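(* Let $P$ be a $2$-dimensional polyhedral space and let $h\colon P\to\mathbb{R}^2$ be a distance non-expanding piecewise linear map. Then for every $\varepsilon>0$ there is a piecewise distance-preserving map $f\colon P\to\mathbb{R}^2$ such that $$|f(x)-h(x)|<\varepsilon$$ for all $x\in P$.
   Context: Metrics take finite values; $|x-y|_X$ denotes the distance in a metric space $X$; $\mathbb{R}^2$ carries the standard Euclidean metric. A map $f\colon X\to Y$ of metric spaces is distance-preserving (respectively distance non-expanding) if $|f(x)-f(x')|_Y=|x-x'|_X$ (respectively $\le$) for all $x,x'\in X$; an isometry is a distance-preserving bijection. The length of a curve (continuous map) $\alpha\colon\mathbb{I}\to X$ on a real interval $\mathbb{I}$ is the supremum of $\sum_{i=1}^k|\alpha(t_{i-1})-\alpha(t_i)|_X$ over all $k\geq 1$ and all $t_0<\dots<t_k$ in $\mathbb{I}$. A metric space $X$ is a length space if for any $x,y\in X$ and any $\delta>0$ there is a curve from $x$ to $y$ of length less than $|x-y|_X+\delta$. A simplicial complex $\mathcal K$ is a finite collection of (Euclidean, non-degenerate) simplices in some $\mathbb{R}^n$ that contains all faces of its simplices and such that any two of its simplices intersect in the empty set or in a common face; $|\mathcal K|\subset\mathbb{R}^n$ is the union of its simplices. A triangulation of a metric space $X$ is a simplicial complex $\mathcal K$ together with a homeomorphism $|\mathcal K|\to X$; the images of simplices of $\mathcal K$ are called the simplices of the triangulation. A polyhedral space is a length space that admits a triangulation such that each of its simplices is isometric to a simplex in Euclidean space; "triangulation" of a polyhedral space always means a triangulation of this kind. The dimension of a polyhedral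 space is the maximal dimension of the simplices in its triangulation (not every simplex need be a face of a simplex of maximal dimension). Each simplex of the triangulation carries barycentric coordinates coming from its isometry with a Euclidean simplex. A map $h\colon P\to\mathbb{R}^n$ from a polyhedral space is piecewise linear if there is a triangulation of $P$ such that for each simplex $\Delta$ with vertices $v_0,\dots,v_k$ and each $x\in\Delta$ with barycentric coordinates $(\lambda_0,\dots,\lambda_k)$ one has $h(x)=\lambda_0 h(v_0)+\dots+\lambda_k h(v_k)$. A map $f\colon P\to\mathbb{R}^n$ is piecewise distance-preserving if there is a triangulation of $P$ such that for every simplex $\Delta$ of the triangulation the restriction $f|_\Delta$ is distance-preserving. *)

theory Defs
  imports "HOL-Analysis.Analysis"
begin

section \<open>Euclidean spaces of arbitrary dimension\<close>

text \<open>
  A dimension that is quantified existentially (``a simplicial complex in some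
  Euclidean space'') cannot be the index type of a vector type.  We therefore use the space of
  finitely supported real sequences with its standard inner product, in which the
  \<open>n\<close>-dimensional Euclidean space is the subset \<open>Rn n\<close> of all sequences vanishing from
  index \<open>n\<close> on; by \<open>dist_Rn\<close> below the induced metric is the Euclidean one.
\<close>

typedef fseq = "{x :: nat \<Rightarrow> real. finite {i. x i \<noteq> 0}}"
  morphisms coord Abs_fseq
  by (rule exI[of _ "\<lambda>_. 0"]) simp

setup_lifting type_definition_fseq

lemma finite_support: "finite {i. coord x i \<noteq> 0}"
  using coord by simp

lemma fseq_eqI: "(\<And>i. coord x i = coord y i) \<Longrightarrow> x = y"
  by (simp add: coord_inject[symmetric] fun_eq_iff)

instantiation fseq :: real_vector
begin

lift_definition zero_fseq :: fseq is "\<lambda>_. 0"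
  by simp

lift_definition plus_fseq :: "fseq \<Rightarrow> fseq \<Rightarrow> fseq" is "\<lambda>x y i. x i + y i"
proof -
  fix x y :: "nat \<Rightarrow> real"
  assume "finite {i. x i \<noteq> 0}" "finite {i. y i \<noteq> 0}"
  then show "finite {i. x i + y i \<noteq> 0}"
    by (rule_tac finite_subset[of _ "{i. x i \<noteq> 0} \<union> {i. y i \<noteq> 0}"]) auto
qed

lift_definition minus_fseq :: "fseq \<Rightarrow> fseq \<Rightarrow> fseq" is "\<lambda>x y i. x i - y i"
proof -
  fix x y :: "nat \<Rightarrow> real"
  assume "finite {i. x i \<noteq> 0}" "finite {i. y i \<noteq> 0}"
  then show "finite {i. x i - y i \<noteq> 0}"
    by (rule_tac finite_subset[of _ "{i. x i \<noteq> 0} \<union> {i. y i \<noteq> 0}"]) auto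
qed

lift_definition uminus_fseq :: "fseq \<Rightarrow> fseq" is "\<lambda>x i. - x i"
  by simp

lift_definition scaleR_fseq :: "real \<Rightarrow> fseq \<Rightarrow> fseq" is "\<lambda>c x i. c * x i"
proof -
  fix c :: real and x :: "nat \<Rightarrow> real"
  assume "finite {i. x i \<noteq> 0}"
  then show "finite {i. c * x i \<noteq> 0}"
    by (rule_tac finite_subset[of _ "{i. x i \<noteq> 0}"]) auto
qed

instance
  by standard (transfer; simp add: fun_eq_iff algebra_simps)+

end

lemma coord_simps [simp]:
  "coord 0 i = 0"
  "coord (x + y) i = coord x i + coord y i"
  "coord (x - y) i = coord x i - coord y i"
  "coord (- x) i = - coord x i"
  "coord (c *\<^sub>R x) i = c * coord x i"
  by (transfer; simp)+

instantiation fseq :: real_inner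
begin

definition inner_fseq :: "fseq \<Rightarrow> fseq \<Rightarrow> real"
  where "inner x y = (\<Sum>i | coord x i \<noteq> 0. coord x i * coord y i)"

definition norm_fseq :: "fseq \<Rightarrow> real"
  where "norm_fseq x = sqrt (inner x x)"

definition sgn_fseq :: "fseq \<Rightarrow> fseq"
  where "sgn_fseq x = x /\<^sub>R norm x"

definition dist_fseq :: "fseq \<Rightarrow> fseq \<Rightarrow> real"
  where "dist_fseq x y = norm (x - y)"

definition uniformity_fseq :: "(fseq \<times> fseq) filter"
  where "uniformity_fseq = (INF e\<in>{0<..}. principal {(x, y). dist x y < e})"

definition open_fseq :: "fseq set \<Rightarrow> bool"
  where "open_fseq U \<longleftrightarrow> (\<forall>x\<in>U. eventually (\<lambda>(x', y). x' = x \<longrightarrow> y \<in> U) uniformity)"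

lemma inner_fseq_eq_sum:
  assumes "finite A" "\<And>i. i \<notin> A \<Longrightarrow> coord x i * coord y i = 0"
  shows "inner x y = (\<Sum>i\<in>A. coord x i * coord y i)"
  unfolding inner_fseq_def
  by (rule sum.mono_neutral_cong) (use assms finite_support in auto)

instance
proof
  fix x y z :: fseq and r :: real
  let ?A = "{i. coord x i \<noteq> 0} \<union> {i. coord y i \<noteq> 0}"
  have fin: "finite ?A"
    using finite_support by simp
  have eq: "inner u v = (\<Sum>i\<in>?A. coord u i * coord v i)"
    if "\<And>i. i \<notin> ?A \<Longrightarrow> coord u i = 0 \<or> coord v i = 0" for u v
    by (rule inner_fseq_eq_sum[OF fin]) (use that in auto)
  have "inner x y = (\<Sum>i\<in>?A. coord x i * coord y i)" "inner y x = (\<Sum>i\<in>?A. coord y i * coord x i)"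
    by (rule eq; simp)+
  then show "inner x y = inner y x"
    by (simp only: mult.commute)
  have "inner (x + y) z = (\<Sum>i\<in>?A. coord (x + y) i * coord z i)"
       "inner x z = (\<Sum>i\<in>?A. coord x i * coord z i)" "inner y z = (\<Sum>i\<in>?A. coord y i * coord z i)"
    by (rule eq; simp)+
  then show "inner (x + y) z = inner x z + inner y z"
    by (simp only: coord_simps distrib_right sum.distrib)
  have "inner (r *\<^sub>R x) y = (\<Sum>i\<in>?A. coord (r *\<^sub>R x) i * coord y i)"
       "inner x y = (\<Sum>i\<in>?A. coord x i * coord y i)"
    by (rule eq; simp)+
  then show "inner (r *\<^sub>R x) y = r * inner x y"
    by (simp only: coord_simps sum_distrib_left mult.assoc)
  show "0 \<le> inner x x"
    unfolding inner_fseq_def by (rule sum_nonneg) simp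
  show "inner x x = 0 \<longleftrightarrow> x = 0"
  proof
    assume "inner x x = 0"
    then have "\<forall>i\<in>{i. coord x i \<noteq> 0}. coord x i * coord x i = 0"
      unfolding inner_fseq_def by (subst (asm) sum_nonneg_eq_0_iff) (auto simp: finite_support)
    then show "x = 0"
      by (intro fseq_eqI) auto
  qed (simp add: inner_fseq_def)
qed (simp_all add: norm_fseq_def sgn_fseq_def dist_fseq_def uniformity_fseq_def open_fseq_def)

end

definition Rn :: "nat \<Rightarrow> fseq set"
  where "Rn n = {x. \<forall>i\<ge>n. coord x i = 0}"

lemma dist_Rn:
  assumes "x \<in> Rn n" "y \<in> Rn n"
  shows "dist x y = sqrt (\<Sum>i<n. (coord x i - coord y i)\<^sup>2)"
proof -
  have "inner (x - y) (x - y) = (\<Sum>i<n. coord (x - y) i * coord (x - y) i)"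
    by (rule inner_fseq_eq_sum) (use assms in \<open>auto simp: Rn_def not_less\<close>)
  then show ?thesis
    by (simp add: dist_fseq_def norm_fseq_def power2_eq_square)
qed


section \<open>Metric notions\<close>

text \<open>A metric space is a subset of a type of class \<open>metric_space\<close>, with the restricted metric.\<close>

definition distance_preserving_on :: "'a::metric_space set \<Rightarrow> ('a \<Rightarrow> 'b::metric_space) \<Rightarrow> bool"
  where "distance_preserving_on X f \<longleftrightarrow> (\<forall>x\<in>X. \<forall>x'\<in>X. dist (f x) (f x') = dist x x')"

definition distance_nonexpanding_on :: "'a::metric_space set \<Rightarrow> ('a \<Rightarrow> 'b::metric_space) \<Rightarrow> bool"
  where "distance_nonexpanding_on X f \<longleftrightarrow> (\<forall>x\<in>X. \<forall>x'\<in>X. dist (f x) (f x') \<le> dist x x')"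

definition isometry_between ::
    "'a::metric_space set \<Rightarrow> 'b::metric_space set \<Rightarrow> ('a \<Rightarrow> 'b) \<Rightarrow> bool"
  where "isometry_between X Y f \<longleftrightarrow> bij_betw f X Y \<and> distance_preserving_on X f"

definition curve_length :: "real set \<Rightarrow> (real \<Rightarrow> 'a::metric_space) \<Rightarrow> ennreal"
  where "curve_length I \<alpha> =
    Sup {ennreal (\<Sum>i=1..k. dist (\<alpha> (t (i - 1))) (\<alpha> (t i))) | k t :: nat \<Rightarrow> real.
      k \<ge> 1 \<and> (\<forall>i\<le>k. t i \<in> I) \<and> (\<forall>i<k. t i < t (Suc i))}"

definition length_space :: "'a::metric_space set \<Rightarrow> bool"
  where "length_space X \<longleftrightarrow>
    (\<forall>x\<in>X. \<forall>y\<in>X. \<forall>\<delta>>0. \<exists>a b \<alpha>. a \<le> b \<and> continuous_on {a..b} \<alpha> \<and> \<alpha> ` {a..b} \<subseteq> X \<and>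
      \<alpha> a = x \<and> \<alpha> b = y \<and> curve_length {a..b} \<alpha> < ennreal (dist x y + \<delta>))"


section \<open>Simplices and simplicial complexes\<close>

text \<open>Simplices are nonempty here, as opposed to the library's \<open>simplex\<close>.  A finite set of points
  of \<^typ>\<open>fseq\<close> always lies in some \<open>Rn n\<close>, so every such simplex is one in some Euclidean space.\<close>

definition simplex_with_vertices :: "fseq set \<Rightarrow> fseq set \<Rightarrow> bool"
  where "simplex_with_vertices V S \<longleftrightarrow>
    finite V \<and> V \<noteq> {} \<and> \<not> affine_dependent V \<and> S = convex hull V"

definition simplex_face :: "fseq set \<Rightarrow> fseq set \<Rightarrow> bool"
  where "simplex_face F S \<longleftrightarrow>
    (\<exists>V W. simplex_with_vertices V S \<and> W \<subseteq> V \<and> W \<noteq> {} \<and> F = convex hull W)"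

definition Rn_simplicial_complex :: "fseq set set \<Rightarrow> bool"
  where "Rn_simplicial_complex K \<longleftrightarrow>
    finite K \<and> (\<exists>n. \<Union>K \<subseteq> Rn n) \<and>
    (\<forall>S\<in>K. \<exists>V. simplex_with_vertices V S) \<and>
    (\<forall>S\<in>K. \<forall>F. simplex_face F S \<longrightarrow> F \<in> K) \<and>
    (\<forall>S\<in>K. \<forall>T\<in>K. S \<inter> T = {} \<or> simplex_face (S \<inter> T) S \<and> simplex_face (S \<inter> T) T)"

definition complex_has_dim :: "fseq set set \<Rightarrow> nat \<Rightarrow> bool"
  where "complex_has_dim K d \<longleftrightarrow>
    (\<exists>S\<in>K. \<exists>V. simplex_with_vertices V S \<and> card V = d + 1) \<and>
    (\<forall>S\<in>K. \<forall>V. simplex_with_vertices V S \<longrightarrow> card V \<le> d + 1)"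


section \<open>Polyhedral spaces\<close>

definition triangulates :: "fseq set set \<Rightarrow> (fseq \<Rightarrow> 'a::metric_space) \<Rightarrow> 'a set \<Rightarrow> bool"
  where "triangulates K \<phi> P \<longleftrightarrow>
    Rn_simplicial_complex K \<and> (\<exists>\<psi>. homeomorphism (\<Union>K) P \<phi> \<psi>)"

definition polyhedral_triangulation ::
    "fseq set set \<Rightarrow> (fseq \<Rightarrow> 'a::metric_space) \<Rightarrow> 'a set \<Rightarrow> bool"
  where "polyhedral_triangulation K \<phi> P \<longleftrightarrow>
    triangulates K \<phi> P \<and>
    (\<forall>S\<in>K. \<exists>V E \<iota>. simplex_with_vertices V E \<and> isometry_between E (\<phi> ` S) \<iota>)"

definition polyhedral_space :: "'a::metric_space set \<Rightarrow> bool"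
  where "polyhedral_space P \<longleftrightarrow> length_space P \<and> (\<exists>K \<phi>. polyhedral_triangulation K \<phi> P)"

definition has_polyhedral_dim :: "'a::metric_space set \<Rightarrow> nat \<Rightarrow> bool"
  where "has_polyhedral_dim P d \<longleftrightarrow>
    (\<exists>K \<phi>. polyhedral_triangulation K \<phi> P \<and> complex_has_dim K d)"

text \<open>
  The vertices and barycentric coordinates of a simplex \<open>\<Delta>\<close> of a polyhedral triangulation are
  those transported by an isometry from a Euclidean simplex.  They do not depend on the choice of
  that isometry, because an isometry between Euclidean simplices is affine.
\<close>

definition barycentric_linear_on ::
    "'a::metric_space set \<Rightarrow> ('a \<Rightarrow> 'b::real_vector) \<Rightarrow> bool"
  where "barycentric_linear_on \<Delta> h \<longleftrightarrow>
    (\<exists>V E \<iota>. simplex_with_vertices V E \<and> isometry_between E \<Delta> \<iota> \<and>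
      (\<forall>c. (\<forall>v\<in>V. 0 \<le> c v) \<and> sum c V = 1 \<longrightarrow>
        h (\<iota> (\<Sum>v\<in>V. c v *\<^sub>R v)) = (\<Sum>v\<in>V. c v *\<^sub>R h (\<iota> v))))"

definition piecewise_linear_on :: "'a::metric_space set \<Rightarrow> ('a \<Rightarrow> 'b::euclidean_space) \<Rightarrow> bool"
  where "piecewise_linear_on P h \<longleftrightarrow>
    (\<exists>K \<phi>. polyhedral_triangulation K \<phi> P \<and> (\<forall>S\<in>K. barycentric_linear_on (\<phi> ` S) h))"

definition piecewise_distance_preserving_on ::
    "'a::metric_space set \<Rightarrow> ('a \<Rightarrow> 'b::euclidean_space) \<Rightarrow> bool"
  where "piecewise_distance_preserving_on P f \<longleftrightarrow>
    (\<exists>K \<phi>. polyhedral_triangulation K \<phi> P \<and> (\<forall>S\<in>K. distance_preserving_on (\<phi> ` S) f))"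

end

theory Submission
  imports Defs
begin

text \<open>
  After scaling, \<open>h\<close> is \<open>L\<close>-Lipschitz with \<open>L < 1\<close>.  A logarithmic cutoff makes it constant near
  every vertex at the cost of an arbitrarily small increase of \<open>L\<close>.  On every edge, fine zigzags of
  unit speed follow \<open>h\<close>; near a vertex all edges use the same zigzag as a function of the distance
  to that vertex, so the finite set of breakpoints, together with a finite net of points off the
  edges, is mapped in a distance non-expanding way: two breakpoints on different edges are either
  close to a common vertex or at a distance that is large compared with the mesh of the zigzags.
  On each simplex, Brehm's theorem extends this finite data to a piecewise distance-preserving map.
  The extensions agree on common edges because a non-expanding map is determined on a segment
  between two points whose distance it preserves.  They are close to \<open>h\<close> because they are so on
  a net.  Finally, edges of the triangulation are subdivided until the lines bounding the pieces of
  the extensions no longer separate the ends of any edge.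
\<close>

section \<open>Brehm's extension theorem\<close>


text \<open>Brehm's theorem is applied to each simplex separately, so the difficulty is to make
  independently chosen extensions agree. Two distinct simplices of dimension at most two share at
  most an edge; hence it is enough to leave no freedom along edges. An extension is free wherever
  the prescribed values are closer together than their points, and it is rigid along a path of unit
  speed. Such a path differs from \<open>h\<close> by an error of the order of its mesh
  \<open>d\<close>. The gap \<open>1 - L\<close> pays for the error: values at two points of
  distance \<open>r\<close> may be moved by \<open>(1 - L) * r\<close> in total. This budget tends
  to 0 when points of two edges approach a common vertex, however small the mesh. That is why
  \<open>h\<close> is made constant near vertices and one zigzag is shared there: it depends only on
  the distance to the vertex, so the triangle inequality replaces the budget. Away from the vertices
  a compactness argument bounds the distances between different edges from below before the mesh is
  chosen.\<close>

definition rigid_motion :: "('a::euclidean_space \<Rightarrow> 'a) \<Rightarrow> bool"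
  where "rigid_motion g \<longleftrightarrow> (\<forall>x y. dist (g x) (g y) = dist x y)"

text \<open>Overlapping pieces carry the same function \<open>f\<close>, so continuity across their
  closed boundaries is automatic. The isometries are global in order that they can be composed with
  reflections and have preimages outside the piece.\<close>

definition piecewise_isometric :: "'a::euclidean_space set \<Rightarrow> 'a set set \<Rightarrow> ('a \<Rightarrow> 'a) \<Rightarrow> bool"
  where "piecewise_isometric Q \<C> f \<longleftrightarrow> finite \<C> \<and> \<Union>\<C> = Q \<and>
    (\<forall>C\<in>\<C>. polytope C \<and> (\<exists>g. rigid_motion g \<and> (\<forall>x\<in>C. f x = g x)))"

lemma rigid_motion_affine:
  assumes "rigid_motion g"
  shows "g (a + s *\<^sub>R (z - a)) = g a + s *\<^sub>R (g z - g a)"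
proof -
  have "orthogonal_transformation (\<lambda>x. g x - g 0)"
    using assms by (auto simp: orthogonal_transformation_isometry rigid_motion_def dist_norm)
  then have l: "linear (\<lambda>x. g x - g 0)"
    by (rule orthogonal_transformation_linear)
  have "g (a + s *\<^sub>R (z - a)) - g 0 = (g a - g 0) + s *\<^sub>R ((g z - g 0) - (g a - g 0))"
    by (simp only: linear_add[OF l] linear_scale[OF l] linear_diff[OF l])
  also have "(g z - g 0) - (g a - g 0) = g z - g a"
    by simp
  finally have "g (a + s *\<^sub>R (z - a)) = (g a - g 0 + s *\<^sub>R (g z - g a)) + g 0"
    by (simp only: diff_eq_eq)
  then show ?thesis
    by simp
qed

lemma rigid_motion_surj:
  assumes "rigid_motion g"
  shows "\<exists>a. g a = b"
proof -
  have "orthogonal_transformation (\<lambda>x. g x - g 0)"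
    using assms by (auto simp: orthogonal_transformation_isometry rigid_motion_def dist_norm)
  then have "surj (\<lambda>x. g x - g 0)"
    by (rule orthogonal_transformation_surj)
  then have "\<exists>a. b - g 0 = g a - g 0"
    by (rule surjD)
  then show ?thesis
    by simp metis
qed

lemma reflection_exists:
  fixes a a' :: "'a::euclidean_space"
  obtains r where "rigid_motion r" "r a = a'" "\<And>z. dist z a = dist z a' \<Longrightarrow> r z = z"
proof -
  define n m where "n = a' - a" and "m = (1/2) *\<^sub>R (a + a')"
  \<comment> \<open>Reflection in the perpendicular bisector of \<open>a\<close> and
    \<open>a'\<close>. For \<open>a = a'\<close> the normal \<open>n\<close> is 0 and
    \<open>\<rho>\<close> is the identity, as it should be.\<close>
  define \<rho> where "\<rho> w = w - (2 * (w \<bullet> n) / (n \<bullet> n)) *\<^sub>R n" for w :: 'a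
  define r where "r y = m + \<rho> (y - m)" for y
  have nm: "norm (\<rho> w) = norm w" for w
  proof (cases "n = 0")
    case False
    then have nn: "n \<bullet> n \<noteq> 0" by simp
    have "\<rho> w \<bullet> \<rho> w = w \<bullet> w"
      unfolding \<rho>_def using nn by (simp add: inner_diff inner_commute[of n w] field_simps power2_eq_square)
    then show ?thesis
      by (simp add: norm_eq_sqrt_inner)
  qed (simp add: \<rho>_def)
  have dd: "\<rho> v - \<rho> w = \<rho> (v - w)" for v w
    by (simp add: \<rho>_def inner_diff_left algebra_simps diff_divide_distrib)
  have "rigid_motion r"
    unfolding rigid_motion_def dist_norm r_def
    by (metis (no_types, lifting) add_diff_cancel_left dd diff_diff_eq2 diff_add_cancel nm)
  moreover have "r a = a'"
  proof (cases "n = 0")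
    case True
    then show ?thesis by (simp add: r_def \<rho>_def n_def)
  next
    case False
    have am: "a - m = - (1/2) *\<^sub>R n"
    proof -
      have "2 *\<^sub>R (a - m) = - n" by (simp add: m_def n_def algebra_simps scaleR_2)
      then have "(1/2) *\<^sub>R (2 *\<^sub>R (a - m)) = (1/2) *\<^sub>R (- n)" by (rule arg_cong)
      then show ?thesis by simp
    qed
    have "\<rho> (a - m) = (1/2) *\<^sub>R n"
    proof -
      have "\<rho> (a - m) = (-(1/2)) *\<^sub>R n + 1 *\<^sub>R n"
        unfolding am \<rho>_def using False by simp
      then show ?thesis unfolding scaleR_left_distrib[symmetric] by simp
    qed
    then have "r a = m + (1/2) *\<^sub>R n"
      by (simp add: r_def)
    also have "\<dots> = (1/2) *\<^sub>R (2 *\<^sub>R a')"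
      by (simp add: m_def n_def scaleR_2 flip: scaleR_add_right)
    finally show ?thesis by simp
  qed
  moreover have "r z = z" if "dist z a = dist z a'" for z
  proof -
    have "(z - a) \<bullet> (z - a) = (z - a') \<bullet> (z - a')"
      using that by (simp add: dist_norm norm_eq_sqrt_inner)
    then have "(z - m) \<bullet> n = 0"
      by (simp add: m_def n_def inner_diff inner_add inner_commute algebra_simps)
    then show ?thesis
      by (simp add: r_def \<rho>_def)
  qed
  ultimately show ?thesis
    using that by blast
qed

text \<open>Along the segment from \<open>x\<close> to \<open>y\<close>, which stays in
  \<open>Q\<close> by convexity, the pieces cut the parameter interval into finitely many closed
  sets. On each the path has Lipschitz constant \<open>dist x y\<close>, and such bounds glue over a
  finite closed cover of an interval.\<close>

lemma piecewise_isometric_nonexpanding: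
  assumes pw: "piecewise_isometric Q \<C> f" and "convex Q" "x \<in> Q" "y \<in> Q"
  shows "dist (f x) (f y) \<le> dist x y"
proof -
  define \<gamma> where "\<gamma> t = x + t *\<^sub>R (y - x)" for t
  have cont: "continuous_on {0..1} \<gamma>"
    unfolding \<gamma>_def by (intro continuous_intros)
  have "(dist x y)-lipschitz_on {0..1} (f \<circ> \<gamma>)"
  proof (rule lipschitz_on_closed_Union)
    show "finite \<C>" using pw by (simp add: piecewise_isometric_def)
    show "dist x y \<ge> 0" by simp
    fix C assume C: "C \<in> \<C>"
    then have "polytope C" using pw by (auto simp: piecewise_isometric_def)
    then show "closed ({0..1} \<inter> \<gamma> -` C)"
      by (intro continuous_closed_preimage cont) (auto simp: polytope_imp_closed)
    obtain g where g: "rigid_motion g" "\<And>x. x \<in> C \<Longrightarrow> f x = g x"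
      using C pw by (auto simp: piecewise_isometric_def)
    show "(dist x y)-lipschitz_on ({0..1} \<inter> \<gamma> -` C) (f \<circ> \<gamma>)"
    proof (rule lipschitz_onI)
      fix s t assume "s \<in> {0..1} \<inter> \<gamma> -` C" "t \<in> {0..1} \<inter> \<gamma> -` C"
      then have "dist ((f \<circ> \<gamma>) s) ((f \<circ> \<gamma>) t) = dist (\<gamma> s) (\<gamma> t)"
        using g by (auto simp: rigid_motion_def)
      also have "\<dots> = norm ((s - t) *\<^sub>R (y - x))"
        by (simp add: \<gamma>_def dist_norm algebra_simps)
      also have "\<dots> = dist x y * dist s t"
        by (simp add: dist_norm norm_minus_commute)
      finally show "dist ((f \<circ> \<gamma>) s) ((f \<circ> \<gamma>) t) \<le> dist x y * dist s t" by simp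
    qed simp
  next
    have "\<gamma> t \<in> Q" if "t \<in> {0..1}" for t
      using \<open>convex Q\<close> \<open>x \<in> Q\<close> \<open>y \<in> Q\<close> that convexD_alt[of Q x y t]
      by (auto simp: \<gamma>_def algebra_simps)
    then show "{0..1} \<subseteq> (\<Union>C\<in>\<C>. {0..1} \<inter> \<gamma> -` C)"
      using pw by (auto simp: piecewise_isometric_def)
  qed
  from lipschitz_onD[OF this, of 0 1] show ?thesis
    by (simp add: \<gamma>_def)
qed

text \<open>
  By the triangle inequality, the set where \<open>dist (f x) b > dist x a\<close> is star-shaped about \<open>a\<close>.
  The new map sends each segment from \<open>a\<close> to a point \<open>z\<close> with \<open>dist (f z) b = dist z a\<close> isometrically
  to the segment from \<open>b\<close> to \<open>f z\<close>; on the cone over the intersection of a piece with the bisector,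
  this is the old isometry composed with a reflection.  The assumption on the frontier makes every
  ray from \<open>a\<close> leave the star-shaped set within \<open>Q\<close>.
\<close>

lemma brehm_step:
  fixes f :: "'a::euclidean_space \<Rightarrow> 'a"
  assumes pw: "piecewise_isometric Q \<C> f" and Q: "convex Q" "compact Q" and aQ: "a \<in> interior Q"
    and fr: "\<And>x. x \<in> frontier Q \<Longrightarrow> dist (f x) b \<le> dist x a"
  obtains f' \<C>' where "piecewise_isometric Q \<C>' f'" "f' a = b"
    "\<And>x. dist (f x) b \<le> dist x a \<Longrightarrow> f' x = f x"
    "\<And>x. x \<in> Q \<Longrightarrow> \<exists>y\<in>Q. f' x \<in> closed_segment b (f y)"
proof -
  have lip: "dist (f x) (f y) \<le> dist x y" if "x \<in> Q" "y \<in> Q" for x y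
    using piecewise_isometric_nonexpanding[OF pw Q(1)] that by blast
  have fin: "finite \<C>" and UQ: "\<Union>\<C> = Q" using pw by (auto simp: piecewise_isometric_def)
  define Eq where "Eq = {z \<in> Q. dist z a = dist (f z) b}"
  define f' where "f' x = (if dist (f x) b \<le> dist x a then f x else
    (SOME y. \<exists>z\<in>Eq. \<exists>s. 0 \<le> s \<and> s \<le> 1 \<and> x = a + s *\<^sub>R (z - a) \<and> y = b + s *\<^sub>R (f z - b)))" for x
  \<comment> \<open>Well-definedness: two points of \<open>Eq\<close> on one ray from
    \<open>a\<close> prescribe the same value. Distances to \<open>a\<close> and \<open>b\<close>
    match and \<open>f\<close> is non-expanding, so inner products seen from \<open>b\<close> are at
    least those seen from \<open>a\<close>. Passing to the images can therefore only shrink the norm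
    of the difference, which is 0 already.\<close>
  have K0: "s *\<^sub>R (f z - b) = s' *\<^sub>R (f z' - b)"
    if z: "z \<in> Eq" "z' \<in> Eq" "0 \<le> s" "0 \<le> s'" and e: "s *\<^sub>R (z - a) = s' *\<^sub>R (z' - a)" for z z' s s'
  proof -
    have n1: "(f z - b) \<bullet> (f z - b) = (z - a) \<bullet> (z - a)" "(f z' - b) \<bullet> (f z' - b) = (z' - a) \<bullet> (z' - a)"
      using z by (auto simp: Eq_def dist_norm dot_square_norm)
    have "(norm (f z - f z'))\<^sup>2 \<le> (norm (z - z'))\<^sup>2"
      using lip[of z z'] z by (intro power_mono) (auto simp: Eq_def dist_norm)
    then have "((f z - b) - (f z' - b)) \<bullet> ((f z - b) - (f z' - b)) \<le> ((z - a) - (z' - a)) \<bullet> ((z - a) - (z' - a))"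
      by (simp add: dot_square_norm)
    then have i: "(z - a) \<bullet> (z' - a) \<le> (f z - b) \<bullet> (f z' - b)"
      using n1 by (simp only: inner_diff_left[of "f z - b"] inner_diff_right[of _ "f z - b"]
         inner_diff_left[of "z - a" "z' - a"] inner_diff_right[of _ "z - a" "z' - a"]
         inner_commute[of "f z' - b" "f z - b"] inner_commute[of "z' - a" "z - a"])
    define u v p q where "u = f z - b" and "v = f z' - b" and "p = z - a" and "q = z' - a"
    have "(norm (s *\<^sub>R u - s' *\<^sub>R v))\<^sup>2 = s * s * (u \<bullet> u) + s' * s' * (v \<bullet> v) - 2 * (s * s') * (u \<bullet> v)"
      by (simp add: power2_norm_eq_inner inner_diff inner_commute algebra_simps)
    also have "\<dots> \<le> s * s * (p \<bullet> p) + s' * s' * (q \<bullet> q) - 2 * (s * s') * (p \<bullet> q)"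
      using n1 i mult_left_mono[OF i, of "s * s'"] z(3,4) by (simp add: u_def v_def p_def q_def)
    also have "\<dots> = (norm (s *\<^sub>R p - s' *\<^sub>R q))\<^sup>2"
      by (simp add: power2_norm_eq_inner inner_diff inner_commute algebra_simps)
    also have "\<dots> = 0" using e by (simp add: p_def q_def)
    finally show ?thesis by (simp add: u_def v_def)
  qed
  have K: "f' (a + s *\<^sub>R (z - a)) = b + s *\<^sub>R (f z - b)" if z: "z \<in> Eq" "0 \<le> s" "s \<le> 1" for z s
  proof -
    define x where "x = a + s *\<^sub>R (z - a)"
    show ?thesis
    proof (cases "dist (f x) b \<le> dist x a")
      case True
      \<comment> \<open>Here \<open>f'\<close> keeps the old value. The triangle inequality along
        the segment from \<open>a\<close> to \<open>z\<close> forces equality, so \<open>x\<close>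
        itself lies in \<open>Eq\<close> and \<open>K0\<close> applies with \<open>s = 1\<close> at
        \<open>x\<close>.\<close>
      have "a \<in> Q" using aQ interior_subset by blast
      then have xQ: "x \<in> Q"
        using Q(1) z convexD_alt[of Q a z s] by (auto simp: x_def Eq_def algebra_simps)
      have "dist z x + dist x a = dist z a"
      proof -
        have "z - x = (1 - s) *\<^sub>R (z - a)" "x - a = s *\<^sub>R (z - a)"
          by (auto simp: x_def algebra_simps)
        then have "dist z x = (1 - s) * dist z a" "dist x a = s * dist z a"
          unfolding dist_norm using z(2,3) by auto
        then show ?thesis by (simp add: algebra_simps)
      qed
      moreover have "dist (f z) b \<le> dist (f z) (f x) + dist (f x) b" by (rule dist_triangle)
      moreover have "dist (f z) (f x) \<le> dist z x" using lip xQ z by (auto simp: Eq_def)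
      ultimately have "dist (f x) b = dist x a" using True z by (auto simp: Eq_def)
      then have "x \<in> Eq" using xQ by (auto simp: Eq_def)
      from K0[OF this z(1), of 1 s] z have "f x - b = s *\<^sub>R (f z - b)" by (auto simp: x_def)
      then show ?thesis using True unfolding f'_def x_def[symmetric] by (simp add: algebra_simps)
    next
      case False
      have "\<exists>y. \<exists>z\<in>Eq. \<exists>s. 0 \<le> s \<and> s \<le> 1 \<and> x = a + s *\<^sub>R (z - a) \<and> y = b + s *\<^sub>R (f z - b)"
        using z x_def by blast
      from someI_ex[OF this] False obtain z' s' where
        *: "z' \<in> Eq" "0 \<le> s'" "s' \<le> 1" "x = a + s' *\<^sub>R (z' - a)" "f' x = b + s' *\<^sub>R (f z' - b)"
        unfolding f'_def by auto
      then have "s' *\<^sub>R (f z' - b) = s *\<^sub>R (f z - b)"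
        using z by (intro K0) (auto simp: x_def)
      then show ?thesis using * by (simp flip: x_def)
    qed
  qed
  have contf: "continuous_on Q f"
    using lip by (intro lipschitz_on_continuous_on[of 1]) (auto intro!: lipschitz_onI)
  have cover: "\<exists>z\<in>Eq. \<exists>s. 0 \<le> s \<and> s \<le> 1 \<and> x = a + s *\<^sub>R (z - a)"
    if x: "x \<in> Q" "dist (f x) b > dist x a" for x
  proof -
    obtain i0 :: 'a where "i0 \<in> Basis" using nonempty_Basis by blast
    \<comment> \<open>For \<open>x = a\<close> any direction does. Together with the parameter
      \<open>c\<close> of \<open>x\<close> on the ray, which is 0 or 1, this lets one intermediate
      value argument serve both cases.\<close>
    define l where "l = (if x = a then i0 else x - a)"
    have l0: "l \<noteq> 0" using \<open>i0 \<in> Basis\<close> by (auto simp: l_def)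
    obtain d where d: "0 < d" "a + d *\<^sub>R l \<in> frontier Q"
      using ray_to_frontier[OF compact_imp_bounded[OF Q(2)] aQ l0] by blast
    define c where "c = (if x = a then 0 else 1::real)"
    have xc: "x = a + c *\<^sub>R l" by (simp add: l_def c_def)
    define y where "y = a + d *\<^sub>R l"
    have yQ: "y \<in> Q" using d(2) Q(2) compact_imp_closed frontier_subset_closed y_def by blast
    have cd: "c \<le> d"
    proof (rule ccontr)
      assume "\<not> c \<le> d"
      then have c1: "c = 1" "d < 1" and xa: "x \<noteq> a" using d(1) by (auto simp: c_def split: if_splits)
      have "y \<in> open_segment a x"
        using xa c1 d(1) by (auto simp: in_segment y_def l_def algebra_simps intro!: exI[of _ d])
      then have "y \<in> interior Q"
        using in_interior_closure_convex_segment[OF Q(1) aQ, of x] x(1) closure_subset by blast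
      then show False using d(2) by (simp add: y_def frontier_def)
    qed
    define \<gamma> where "\<gamma> t = a + t *\<^sub>R l" for t
    have \<gamma>Q: "\<gamma> t \<in> Q" if "c \<le> t" "t \<le> d" for t
    proof -
      have t0: "0 \<le> t" using that by (auto simp: c_def split: if_splits)
      have "\<gamma> t = (1 - t/d) *\<^sub>R a + (t/d) *\<^sub>R y"
        using d(1) by (simp add: y_def \<gamma>_def algebra_simps)
      moreover have "a \<in> Q" using aQ interior_subset by blast
      ultimately show ?thesis using convexD_alt[OF Q(1) _ yQ, of a "t/d"] t0 that d(1) by auto
    qed
    define q where "q t = dist (f (\<gamma> t)) b - dist (\<gamma> t) a" for t
    have "continuous_on {c..d} q"
      unfolding q_def
    proof (intro continuous_intros)
      show "continuous_on {c..d} \<gamma>" unfolding \<gamma>_def by (intro continuous_intros)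
      then show "continuous_on {c..d} (\<lambda>x. f (\<gamma> x))"
        by (rule continuous_on_compose2[OF contf]) (use \<gamma>Q in auto)
    qed
    moreover have "q d \<le> 0" "0 \<le> q c"
      using fr[OF d(2)] x(2) by (auto simp: q_def \<gamma>_def simp flip: xc)
    ultimately obtain t where t: "c \<le> t" "t \<le> d" "q t = 0"
      using IVT2'[of q d 0 c] cd by auto
    have zE: "\<gamma> t \<in> Eq" using t \<gamma>Q by (auto simp: Eq_def q_def)
    have "\<exists>s. 0 \<le> s \<and> s \<le> 1 \<and> x = a + s *\<^sub>R (\<gamma> t - a)"
    proof (cases "x = a")
      case True
      then show ?thesis by (intro exI[of _ 0]) auto
    next
      case False
      then show ?thesis using t by (intro exI[of _ "1/t"]) (auto simp: \<gamma>_def c_def l_def)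
    qed
    then show ?thesis using zE by blast
  qed
  have aa: "\<exists>a'. g a' = b" if "rigid_motion g" for g :: "'a \<Rightarrow> 'a"
    using rigid_motion_surj[OF that] by blast
  have "\<forall>C\<in>\<C>. \<exists>g a'. rigid_motion g \<and> (\<forall>x\<in>C. f x = g x) \<and> g a' = b"
    using pw aa unfolding piecewise_isometric_def by blast
  then obtain g0 a0 where ga: "\<And>C. C \<in> \<C> \<Longrightarrow> rigid_motion (g0 C) \<and> (\<forall>x\<in>C. f x = g0 C x) \<and> g0 C (a0 C) = b"
    by metis
  have da: "dist (f x) b = dist x (a0 C)" if "C \<in> \<C>" "x \<in> C" for C x
    using ga[OF that(1)] that(2) by (metis rigid_motion_def)
  \<comment> \<open>Since \<open>a0 C\<close> is the preimage of \<open>b\<close> under the isometry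
    of \<open>C\<close>, comparing \<open>dist (f x) b\<close> with \<open>dist x a\<close> on
    \<open>C\<close> amounts to comparing distances to \<open>a0 C\<close> and \<open>a\<close>.
    Thus \<open>C1 C\<close> is the half of \<open>C\<close> with unchanged values,
    \<open>E C\<close> its part on the bisector, and \<open>C2 C\<close> the cone over the
    latter.\<close>
  define C1 where "C1 C = C \<inter> {x. dist x (a0 C) \<le> dist x a}" for C
  define E where "E C = C \<inter> {x. dist x (a0 C) = dist x a}" for C
  define C2 where "C2 C = convex hull (insert a (E C))" for C
  define \<C>' where "\<C>' = C1 ` \<C> \<union> C2 ` {C \<in> \<C>. E C \<noteq> {}}"
  have pC: "polytope C" if "C \<in> \<C>" for C using pw that by (auto simp: piecewise_isometric_def)
  have E_eq: "E C = C \<inter> {x. (2 *\<^sub>R (a - a0 C)) \<bullet> x = a \<bullet> a - a0 C \<bullet> a0 C}" for C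
    unfolding E_def by (auto simp: dist_norm norm_eq_sqrt_inner inner_diff inner_commute algebra_simps)
  have C1_eq: "C1 C = C \<inter> {x. (2 *\<^sub>R (a - a0 C)) \<bullet> x \<le> a \<bullet> a - a0 C \<bullet> a0 C}" for C
    unfolding C1_def by (auto simp: dist_norm norm_eq_sqrt_inner inner_diff inner_commute algebra_simps)
  have pE: "polytope (E C)" if "C \<in> \<C>" for C
    unfolding E_eq by (intro polytope_Int_polyhedron pC that polyhedron_hyperplane)
  have pC1: "polytope (C1 C)" if "C \<in> \<C>" for C
    unfolding C1_eq by (intro polytope_Int_polyhedron pC that polyhedron_halfspace_le)
  have pC2: "polytope (C2 C)" if C: "C \<in> \<C>" for C
  proof -
    obtain V where V: "finite V" "E C = convex hull V" using pE[OF C] by (auto simp: polytope_def)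
    have "C2 C = convex hull (insert a V)"
      unfolding C2_def V(2) by (rule hull_insert[symmetric])
    then show ?thesis using V by (simp add: polytope_convex_hull)
  qed
  have E_Eq: "E C \<subseteq> Eq" if "C \<in> \<C>" for C
    using that UQ da[OF that] by (auto simp: E_def Eq_def)
  have C2D: "\<exists>z\<in>E C. \<exists>s. 0 \<le> s \<and> s \<le> 1 \<and> x = a + s *\<^sub>R (z - a)"
    if C: "C \<in> \<C>" "E C \<noteq> {}" "x \<in> C2 C" for C x
  proof -
    have "convex hull E C = E C"
      using pE[OF C(1)] polytope_imp_convex convex_hull_eq by blast
    then obtain u v z where *: "u \<ge> 0" "v \<ge> 0" "u + v = 1" "z \<in> E C" "x = u *\<^sub>R a + v *\<^sub>R z"
      using C(3) unfolding C2_def convex_hull_insert[OF C(2)] by auto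
    then have "u = 1 - v" by simp
    with * have "x = a + v *\<^sub>R (z - a)" by (simp add: algebra_simps)
    then show ?thesis using *(1-4) by (intro bexI[of _ z] exI[of _ v]) auto
  qed
  have aQ': "a \<in> Q" using aQ interior_subset by blast
  have "piecewise_isometric Q \<C>' f'"
    unfolding piecewise_isometric_def
  proof (intro conjI ballI)
    show "finite \<C>'" using fin by (simp add: \<C>'_def)
    have "x \<in> \<Union>\<C>'" if x: "x \<in> Q" for x
    proof (cases "dist (f x) b \<le> dist x a")
      case True
      obtain C where C: "C \<in> \<C>" "x \<in> C" using x UQ by auto
      then have "x \<in> C1 C" using True da[OF C] by (auto simp: C1_def)
      then show ?thesis using C by (auto simp: \<C>'_def)
    next
      case False
      then obtain z s where z: "z \<in> Eq" "0 \<le> s" "s \<le> 1" "x = a + s *\<^sub>R (z - a)"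
        using cover[OF x] by force
      obtain C where C: "C \<in> \<C>" "z \<in> C" using z UQ by (auto simp: Eq_def)
      have zE: "z \<in> E C" using z da[OF C] C by (auto simp: E_def Eq_def)
      have "x = (1 - s) *\<^sub>R a + s *\<^sub>R z" using z by (simp add: algebra_simps)
      moreover have "a \<in> C2 C" "z \<in> C2 C" using zE by (auto simp: C2_def hull_inc)
      ultimately have "x \<in> C2 C" using convexD_alt[of "C2 C" a z s] z by (auto simp: C2_def)
      then show ?thesis using C zE by (auto simp: \<C>'_def)
    qed
    moreover have "C2 C \<subseteq> Q" if "C \<in> \<C>" for C
      unfolding C2_def using that UQ aQ' by (intro hull_minimal Q(1)) (auto simp: E_def)
    ultimately have "Q \<subseteq> \<Union>\<C>'" "\<And>D. D \<in> \<C>' \<Longrightarrow> D \<subseteq> Q"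
      using UQ unfolding \<C>'_def C1_def by blast+
    then show "\<Union>\<C>' = Q" by blast
    fix D assume D: "D \<in> \<C>'"
    show "polytope D" using D pC1 pC2 by (auto simp: \<C>'_def)
    show "\<exists>g. rigid_motion g \<and> (\<forall>x\<in>D. f' x = g x)"
    proof (cases "D \<in> C1 ` \<C>")
      case True
      then obtain C where C: "C \<in> \<C>" "D = C1 C" by auto
      have "f' x = g0 C x" if "x \<in> D" for x
        using that ga[OF C(1)] da[OF C(1)] C(2) by (auto simp: f'_def C1_def)
      then show ?thesis using ga[OF C(1)] by blast
    next
      case False
      then obtain C where C: "C \<in> \<C>" "E C \<noteq> {}" "D = C2 C" using D by (auto simp: \<C>'_def)
      obtain r where r: "rigid_motion r" "r a = a0 C" "\<And>z. dist z a = dist z (a0 C) \<Longrightarrow> r z = z"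
        using reflection_exists by blast
      note g = ga[OF C(1)]
      have "f' x = (g0 C \<circ> r) x" if xD: "x \<in> D" for x
      proof -
        obtain z s where z: "z \<in> E C" "0 \<le> s" "s \<le> 1" "x = a + s *\<^sub>R (z - a)"
          using C2D[OF C(1,2)] xD C(3) by blast
        have "f' x = b + s *\<^sub>R (f z - b)" using K z E_Eq[OF C(1)] by auto
        moreover have "r z = z" "f z = g0 C z" using r(3) z(1) g by (auto simp: E_def)
        ultimately show ?thesis
          using g r(2) by (simp add: z(4) rigid_motion_affine[OF r(1)] rigid_motion_affine[of "g0 C"])
      qed
      moreover have "rigid_motion (g0 C \<circ> r)" using g r(1) by (simp add: rigid_motion_def)
      ultimately show ?thesis by blast
    qed
  qed
  moreover have "f' a = b"
  proof (cases "f a = b")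
    case False
    then obtain z s where "z \<in> Eq" using cover[of a] aQ' by auto
    then show ?thesis using K[of z 0] by simp
  qed (simp add: f'_def)
  moreover have "dist (f x) b \<le> dist x a \<Longrightarrow> f' x = f x" for x by (simp add: f'_def)
  moreover have "\<exists>y\<in>Q. f' x \<in> closed_segment b (f y)" if x: "x \<in> Q" for x
  proof (cases "dist (f x) b \<le> dist x a")
    case True
    then show ?thesis using x by (intro bexI[of _ x]) (auto simp: f'_def)
  next
    case False
    then obtain z s where z: "z \<in> Eq" "0 \<le> s" "s \<le> 1" "x = a + s *\<^sub>R (z - a)"
      using cover[OF x] by force
    then have "f' x = (1 - s) *\<^sub>R b + s *\<^sub>R f z" using K[OF z(1-3)] by (simp only:) (simp add: algebra_simps)
    then have "f' x \<in> closed_segment b (f z)" using z unfolding in_segment by blast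
    then show ?thesis using z by (auto simp: Eq_def)
  qed
  ultimately show ?thesis using that by blast
qed


text \<open>
  The induction starts with a map folding space into the unit cube: its bounded image provides the
  assumption on the frontier of a large box, and the bound survives every step, because new values
  lie on segments between old ones and the new value \<open>b\<close>.
\<close>

definition fold_unit :: "real \<Rightarrow> real"
  where "fold_unit t = (if even \<lfloor>t\<rfloor> then t - of_int \<lfloor>t\<rfloor> else of_int \<lfloor>t\<rfloor> + 1 - t)"

text \<open>The interval is closed on both sides: at its right end the floor has already jumped, but
  the formulas of neighbouring intervals agree there. A closed unit cube therefore carries a single
  isometry.\<close>

lemma fold_unit_interval:
  assumes "of_int k \<le> t" "t \<le> of_int k + 1"
  shows "fold_unit t = (if even k then t - of_int k else of_int k + 1 - t)"
proof (cases "t = of_int k + 1")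
  case True
  then have "\<lfloor>t\<rfloor> = k + 1" by simp
  then show ?thesis using True by (simp add: fold_unit_def)
next
  case False
  then have "\<lfloor>t\<rfloor> = k" using assms by (simp add: floor_eq_iff)
  then show ?thesis by (simp add: fold_unit_def)
qed

lemma folding_exists:
  fixes N :: nat
  assumes "N > 0"
  obtains \<C> and f :: "'a::euclidean_space \<Rightarrow> 'a"
  where "piecewise_isometric (cbox (- real N *\<^sub>R One) (real N *\<^sub>R One)) \<C> f"
    "\<And>x. norm (f x) \<le> real DIM('a)"
proof -
  define f :: "'a \<Rightarrow> 'a" where "f x = (\<Sum>b\<in>Basis. fold_unit (x \<bullet> b) *\<^sub>R b)" for x
  define D :: "('a \<Rightarrow> int) \<Rightarrow> 'a set" where
    "D k = cbox (\<Sum>b\<in>Basis. of_int (k b) *\<^sub>R b) (\<Sum>b\<in>Basis. (of_int (k b) + 1) *\<^sub>R b)" for k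
  define KK where "KK = (Basis::'a set) \<rightarrow>\<^sub>E {- int N..<int N}"
  define g :: "('a \<Rightarrow> int) \<Rightarrow> 'a \<Rightarrow> 'a" where
    "g k x = (\<Sum>b\<in>Basis. (if even (k b) then x \<bullet> b - of_int (k b) else of_int (k b) + 1 - x \<bullet> b) *\<^sub>R b)" for k x
  have memD: "x \<in> D k \<longleftrightarrow> (\<forall>b\<in>Basis. of_int (k b) \<le> x \<bullet> b \<and> x \<bullet> b \<le> of_int (k b) + 1)" for x k
    by (simp add: D_def mem_box)
  have "piecewise_isometric (cbox (- real N *\<^sub>R One) (real N *\<^sub>R One)) (D ` KK) f"
    unfolding piecewise_isometric_def
  proof (intro conjI ballI)
    show "finite (D ` KK)" unfolding KK_def by (intro finite_imageI finite_PiE) auto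
    show "\<Union>(D ` KK) = cbox (- real N *\<^sub>R One) (real N *\<^sub>R One)"
    proof (intro equalityI subsetI)
      fix x assume "x \<in> \<Union>(D ` KK)"
      then obtain k where k: "k \<in> KK" "x \<in> D k" by auto
      have "- real N \<le> x \<bullet> b \<and> x \<bullet> b \<le> real N" if b: "b \<in> Basis" for b
      proof -
        have "k b \<in> {- int N..<int N}" using k b by (auto simp: KK_def)
        then have "- real N \<le> of_int (k b)" "of_int (k b) + 1 \<le> real N" by auto
        then show ?thesis using k(2) b by (auto simp: memD dest!: bspec[of _ _ b])
      qed
      then show "x \<in> cbox (- real N *\<^sub>R One) (real N *\<^sub>R One)" by (auto simp: mem_box)
    next
      fix x :: 'a assume "x \<in> cbox (- real N *\<^sub>R One) (real N *\<^sub>R One)"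
      then have x: "- real N \<le> x \<bullet> b \<and> x \<bullet> b \<le> real N" if "b \<in> Basis" for b
        using that by (auto simp: mem_box)
      show "x \<in> \<Union>(D ` KK)"
      proof -
        \<comment> \<open>The minimum assigns points with a coordinate equal to
          \<open>real N\<close>, whose floor is \<open>int N\<close>, to the last cube.\<close>
        define k where "k = (\<lambda>b\<in>Basis. min \<lfloor>x \<bullet> b\<rfloor> (int N - 1))"
        have "k \<in> KK" using x \<open>N > 0\<close> by (auto simp: k_def KK_def le_floor_iff)
        moreover have "x \<in> D k"
          unfolding memD using x by (auto simp: k_def min_def not_le floor_le_iff le_floor_iff split: if_splits; linarith?)
        ultimately show ?thesis by blast
      qed
    qed
    fix C assume "C \<in> D ` KK"
    then obtain k where k: "C = D k" by blast
    show "polytope C" by (simp add: k D_def polytope_interval)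
    have "f x = g k x" if "x \<in> C" for x
      unfolding f_def g_def
      by (rule sum.cong) (use that in \<open>auto simp: k memD fold_unit_interval\<close>)
    moreover have "dist (g k x) (g k y) = dist x y" for x y
      by (subst (1 2) euclidean_dist_l2) (intro L2_set_cong, auto simp: g_def dist_real_def)
    ultimately show "\<exists>g. rigid_motion g \<and> (\<forall>x\<in>C. f x = g x)"
      by (auto simp: rigid_motion_def)
  qed
  moreover have "norm (f x) \<le> real DIM('a)" for x
  proof -
    have "\<bar>fold_unit t\<bar> \<le> 1" for t by (auto simp: fold_unit_def abs_if) linarith+
    then have "norm (f x) \<le> (\<Sum>b\<in>(Basis::'a set). 1)"
      unfolding f_def by (intro sum_norm_le) auto
    then show ?thesis by simp
  qed
  ultimately show ?thesis using that by blast
qed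

theorem brehm_extension:
  fixes G :: "('a::euclidean_space \<times> 'a) set" and r :: real
  assumes "finite G" and short: "\<And>a b a' b'. (a, b) \<in> G \<Longrightarrow> (a', b') \<in> G \<Longrightarrow> dist b b' \<le> dist a a'"
  obtains Q \<C> F where "piecewise_isometric Q \<C> F" "convex Q" "cball 0 r \<subseteq> Q"
    "\<And>a b. (a, b) \<in> G \<Longrightarrow> a \<in> Q \<and> F a = b"
proof -
  obtain B where B: "\<forall>b \<in> insert (real DIM('a)) (norm ` snd ` G). b \<le> B"
    using bdd_above_finite[of "insert (real DIM('a)) (norm ` snd ` G)"] \<open>finite G\<close>
    unfolding bdd_above_def by auto
  obtain A where A: "\<forall>b \<in> insert (max r 0) (norm ` fst ` G). b \<le> A"
    using bdd_above_finite[of "insert (max r 0) (norm ` fst ` G)"] \<open>finite G\<close>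
    unfolding bdd_above_def by auto
  have B0: "0 < B" using B by (auto intro: less_le_trans[of 0 "real DIM('a)"])
  \<comment> \<open>A frontier point \<open>x\<close> has norm at least \<open>real N\<close>, hence
    distance at least \<open>2 * B\<close> from every prescribed \<open>a\<close>, while values and
    prescribed values have norm at most \<open>B\<close>. This is the frontier condition of
    \<open>brehm_step\<close>.\<close>
  obtain N :: nat where N: "real N \<ge> A + 2 * B" using real_arch_simple by blast
  then have N0: "N > 0" using A B0 by (cases "N = 0") auto
  define Q where "Q = cbox (- real N *\<^sub>R One) (real N *\<^sub>R One :: 'a)"
  have Q: "convex Q" "compact Q" by (auto simp: Q_def)
  have ball: "cball 0 r \<subseteq> Q"
  proof
    fix x :: 'a assume "x \<in> cball 0 r"
    then have "norm x \<le> real N" using A N B0 by auto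
    then have "\<bar>x \<bullet> i\<bar> \<le> real N" if "i \<in> Basis" for i
      using Basis_le_norm[OF that, of x] by linarith
    then show "x \<in> Q" by (fastforce simp: Q_def mem_box abs_le_iff)
  qed
  have int: "a \<in> interior Q" if "(a, b) \<in> G" for a b
  proof -
    have "norm a \<le> A" using that A by force
    then have "norm a < real N" using N B0 by linarith
    then have "\<bar>a \<bullet> i\<bar> < real N" if "i \<in> Basis" for i
      using Basis_le_norm[OF that, of a] by linarith
    then show ?thesis by (fastforce simp: Q_def mem_box interior_cbox abs_less_iff)
  qed
  have fr: "norm x \<ge> real N" if "x \<in> frontier Q" for x
  proof -
    have "x \<in> Q" "x \<notin> interior Q" using that Q(2)
      by (auto simp: frontier_def compact_imp_closed)
    then obtain i where i: "i \<in> Basis" "\<bar>x \<bullet> i\<bar> \<ge> real N"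
      by (fastforce simp: Q_def mem_box interior_cbox)
    then show ?thesis using Basis_le_norm[OF i(1), of x] by linarith
  qed
  have "\<exists>\<C> F. piecewise_isometric Q \<C> F \<and> (\<forall>x\<in>Q. norm (F x) \<le> B) \<and> (\<forall>(a,b)\<in>G'. F a = b)"
    if "finite G'" "G' \<subseteq> G" for G'
    using that
  proof (induction G' rule: finite_induct)
    case empty
    obtain \<C> f where *: "piecewise_isometric Q \<C> f" "\<And>x. norm (f x) \<le> real DIM('a)"
      unfolding Q_def using folding_exists[OF N0] by blast
    have "norm (f x) \<le> B" for x using *(2)[of x] B by auto
    with * show ?case by blast
  next
    case (insert p G')
    then obtain \<C> F where F: "piecewise_isometric Q \<C> F" "\<forall>x\<in>Q. norm (F x) \<le> B" "\<forall>(a,b)\<in>G'. F a = b"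
      by auto
    obtain a b where p: "p = (a, b)" by fastforce
    have pG: "(a, b) \<in> G" using insert p by auto
    have nb: "norm b \<le> B" "norm a \<le> A" using B A pG by force+
    have "dist (F x) b \<le> dist x a" if "x \<in> frontier Q" for x
    proof -
      have xQ: "x \<in> Q" using that Q(2) compact_imp_closed frontier_subset_closed by blast
      have "dist (F x) b \<le> norm (F x) + norm b" by (simp add: dist_norm norm_triangle_ineq4)
      also have "\<dots> \<le> B + B" using F(2) xQ nb by (intro add_mono) auto
      also have "\<dots> \<le> norm x - norm a" using fr[OF that] N nb by linarith
      also have "\<dots> \<le> dist x a" by (simp add: dist_norm norm_triangle_ineq2)
      finally show ?thesis .
    qed
    from brehm_step[OF F(1) Q int[OF pG] this] obtain F' \<C>' where F':
      "piecewise_isometric Q \<C>' F'" "F' a = b" "\<And>x. dist (F x) b \<le> dist x a \<Longrightarrow> F' x = F x"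
      "\<And>x. x \<in> Q \<Longrightarrow> \<exists>y\<in>Q. F' x \<in> closed_segment b (F y)" by metis
    have "norm (F' x) \<le> B" if x: "x \<in> Q" for x
    proof -
      obtain y where y: "y \<in> Q" "F' x \<in> closed_segment b (F y)" using F'(4)[OF x] by blast
      have "closed_segment b (F y) \<subseteq> cball 0 B"
        using F(2) y nb by (intro closed_segment_subset) auto
      then show ?thesis using y by auto
    qed
    \<comment> \<open>The shortness of \<open>G\<close> is exactly the condition under which the
      step leaves an earlier prescribed value alone.\<close>
    moreover have "F' a' = b'" if "(a', b') \<in> G'" for a' b'
    proof -
      have "F a' = b'" using bspec[OF F(3) that] by simp
      moreover have "dist b' b \<le> dist a' a" using short[OF _ pG, of a' b'] that insert.prems(1) by blast
      ultimately show ?thesis using F'(3)[of a'] by metis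
    qed
    ultimately have "\<forall>x\<in>Q. norm (F' x) \<le> B" "\<forall>(a,b)\<in>insert p G'. F' a = b"
      using F'(2) p by auto
    then show ?case using F'(1) by blast
  qed
  from this[OF \<open>finite G\<close> order_refl] obtain \<C> F where
    F: "piecewise_isometric Q \<C> F" "\<forall>(a,b)\<in>G. F a = b" by blast
  have "F a = b" if "(a, b) \<in> G" for a b using bspec[OF F(2) that] by simp
  moreover note F(1)
  moreover have "a \<in> Q" if "(a, b) \<in> G" for a b using int[OF that] interior_subset by blast
  ultimately show ?thesis by (intro that[of Q \<C> F] Q ball) blast+
qed


section \<open>Simplicial complexes and barycentric coordinates\<close>

text \<open>Coordinates vanish off \<open>\<sigma>\<close>, so that coordinates with respect to
  different simplices can be compared as functions on the whole space.\<close>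

definition bary :: "'v set \<Rightarrow> ('v \<Rightarrow> real) \<Rightarrow> bool"
  where "bary \<sigma> c \<longleftrightarrow> (\<forall>v. 0 \<le> c v) \<and> (\<forall>v. v \<notin> \<sigma> \<longrightarrow> c v = 0) \<and> sum c \<sigma> = 1"

definition affine_on_simplex :: "'v::real_vector set \<Rightarrow> ('v \<Rightarrow> 'b::real_vector) \<Rightarrow> bool"
  where "affine_on_simplex \<sigma> G \<longleftrightarrow>
    (\<forall>c. bary \<sigma> c \<longrightarrow> G (\<Sum>v\<in>\<sigma>. c v *\<^sub>R v) = (\<Sum>v\<in>\<sigma>. c v *\<^sub>R G v))"

text \<open>A geometric simplicial complex given by its vertex sets; affine independence and the
  intersection property are both contained in the uniqueness of barycentric coordinates.\<close>

definition vcomplex :: "'v::real_vector set set \<Rightarrow> bool"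
  where "vcomplex \<V> \<longleftrightarrow> finite \<V> \<and> (\<forall>\<sigma>\<in>\<V>. finite \<sigma> \<and> \<sigma> \<noteq> {}) \<and>
    (\<forall>\<sigma>\<in>\<V>. \<forall>\<tau>. \<tau> \<subseteq> \<sigma> \<and> \<tau> \<noteq> {} \<longrightarrow> \<tau> \<in> \<V>) \<and>
    (\<forall>\<sigma>\<in>\<V>. \<forall>\<tau>\<in>\<V>. \<forall>c d. bary \<sigma> c \<and> bary \<tau> d \<and>
      (\<Sum>v\<in>\<sigma>. c v *\<^sub>R v) = (\<Sum>v\<in>\<tau>. d v *\<^sub>R v) \<longrightarrow> c = d)"

lemma vcomplexD:
  assumes "vcomplex \<V>"
  shows "finite \<V>" "\<sigma> \<in> \<V> \<Longrightarrow> finite \<sigma>" "\<sigma> \<in> \<V> \<Longrightarrow> \<sigma> \<noteq> {}"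
    "\<sigma> \<in> \<V> \<Longrightarrow> \<tau> \<subseteq> \<sigma> \<Longrightarrow> \<tau> \<noteq> {} \<Longrightarrow> \<tau> \<in> \<V>"
    "\<sigma> \<in> \<V> \<Longrightarrow> \<tau> \<in> \<V> \<Longrightarrow> bary \<sigma> c \<Longrightarrow> bary \<tau> d \<Longrightarrow>
      (\<Sum>v\<in>\<sigma>. c v *\<^sub>R v) = (\<Sum>v\<in>\<tau>. d v *\<^sub>R v) \<Longrightarrow> c = d"
proof -
  note * = assms[unfolded vcomplex_def]
  show "finite \<V>" using *[THEN conjunct1] .
  show "\<sigma> \<in> \<V> \<Longrightarrow> finite \<sigma>" "\<sigma> \<in> \<V> \<Longrightarrow> \<sigma> \<noteq> {}"
    using *[THEN conjunct2, THEN conjunct1] by simp_all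
  show "\<sigma> \<in> \<V> \<Longrightarrow> \<tau> \<subseteq> \<sigma> \<Longrightarrow> \<tau> \<noteq> {} \<Longrightarrow> \<tau> \<in> \<V>"
    using *[THEN conjunct2, THEN conjunct2, THEN conjunct1] by simp
  show "\<sigma> \<in> \<V> \<Longrightarrow> \<tau> \<in> \<V> \<Longrightarrow> bary \<sigma> c \<Longrightarrow> bary \<tau> d \<Longrightarrow>
      (\<Sum>v\<in>\<sigma>. c v *\<^sub>R v) = (\<Sum>v\<in>\<tau>. d v *\<^sub>R v) \<Longrightarrow> c = d"
    by (rule *[THEN conjunct2, THEN conjunct2, THEN conjunct2, rule_format]) auto
qed

lemma baryD:
  assumes "bary \<sigma> c"
  shows "0 \<le> c v" "v \<notin> \<sigma> \<Longrightarrow> c v = 0" "sum c \<sigma> = 1"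
  using assms by (auto simp: bary_def)

lemma convex_hull_bary:
  assumes "finite \<sigma>"
  shows "x \<in> convex hull \<sigma> \<longleftrightarrow> (\<exists>c. bary \<sigma> c \<and> x = (\<Sum>v\<in>\<sigma>. c v *\<^sub>R v))"
proof
  assume "x \<in> convex hull \<sigma>"
  then obtain u where u: "\<forall>x\<in>\<sigma>. 0 \<le> u x" "sum u \<sigma> = 1" "(\<Sum>x\<in>\<sigma>. u x *\<^sub>R x) = x"
    unfolding convex_hull_finite[OF assms] by auto
  define c where "c v = (if v \<in> \<sigma> then u v else 0)" for v
  have "sum c \<sigma> = sum u \<sigma>" "(\<Sum>v\<in>\<sigma>. c v *\<^sub>R v) = (\<Sum>x\<in>\<sigma>. u x *\<^sub>R x)"
    by (auto simp: c_def intro: sum.cong)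
  then have "bary \<sigma> c \<and> x = (\<Sum>v\<in>\<sigma>. c v *\<^sub>R v)"
    using u by (auto simp: bary_def c_def)
  then show "\<exists>c. bary \<sigma> c \<and> x = (\<Sum>v\<in>\<sigma>. c v *\<^sub>R v)" by blast
next
  assume "\<exists>c. bary \<sigma> c \<and> x = (\<Sum>v\<in>\<sigma>. c v *\<^sub>R v)"
  then show "x \<in> convex hull \<sigma>"
    unfolding convex_hull_finite[OF assms] by (auto simp: bary_def)
qed

lemma sum_bary_mono:
  fixes f :: "'v \<Rightarrow> 'b::real_vector"
  assumes "bary \<sigma> c" "\<sigma> \<subseteq> \<tau>" "finite \<tau>"
  shows "(\<Sum>v\<in>\<tau>. c v *\<^sub>R f v) = (\<Sum>v\<in>\<sigma>. c v *\<^sub>R f v)"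
  using assms by (intro sum.mono_neutral_right) (auto simp: bary_def)

lemma bary_mono:
  assumes "bary \<sigma> c" "\<sigma> \<subseteq> \<tau>" "finite \<tau>"
  shows "bary \<tau> c"
proof -
  have "sum c \<tau> = sum c \<sigma>"
    using assms by (intro sum.mono_neutral_right) (auto simp: bary_def)
  then show ?thesis using assms by (auto simp: bary_def)
qed

lemma bary_subset_support:
  fixes f :: "'v \<Rightarrow> 'b::real_vector"
  assumes "bary \<sigma> c" "finite \<sigma>" "\<And>v. c v \<noteq> 0 \<Longrightarrow> v \<in> \<tau>"
  shows "bary (\<sigma> \<inter> \<tau>) c" "(\<Sum>v\<in>\<sigma>. c v *\<^sub>R f v) = (\<Sum>v\<in>\<sigma> \<inter> \<tau>. c v *\<^sub>R f v)"
proof -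
  have "sum c \<sigma> = sum c (\<sigma> \<inter> \<tau>)"
    using assms by (intro sum.mono_neutral_right) auto
  then show "bary (\<sigma> \<inter> \<tau>) c" using assms by (auto simp: bary_def)
  show "(\<Sum>v\<in>\<sigma>. c v *\<^sub>R f v) = (\<Sum>v\<in>\<sigma> \<inter> \<tau>. c v *\<^sub>R f v)"
    using assms by (intro sum.mono_neutral_right) auto
qed

lemma bary_delta:
  fixes f :: "'v \<Rightarrow> 'b::real_vector"
  assumes "finite \<sigma>" "v \<in> \<sigma>"
  shows "bary \<sigma> (\<lambda>w. if w = v then 1 else 0)"
    "(\<Sum>w\<in>\<sigma>. (if w = v then 1 else 0) *\<^sub>R f w) = f v"
proof -
  have "(\<Sum>w\<in>\<sigma>. (if w = v then 1 else 0) *\<^sub>R f w) = (\<Sum>w\<in>\<sigma>. if w = v then f w else 0)"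
    by (rule sum.cong) auto
  then show "(\<Sum>w\<in>\<sigma>. (if w = v then 1 else 0) *\<^sub>R f w) = f v"
    using assms by simp
qed (use assms in \<open>auto simp: bary_def\<close>)

lemma bary_compose:
  fixes f :: "'v \<Rightarrow> 'b::real_vector"
  assumes "finite \<sigma>" "finite \<tau>" "bary \<sigma> d" "\<And>w. w \<in> \<sigma> \<Longrightarrow> bary \<tau> (c w)"
  shows "bary \<tau> (\<lambda>v. \<Sum>w\<in>\<sigma>. d w * c w v)"
    "(\<Sum>v\<in>\<tau>. (\<Sum>w\<in>\<sigma>. d w * c w v) *\<^sub>R f v) = (\<Sum>w\<in>\<sigma>. d w *\<^sub>R (\<Sum>v\<in>\<tau>. c w v *\<^sub>R f v))"
proof -
  have "(\<Sum>v\<in>\<tau>. \<Sum>w\<in>\<sigma>. d w * c w v) = (\<Sum>w\<in>\<sigma>. d w * sum (c w) \<tau>)"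
    by (subst sum.swap) (simp add: sum_distrib_left)
  also have "\<dots> = (\<Sum>w\<in>\<sigma>. d w)"
    by (rule sum.cong) (use assms in \<open>auto simp: baryD(3)\<close>)
  also have "\<dots> = 1" using assms by (simp add: baryD(3))
  finally show "bary \<tau> (\<lambda>v. \<Sum>w\<in>\<sigma>. d w * c w v)"
    using assms(3,4) by (auto simp: bary_def intro!: sum_nonneg)
  show "(\<Sum>v\<in>\<tau>. (\<Sum>w\<in>\<sigma>. d w * c w v) *\<^sub>R f v) = (\<Sum>w\<in>\<sigma>. d w *\<^sub>R (\<Sum>v\<in>\<tau>. c w v *\<^sub>R f v))"
    by (simp add: scaleR_sum_left scaleR_sum_right sum.swap[of _ \<tau> \<sigma>])
qed

lemma affine_on_simplexD:
  "affine_on_simplex \<sigma> G \<Longrightarrow> bary \<sigma> c \<Longrightarrow> G (\<Sum>v\<in>\<sigma>. c v *\<^sub>R v) = (\<Sum>v\<in>\<sigma>. c v *\<^sub>R G v)"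
  by (auto simp: affine_on_simplex_def)

lemma affine_on_subsimplex:
  assumes "affine_on_simplex \<sigma> G" "finite \<sigma>" "finite \<tau>" "\<tau> \<subseteq> convex hull \<sigma>"
  shows "affine_on_simplex \<tau> G"
  unfolding affine_on_simplex_def
proof (intro allI impI)
  fix d assume d: "bary \<tau> d"
  have "\<forall>w\<in>\<tau>. \<exists>c. bary \<sigma> c \<and> w = (\<Sum>v\<in>\<sigma>. c v *\<^sub>R v)"
    using assms convex_hull_bary by blast
  then obtain c where c: "\<And>w. w \<in> \<tau> \<Longrightarrow> bary \<sigma> (c w)" "\<And>w. w \<in> \<tau> \<Longrightarrow> w = (\<Sum>v\<in>\<sigma>. c w v *\<^sub>R v)"
    by metis
  have cc: "bary \<sigma> (\<lambda>v. \<Sum>w\<in>\<tau>. d w * c w v)"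
    by (rule bary_compose(1)[OF assms(3,2) d]) (rule c(1))
  have cc1: "(\<Sum>v\<in>\<sigma>. (\<Sum>w\<in>\<tau>. d w * c w v) *\<^sub>R v) = (\<Sum>w\<in>\<tau>. d w *\<^sub>R (\<Sum>v\<in>\<sigma>. c w v *\<^sub>R v))"
    by (rule bary_compose(2)[OF assms(3,2) d]) (rule c(1))
  have cc2: "(\<Sum>v\<in>\<sigma>. (\<Sum>w\<in>\<tau>. d w * c w v) *\<^sub>R G v) = (\<Sum>w\<in>\<tau>. d w *\<^sub>R (\<Sum>v\<in>\<sigma>. c w v *\<^sub>R G v))"
    by (rule bary_compose(2)[OF assms(3,2) d]) (rule c(1))
  have "(\<Sum>w\<in>\<tau>. d w *\<^sub>R w) = (\<Sum>w\<in>\<tau>. d w *\<^sub>R (\<Sum>v\<in>\<sigma>. c w v *\<^sub>R v))"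
    by (intro sum.cong refl arg_cong[of _ _ "\<lambda>x. _ *\<^sub>R x"] c(2))
  also have "\<dots> = (\<Sum>v\<in>\<sigma>. (\<Sum>w\<in>\<tau>. d w * c w v) *\<^sub>R v)"
    using cc1 by (rule sym)
  finally have "G (\<Sum>w\<in>\<tau>. d w *\<^sub>R w) = (\<Sum>v\<in>\<sigma>. (\<Sum>w\<in>\<tau>. d w * c w v) *\<^sub>R G v)"
    using affine_on_simplexD[OF assms(1) cc] by simp
  also have "\<dots> = (\<Sum>w\<in>\<tau>. d w *\<^sub>R (\<Sum>v\<in>\<sigma>. c w v *\<^sub>R G v))"
    by (rule cc2)
  also have "\<dots> = (\<Sum>w\<in>\<tau>. d w *\<^sub>R G w)"
  proof (rule sum.cong)
    fix w assume "w \<in> \<tau>"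
    then show "d w *\<^sub>R (\<Sum>v\<in>\<sigma>. c w v *\<^sub>R G v) = d w *\<^sub>R G w"
      using affine_on_simplexD[OF assms(1) c(1)] c(2) by simp
  qed simp
  finally show "G (\<Sum>w\<in>\<tau>. d w *\<^sub>R w) = (\<Sum>w\<in>\<tau>. d w *\<^sub>R G w)" .
qed

lemma affine_on_subset:
  assumes "affine_on_simplex \<sigma> G" "finite \<sigma>" "\<tau> \<subseteq> \<sigma>"
  shows "affine_on_simplex \<tau> G"
  using assms by (meson affine_on_subsimplex finite_subset hull_subset order_trans)

lemma affine_independent_bary_unique:
  assumes "finite \<sigma>" "\<not> affine_dependent \<sigma>" "bary \<sigma> c" "bary \<sigma> d"
    "(\<Sum>v\<in>\<sigma>. c v *\<^sub>R v) = (\<Sum>v\<in>\<sigma>. d v *\<^sub>R v)"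
  shows "c = d"
proof (rule ccontr)
  assume "c \<noteq> d"
  then obtain v where "c v \<noteq> d v" by auto
  moreover have "v \<in> \<sigma>" using \<open>c v \<noteq> d v\<close> assms by (metis baryD(2))
  moreover have "(\<Sum>v\<in>\<sigma>. c v - d v) = 0" using assms by (simp add: sum_subtractf baryD(3))
  moreover have "(\<Sum>v\<in>\<sigma>. (c v - d v) *\<^sub>R v) = 0" using assms by (simp add: sum_subtractf scaleR_left_diff_distrib)
  ultimately show False
    using assms(2) unfolding affine_dependent_explicit_finite[OF assms(1)]
    by (auto dest!: spec[of _ "\<lambda>v. c v - d v"])
qed

text \<open>The positive and the negative part of an affine dependence have the same positive total
  weight. Divided by it, they are two different families of coordinates of one point.\<close>

lemma bary_unique_affine_independent:
  assumes fin: "finite \<sigma>" and u: "\<And>c d. bary \<sigma> c \<Longrightarrow> bary \<sigma> d \<Longrightarrow>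
    (\<Sum>v\<in>\<sigma>. c v *\<^sub>R v) = (\<Sum>v\<in>\<sigma>. d v *\<^sub>R v) \<Longrightarrow> c = d"
  shows "\<not> affine_dependent \<sigma>"
proof
  assume "affine_dependent \<sigma>"
  then obtain U where U: "sum U \<sigma> = 0" "\<exists>v\<in>\<sigma>. U v \<noteq> 0" "(\<Sum>v\<in>\<sigma>. U v *\<^sub>R v) = 0"
    unfolding affine_dependent_explicit_finite[OF fin] by auto
  define P where "P v = (if v \<in> \<sigma> then max (U v) 0 else 0)" for v
  define N where "N v = (if v \<in> \<sigma> then max (- U v) 0 else 0)" for v
  have PN: "P v - N v = U v" if "v \<in> \<sigma>" for v using that by (auto simp: P_def N_def)
  have s: "sum P \<sigma> = sum N \<sigma>"
  proof -
    have "sum P \<sigma> - sum N \<sigma> = sum U \<sigma>"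
      unfolding sum_subtractf[symmetric] by (rule sum.cong) (auto simp: PN)
    then show ?thesis using U(1) by simp
  qed
  have e: "(\<Sum>v\<in>\<sigma>. P v *\<^sub>R v) = (\<Sum>v\<in>\<sigma>. N v *\<^sub>R v)"
  proof -
    have "(\<Sum>v\<in>\<sigma>. P v *\<^sub>R v) - (\<Sum>v\<in>\<sigma>. N v *\<^sub>R v) = (\<Sum>v\<in>\<sigma>. U v *\<^sub>R v)"
      unfolding sum_subtractf[symmetric] scaleR_left_diff_distrib[symmetric]
      by (rule sum.cong) (auto simp: PN)
    then show ?thesis using U(3) by simp
  qed
  have nn: "0 \<le> P v" "0 \<le> N v" for v by (auto simp: P_def N_def)
  have pos: "sum P \<sigma> > 0"
  proof (rule ccontr)
    assume "\<not> sum P \<sigma> > 0"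
    then have "sum P \<sigma> = 0" using sum_nonneg[of \<sigma> P] nn by force
    then have "\<forall>v\<in>\<sigma>. P v = 0" "\<forall>v\<in>\<sigma>. N v = 0"
      using s sum_nonneg_eq_0_iff[OF fin] nn by metis+
    then show False using U(2) PN by force
  qed
  define S where "S = sum P \<sigma>"
  have "(\<lambda>v. P v / S) = (\<lambda>v. N v / S)"
  proof (rule u)
    show "bary \<sigma> (\<lambda>v. P v / S)" "bary \<sigma> (\<lambda>v. N v / S)"
      using pos s by (auto simp: bary_def P_def N_def S_def simp flip: sum_divide_distrib)
    have "(1/S) *\<^sub>R (\<Sum>v\<in>\<sigma>. P v *\<^sub>R v) = (1/S) *\<^sub>R (\<Sum>v\<in>\<sigma>. N v *\<^sub>R v)" using e by simp
    then show "(\<Sum>v\<in>\<sigma>. (P v / S) *\<^sub>R v) = (\<Sum>v\<in>\<sigma>. (N v / S) *\<^sub>R v)"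
      by (simp add: scaleR_sum_right)
  qed
  then have "P v = N v" for v using pos by (auto simp: S_def fun_eq_iff)
  then show False using U(2) PN by force
qed

lemma vcomplex_affine_independent:
  assumes "vcomplex \<V>" "\<sigma> \<in> \<V>"
  shows "\<not> affine_dependent \<sigma>"
  using assms by (intro bary_unique_affine_independent) (auto dest: vcomplexD)

text \<open>The two coordinate functions of \<open>x\<close> are equal and hence supported in both
  vertex sets.\<close>

lemma vcomplex_hull_Int:
  assumes "vcomplex \<V>" "\<sigma> \<in> \<V>" "\<tau> \<in> \<V>" "x \<in> convex hull \<sigma>" "x \<in> convex hull \<tau>"
  shows "\<sigma> \<inter> \<tau> \<in> \<V>" "x \<in> convex hull (\<sigma> \<inter> \<tau>)"
proof -
  note fin = vcomplexD(2)[OF assms(1) assms(2)] vcomplexD(2)[OF assms(1) assms(3)]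
  obtain c d where c: "bary \<sigma> c" "x = (\<Sum>v\<in>\<sigma>. c v *\<^sub>R v)" "bary \<tau> d" "x = (\<Sum>v\<in>\<tau>. d v *\<^sub>R v)"
    using assms(4,5) convex_hull_bary fin by metis
  then have "c = d" using vcomplexD(5)[OF assms(1-3)] by metis
  then have "\<And>v. c v \<noteq> 0 \<Longrightarrow> v \<in> \<tau>" using c(3) baryD(2) by metis
  from bary_subset_support[OF c(1) fin(1) this] c(2) have b: "bary (\<sigma> \<inter> \<tau>) c" "x = (\<Sum>v\<in>\<sigma> \<inter> \<tau>. c v *\<^sub>R v)"
    by auto
  then show "x \<in> convex hull (\<sigma> \<inter> \<tau>)" using convex_hull_bary fin by blast
  have "\<sigma> \<inter> \<tau> \<noteq> {}" using b by (auto simp: bary_def)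
  then show "\<sigma> \<inter> \<tau> \<in> \<V>" using vcomplexD(4)[OF assms(1,2)] by blast
qed

text \<open>Interpolation of the vertex values is well defined because the coordinates of a point do
  not depend on the simplex chosen to contain it. Off the complex the values of \<open>G\<close> are
  arbitrary.\<close>

lemma simplexwise_affine_extension:
  fixes g :: "'v::real_vector \<Rightarrow> 'b::real_vector"
  assumes "vcomplex \<V>"
  obtains G where "\<And>v. v \<in> \<Union>\<V> \<Longrightarrow> G v = g v" "\<And>\<sigma>. \<sigma> \<in> \<V> \<Longrightarrow> affine_on_simplex \<sigma> G"
proof -
  define R where "R x c \<longleftrightarrow> (\<exists>\<sigma>\<in>\<V>. bary \<sigma> c \<and> x = (\<Sum>v\<in>\<sigma>. c v *\<^sub>R v))" for x c
  define G where "G x = (\<Sum>v\<in>\<Union>\<V>. (SOME c. R x c) v *\<^sub>R g v)" for x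
  have fin: "finite (\<Union>\<V>)" using vcomplexD(1,2)[OF assms] by blast
  have G: "G (\<Sum>v\<in>\<sigma>. c v *\<^sub>R v) = (\<Sum>v\<in>\<sigma>. c v *\<^sub>R g v)" if s: "\<sigma> \<in> \<V>" and c: "bary \<sigma> c" for \<sigma> c
  proof -
    let ?x = "\<Sum>v\<in>\<sigma>. c v *\<^sub>R v"
    have "R ?x c" using s c by (auto simp: R_def)
    moreover have "c' = c" if "R ?x c'" for c'
      using that s c vcomplexD(5)[OF assms] unfolding R_def by metis
    ultimately have "(SOME c. R ?x c) = c" by blast
    then show ?thesis unfolding G_def using sum_bary_mono[OF c _ fin, of g] s by auto
  qed
  have A: "G v = g v" if v: "v \<in> \<Union>\<V>" for v
  proof -
    obtain \<sigma> where s: "\<sigma> \<in> \<V>" "v \<in> \<sigma>" using v by blast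
    note f = vcomplexD(2)[OF assms s(1)]
    from G[OF s(1) bary_delta(1)[OF f s(2)]] show ?thesis
      by (simp only: bary_delta(2)[OF f s(2), of g] bary_delta(2)[OF f s(2), of "\<lambda>x. x"])
  qed
  have "affine_on_simplex \<sigma> G" if "\<sigma> \<in> \<V>" for \<sigma>
    unfolding affine_on_simplex_def
  proof (intro allI impI)
    fix c assume "bary \<sigma> c"
    have "(\<Sum>v\<in>\<sigma>. c v *\<^sub>R G v) = (\<Sum>v\<in>\<sigma>. c v *\<^sub>R g v)"
      by (rule sum.cong) (use A that in auto)
    then show "G (\<Sum>v\<in>\<sigma>. c v *\<^sub>R v) = (\<Sum>v\<in>\<sigma>. c v *\<^sub>R G v)"
      using G[OF that \<open>bary \<sigma> c\<close>] by simp
  qed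
  with A show ?thesis by (rule that[of G])
qed

section \<open>Subdivision by splitting edges\<close>

definition subdivides :: "'v::real_vector set set \<Rightarrow> 'v set set \<Rightarrow> bool"
  where "subdivides \<V>' \<V> \<longleftrightarrow> vcomplex \<V>' \<and> (\<Union>\<sigma>\<in>\<V>'. convex hull \<sigma>) = (\<Union>\<sigma>\<in>\<V>. convex hull \<sigma>) \<and>
    (\<forall>\<sigma>'\<in>\<V>'. \<exists>\<sigma>\<in>\<V>. \<sigma>' \<subseteq> convex hull \<sigma>)"

lemma subdividesD:
  assumes "subdivides \<V>' \<V>"
  shows "vcomplex \<V>'" "(\<Union>\<sigma>\<in>\<V>'. convex hull \<sigma>) = (\<Union>\<sigma>\<in>\<V>. convex hull \<sigma>)"
    "\<sigma>' \<in> \<V>' \<Longrightarrow> \<exists>\<sigma>\<in>\<V>. \<sigma>' \<subseteq> convex hull \<sigma>"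
proof -
  note * = assms[unfolded subdivides_def]
  show "vcomplex \<V>'" using *[THEN conjunct1] .
  show "(\<Union>\<sigma>\<in>\<V>'. convex hull \<sigma>) = (\<Union>\<sigma>\<in>\<V>. convex hull \<sigma>)"
    using *[THEN conjunct2, THEN conjunct1] .
  show "\<sigma>' \<in> \<V>' \<Longrightarrow> \<exists>\<sigma>\<in>\<V>. \<sigma>' \<subseteq> convex hull \<sigma>"
    by (rule *[THEN conjunct2, THEN conjunct2, THEN bspec])
qed

lemma subdivides_refl: "vcomplex \<V> \<Longrightarrow> subdivides \<V> \<V>"
  unfolding subdivides_def by (intro conjI ballI refl, assumption, rule bexI, rule hull_subset)

lemma subdivides_trans:
  assumes "subdivides \<V>'' \<V>'" "subdivides \<V>' \<V>"
  shows "subdivides \<V>'' \<V>"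
proof -
  have "\<exists>\<sigma>\<in>\<V>. \<sigma>'' \<subseteq> convex hull \<sigma>" if s: "\<sigma>'' \<in> \<V>''" for \<sigma>''
  proof -
    obtain \<sigma>' where 1: "\<sigma>' \<in> \<V>'" "\<sigma>'' \<subseteq> convex hull \<sigma>'" using subdividesD(3)[OF assms(1) s] by blast
    obtain \<sigma> where 2: "\<sigma> \<in> \<V>" "\<sigma>' \<subseteq> convex hull \<sigma>" using subdividesD(3)[OF assms(2) 1(1)] by blast
    have "convex hull \<sigma>' \<subseteq> convex hull \<sigma>" using 2 by (simp add: hull_minimal)
    then show ?thesis using 1 2 by blast
  qed
  then show ?thesis unfolding subdivides_def
    by (intro conjI ballI subdividesD(1)[OF assms(1)] trans[OF subdividesD(2)[OF assms(1)] subdividesD(2)[OF assms(2)]])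
qed

text \<open>The stellar subdivision at a point \<open>m\<close> of the edge \<open>{p, q}\<close>.
  The choice \<open>\<tau> = {}\<close> contributes the new vertex \<open>{m}\<close>.\<close>

definition edge_split :: "'v set set \<Rightarrow> 'v \<Rightarrow> 'v \<Rightarrow> 'v \<Rightarrow> 'v set set"
  where "edge_split \<V> p q m = {\<sigma>\<in>\<V>. \<not> {p, q} \<subseteq> \<sigma>} \<union> {insert m \<tau> |\<tau>. \<tau> \<union> {p, q} \<in> \<V> \<and> \<not> {p, q} \<subseteq> \<tau>}"

text \<open>Turns coordinates with respect to a complex split at \<open>m\<close> back into those with respect to the
  original one.\<close>

definition edge_lift :: "'v \<Rightarrow> 'v \<Rightarrow> 'v \<Rightarrow> real \<Rightarrow> ('v \<Rightarrow> real) \<Rightarrow> 'v \<Rightarrow> real"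
  where "edge_lift p q m t c v =
    (if v = m then 0 else c v + (if v = p then (1 - t) * c m else if v = q then t * c m else 0))"

text \<open>The weight of \<open>m\<close> is distributed to \<open>p\<close> and \<open>q\<close>
  in the proportion \<open>1 - t\<close> to \<open>t\<close>. The function \<open>f\<close> is
  arbitrary because the identity is needed for the point and the constant 1 for the total
  weight.\<close>

lemma sum_edge_lift:
  fixes f :: "'v \<Rightarrow> 'w::real_vector"
  assumes "finite \<sigma>" "p \<in> \<sigma>" "q \<in> \<sigma>" "m \<notin> \<sigma>" "p \<noteq> q"
  shows "(\<Sum>v\<in>\<sigma>. edge_lift p q m t c v *\<^sub>R f v) =
    (\<Sum>v\<in>\<sigma>. c v *\<^sub>R f v) + c m *\<^sub>R ((1 - t) *\<^sub>R f p + t *\<^sub>R f q)"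
proof -
  have "(\<Sum>v\<in>\<sigma>. edge_lift p q m t c v *\<^sub>R f v) =
      (\<Sum>v\<in>\<sigma>. c v *\<^sub>R f v + (if v = p then ((1 - t) * c m) *\<^sub>R f v else 0)
        + (if v = q then (t * c m) *\<^sub>R f v else 0))"
    by (rule sum.cong) (use assms in \<open>auto simp: edge_lift_def scaleR_left_distrib\<close>)
  also have "\<dots> = (\<Sum>v\<in>\<sigma>. c v *\<^sub>R f v) + ((1 - t) * c m) *\<^sub>R f p + (t * c m) *\<^sub>R f q"
    using assms by (simp add: sum.distrib)
  finally show ?thesis by (simp add: scaleR_right_distrib mult.commute add.assoc)
qed

lemma sum_insert_superset:
  fixes f :: "'v \<Rightarrow> 'w::real_vector"
  assumes "finite \<rho>" "\<tau> \<subseteq> \<rho>" "m \<notin> \<rho>" "\<And>v. v \<notin> insert m \<tau> \<Longrightarrow> c v = 0"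
  shows "(\<Sum>v\<in>insert m \<tau>. c v *\<^sub>R f v) = c m *\<^sub>R f m + (\<Sum>v\<in>\<rho>. c v *\<^sub>R f v)"
proof -
  have "(\<Sum>v\<in>\<rho>. c v *\<^sub>R f v) = (\<Sum>v\<in>\<tau>. c v *\<^sub>R f v)"
  proof (rule sum.mono_neutral_right)
    have "c i = 0" if "i \<in> \<rho> - \<tau>" for i using assms(3,4) that by (metis Diff_iff insert_iff)
    then show "\<forall>i\<in>\<rho> - \<tau>. c i *\<^sub>R f i = 0" by simp
  qed (use assms in auto)
  then show ?thesis using assms finite_subset[OF assms(2,1)] by (subst sum.insert) auto
qed

text \<open>The reverse of the lift: all weight of \<open>p\<close> is moved to \<open>m\<close>,
  which takes the share \<open>t * r\<close> from \<open>q\<close>. The correction term vanishes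
  both for the identity, if \<open>m\<close> divides the edge in the ratio given by
  \<open>t\<close>, and for the constant 1.\<close>

lemma sum_edge_move:
  fixes g :: "'v \<Rightarrow> 'w::real_vector"
  assumes f: "finite \<sigma>" and s: "p \<in> \<sigma>" "q \<in> \<sigma>" "m \<notin> \<sigma>" "p \<noteq> q" and r: "c p = r * (1 - t)"
  shows "(\<Sum>v\<in>insert m (\<sigma> - {p}). (if v = m then r else if v = p then 0 else if v = q then c q - t * r else c v) *\<^sub>R g v)
    = (\<Sum>v\<in>\<sigma>. c v *\<^sub>R g v) + r *\<^sub>R (g m - (1 - t) *\<^sub>R g p - t *\<^sub>R g q)"
proof -
  let ?d = "\<lambda>v. if v = m then r else if v = p then 0 else if v = q then c q - t * r else c v"
  have s2: "\<sigma> = insert p (insert q (\<sigma> - {p, q}))" "\<sigma> - {p} = insert q (\<sigma> - {p, q})"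
    using s by auto
  have "(\<Sum>v\<in>\<sigma> - {p, q}. ?d v *\<^sub>R g v) = (\<Sum>v\<in>\<sigma> - {p, q}. c v *\<^sub>R g v)"
    by (rule sum.cong) (use s in auto)
  moreover have "(\<Sum>v\<in>\<sigma>. c v *\<^sub>R g v) = c p *\<^sub>R g p + (c q *\<^sub>R g q + (\<Sum>v\<in>\<sigma> - {p, q}. c v *\<^sub>R g v))"
    by (subst s2(1)) (use f s in simp)
  moreover have "(\<Sum>v\<in>insert m (\<sigma> - {p}). ?d v *\<^sub>R g v) =
      r *\<^sub>R g m + ((c q - t * r) *\<^sub>R g q + (\<Sum>v\<in>\<sigma> - {p, q}. ?d v *\<^sub>R g v))"
    unfolding s2(2) by (subst sum.insert; (use f s in force)?)+
  ultimately show ?thesis by (simp add: r algebra_simps)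
qed

text \<open>No simplex of the split complex contains both \<open>p\<close> and \<open>q\<close>, so
  one of their weights is 0. The weight of \<open>m\<close> is then the minimum of the lifted
  weights of \<open>p\<close> and \<open>q\<close> divided by \<open>1 - t\<close> and
  \<open>t\<close>. Hence lifted coordinates determine the coordinates, and uniqueness is inherited
  from \<open>\<V>\<close>.\<close>

lemma edge_split_refines:
  fixes p q :: "'v::real_vector"
  assumes V: "vcomplex \<V>" and pq: "{p, q} \<in> \<V>" "p \<noteq> q" and t: "0 < t" "t < 1"
    and m: "m = (1 - t) *\<^sub>R p + t *\<^sub>R q"
  shows "subdivides (edge_split \<V> p q m) \<V>"
proof -
  define c0 where "c0 v = (if v = p then 1 - t else if v = q then t else 0)" for v
  have c0: "bary {p, q} c0" "(\<Sum>v\<in>{p, q}. c0 v *\<^sub>R v) = m"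
    using pq t by (auto simp: bary_def c0_def m)
  have mV: "m \<notin> \<sigma>" if "\<sigma> \<in> \<V>" for \<sigma>
  proof
    assume ms: "m \<in> \<sigma>"
    note f = vcomplexD(2)[OF V that]
    have "(\<lambda>w. if w = m then 1 else 0) = c0"
      by (rule vcomplexD(5)[OF V that pq(1) bary_delta(1)[OF f ms] c0(1)])
        (rule trans[OF bary_delta(2)[OF f ms, of "\<lambda>x. x"] c0(2)[symmetric]])
    from fun_cong[OF this, of p] fun_cong[OF this, of q] show False
      using t pq(2) by (auto simp: c0_def split: if_splits)
  qed
  have mp: "m \<noteq> p" "m \<noteq> q" using mV[OF pq(1)] by auto
  define lift where "lift = edge_lift p q m t"
  note lift_def = lift_def edge_lift_def
  have sum_new1: "sum c (insert m \<tau>) = c m + sum c (\<tau> \<union> {p, q})"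
    if "\<tau> \<union> {p, q} \<in> \<V>" "\<And>v. v \<notin> insert m \<tau> \<Longrightarrow> c v = 0" for \<tau> and c :: "'v \<Rightarrow> real"
  proof -
    have "(\<Sum>v\<in>insert m \<tau>. c v *\<^sub>R (1::real)) = c m *\<^sub>R 1 + (\<Sum>v\<in>\<tau> \<union> {p, q}. c v *\<^sub>R 1)"
      by (rule sum_insert_superset) (use that vcomplexD(2)[OF V that(1)] mV[OF that(1)] in auto)
    then show ?thesis by simp
  qed
  have lift_sum1: "sum (lift c) \<sigma> = sum c \<sigma> + c m"
    if "finite \<sigma>" "p \<in> \<sigma>" "q \<in> \<sigma>" "m \<notin> \<sigma>" for \<sigma> c
    using sum_edge_lift[OF that pq(2), where f = "\<lambda>_. 1::real" and t = t and c = c] by (simp add: lift_def(1) algebra_simps)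
  have L: "\<exists>\<sigma>\<in>\<V>. bary \<sigma> (lift c) \<and> (\<Sum>v\<in>\<sigma>. lift c v *\<^sub>R v) = (\<Sum>v\<in>\<sigma>'. c v *\<^sub>R v) \<and> (c p = 0 \<or> c q = 0)"
    if s': "\<sigma>' \<in> edge_split \<V> p q m" and c: "bary \<sigma>' c" for \<sigma>' c
  proof (cases "\<sigma>' \<in> \<V> \<and> \<not> {p, q} \<subseteq> \<sigma>'")
    case True
    then have "c m = 0" using c mV baryD(2) by metis
    then have "lift c = c" by (auto simp: lift_def)
    then show ?thesis using True c by (intro bexI[of _ \<sigma>']) (auto simp: bary_def)
  next
    case False
    then obtain \<tau> where \<tau>: "\<sigma>' = insert m \<tau>" "\<tau> \<union> {p, q} \<in> \<V>" "\<not> {p, q} \<subseteq> \<tau>"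
      using s' by (auto simp: edge_split_def)
    define \<sigma> where "\<sigma> = \<tau> \<union> {p, q}"
    have \<sigma>: "finite \<sigma>" "p \<in> \<sigma>" "q \<in> \<sigma>" "m \<notin> \<sigma>"
      using vcomplexD(2)[OF V \<tau>(2)] mV[OF \<tau>(2)] by (auto simp: \<sigma>_def)
    have z: "\<And>v. v \<notin> insert m \<tau> \<Longrightarrow> c v = 0" using c \<tau>(1) baryD(2) by metis
    have "sum c (insert m \<tau>) = c m + sum c \<sigma>" unfolding \<sigma>_def
      by (rule sum_new1[OF \<tau>(2)]) (rule z)
    then have "sum (lift c) \<sigma> = 1" using lift_sum1[OF \<sigma>, of c] baryD(3)[OF c] \<tau>(1) by simp
    moreover have "0 \<le> lift c v" for v using baryD(1)[OF c] t by (auto simp: lift_def)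
    moreover have "lift c v = 0" if "v \<notin> \<sigma>" for v using that z[of v] \<sigma>(2,3) by (auto simp: lift_def \<sigma>_def)
    ultimately have "bary \<sigma> (lift c)" by (simp add: bary_def)
    moreover have "(\<Sum>v\<in>\<sigma>. lift c v *\<^sub>R v) = (\<Sum>v\<in>\<sigma>'. c v *\<^sub>R v)"
    proof -
      have "(\<Sum>v\<in>insert m \<tau>. c v *\<^sub>R v) = c m *\<^sub>R m + (\<Sum>v\<in>\<sigma>. c v *\<^sub>R v)"
        by (rule sum_insert_superset[OF \<sigma>(1) _ \<sigma>(4)]) (use z in \<open>auto simp: \<sigma>_def\<close>)
      then show ?thesis
        unfolding lift_def(1) sum_edge_lift[OF \<sigma> pq(2), where f = "\<lambda>x. x" and t = t and c = c] \<tau>(1)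
        by (simp add: m)
    qed
    moreover have "c p = 0 \<or> c q = 0" using z \<tau>(3) mp by auto
    ultimately show ?thesis using \<tau>(2) by (auto simp: \<sigma>_def)
  qed
  have inj: "c = d" if "lift c = lift d" "c p = 0 \<or> c q = 0" "d p = 0 \<or> d q = 0"
    "\<And>v. 0 \<le> c v" "\<And>v. 0 \<le> d v" for c d
  proof -
    have e: "c p + (1 - t) * c m = d p + (1 - t) * d m" "c q + t * c m = d q + t * d m"
      using fun_cong[OF that(1), of p] fun_cong[OF that(1), of q] mp pq(2) by (auto simp: lift_def)
    have le: "c m \<le> d m" if "c q + t * c m = d q + t * d m" "c p + (1 - t) * c m = d p + (1 - t) * d m"
      "d p = 0 \<or> d q = 0" "\<And>v. 0 \<le> c v" for c d :: "'v \<Rightarrow> real"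
    proof -
      have "t * c m \<le> t * d m \<or> (1 - t) * c m \<le> (1 - t) * d m"
        using that(1-3) that(4)[of p] that(4)[of q] by auto
      then show ?thesis using t by auto
    qed
    have "c m = d m" using le[of c d] le[of d c] e that(2-5) by force
    moreover from this have "c p = d p" "c q = d q" using e by auto
    moreover have "c v = d v" if "v \<noteq> m" "v \<noteq> p" "v \<noteq> q" for v
      using fun_cong[OF \<open>lift c = lift d\<close>, of v] that by (auto simp: lift_def)
    ultimately show "c = d" by (metis ext)
  qed
  \<comment> \<open>A simplex containing the edge is cut into two halves by \<open>m\<close> and the
    vertices other than \<open>p'\<close> and \<open>q'\<close>. The inequality on \<open>c\<close>
    selects the half without \<open>p'\<close>: the share of weight that leaves \<open>q'\<close>
    together with all of \<open>p'\<close> does not exceed what \<open>q'\<close> has. It is used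
    with both orders of the ends of the edge.\<close>
  have half: "x \<in> convex hull (insert m (\<sigma> - {p'}))"
    if s: "\<sigma> \<in> \<V>" "p' \<in> \<sigma>" "q' \<in> \<sigma>" and p'q': "p' \<noteq> q'" "0 < t'" "t' < 1" "m = (1 - t') *\<^sub>R p' + t' *\<^sub>R q'"
      and c: "bary \<sigma> c" "x = (\<Sum>v\<in>\<sigma>. c v *\<^sub>R v)" "c p' * t' \<le> c q' * (1 - t')" for \<sigma> p' q' t' c x
  proof -
    note f = vcomplexD(2)[OF V s(1)]
    have mm: "m \<notin> \<sigma>" using mV[OF s(1)] .
    define r where "r = c p' / (1 - t')"
    have r: "c p' = r * (1 - t')" "0 \<le> r" using p'q' baryD(1)[OF c(1)] by (auto simp: r_def)
    have rq: "r * t' \<le> c q'"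
    proof -
      have "(r * t') * (1 - t') \<le> c q' * (1 - t')" using c(3) r(1) by (simp add: algebra_simps)
      then show ?thesis using p'q' by simp
    qed
    define d where "d v = (if v = m then r else if v = p' then 0 else if v = q' then c q' - t' * r else c v)" for v
    have "x = (\<Sum>v\<in>insert m (\<sigma> - {p'}). d v *\<^sub>R v) \<and> sum d (insert m (\<sigma> - {p'})) = 1"
    proof -
      note eq = sum_edge_move[where c = c and r = r and t = t', OF f s(2,3) mm p'q'(1) r(1), folded d_def]
      from eq[where g = "\<lambda>x. x"] eq[where g = "\<lambda>_. 1::real"] show ?thesis
        using c baryD(3)[OF c(1)] by (simp add: p'q'(4))
    qed
    moreover have "0 \<le> d v" for v using r rq baryD(1)[OF c(1)] by (auto simp: d_def algebra_simps)
    ultimately show ?thesis using f by (subst convex_hull_finite) auto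
  qed
  have vc: "vcomplex (edge_split \<V> p q m)"
    unfolding vcomplex_def
  proof (intro conjI ballI allI impI)
    have "{insert m \<tau> |\<tau>. \<tau> \<union> {p, q} \<in> \<V> \<and> \<not> {p, q} \<subseteq> \<tau>} \<subseteq> insert m ` (\<Union>\<sigma>\<in>\<V>. Pow \<sigma>)" by auto
    moreover have "finite (insert m ` (\<Union>\<sigma>\<in>\<V>. Pow \<sigma>))" using vcomplexD(1,2)[OF V] by auto
    ultimately show "finite (edge_split \<V> p q m)"
      unfolding edge_split_def using vcomplexD(1)[OF V] finite_subset by auto
    fix \<sigma> assume s: "\<sigma> \<in> edge_split \<V> p q m"
    show "finite \<sigma>" using s vcomplexD(2)[OF V] by (force simp: edge_split_def)
    show "\<sigma> \<noteq> {}" using s vcomplexD(3)[OF V] by (auto simp: edge_split_def)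
    {
      fix \<tau> assume t: "\<tau> \<subseteq> \<sigma> \<and> \<tau> \<noteq> {}"
      show "\<tau> \<in> edge_split \<V> p q m"
      proof (cases "\<sigma> \<in> \<V> \<and> \<not> {p, q} \<subseteq> \<sigma>")
        case True
        then show ?thesis using t vcomplexD(4)[OF V] by (auto simp: edge_split_def)
      next
        case False
        then obtain \<rho> where \<rho>: "\<sigma> = insert m \<rho>" "\<rho> \<union> {p, q} \<in> \<V>" "\<not> {p, q} \<subseteq> \<rho>"
          using s by (auto simp: edge_split_def)
        show ?thesis
        proof (cases "m \<in> \<tau>")
          case True
          have "(\<tau> - {m}) \<union> {p, q} \<in> \<V>" using t \<rho> by (intro vcomplexD(4)[OF V \<rho>(2)]) auto
          moreover have "\<not> {p, q} \<subseteq> \<tau> - {m}" "\<tau> = insert m (\<tau> - {m})" using t \<rho> True by auto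
          ultimately show ?thesis unfolding edge_split_def by blast
        next
          case False
          then have "\<tau> \<subseteq> \<rho>" using t \<rho> by auto
          then have "\<tau> \<in> \<V>" using t by (intro vcomplexD(4)[OF V \<rho>(2)]) auto
          then show ?thesis using \<open>\<tau> \<subseteq> \<rho>\<close> \<rho>(3) by (auto simp: edge_split_def)
        qed
      qed
    }
    fix \<tau> c d assume t: "\<tau> \<in> edge_split \<V> p q m"
      and cd: "bary \<sigma> c \<and> bary \<tau> d \<and> (\<Sum>v\<in>\<sigma>. c v *\<^sub>R v) = (\<Sum>v\<in>\<tau>. d v *\<^sub>R v)"
    obtain \<sigma>1 where 1: "\<sigma>1\<in>\<V>" "bary \<sigma>1 (lift c)" "(\<Sum>v\<in>\<sigma>1. lift c v *\<^sub>R v) = (\<Sum>v\<in>\<sigma>. c v *\<^sub>R v)" "c p = 0 \<or> c q = 0"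
      using L[OF s] cd by blast
    obtain \<sigma>2 where 2: "\<sigma>2\<in>\<V>" "bary \<sigma>2 (lift d)" "(\<Sum>v\<in>\<sigma>2. lift d v *\<^sub>R v) = (\<Sum>v\<in>\<tau>. d v *\<^sub>R v)" "d p = 0 \<or> d q = 0"
      using L[OF t] cd by blast
    have "lift c = lift d" using vcomplexD(5)[OF V 1(1) 2(1) 1(2) 2(2)] 1(3) 2(3) cd by simp
    then show "c = d"
      by (rule inj[OF _ 1(4) 2(4)]) (use cd in \<open>auto simp: bary_def\<close>)
  qed
  have sub: "\<exists>\<sigma>\<in>\<V>. \<sigma>' \<subseteq> convex hull \<sigma>" if s: "\<sigma>' \<in> edge_split \<V> p q m" for \<sigma>'
  proof (cases "\<sigma>' \<in> \<V>")
    case True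
    then show ?thesis by (intro bexI[of _ \<sigma>'] hull_subset)
  next
    case False
    then obtain \<tau> where \<tau>: "\<sigma>' = insert m \<tau>" "\<tau> \<union> {p, q} \<in> \<V>"
      using s by (auto simp: edge_split_def)
    have "m \<in> convex hull (\<tau> \<union> {p, q})"
      unfolding m using t by (intro convexD_alt) (auto simp: hull_inc)
    then have "\<sigma>' \<subseteq> convex hull (\<tau> \<union> {p, q})"
      using \<tau>(1) hull_subset[of "\<tau> \<union> {p, q}" convex] by auto
    then show ?thesis using \<tau>(2) by blast
  qed
  have un: "(\<Union>\<sigma>\<in>edge_split \<V> p q m. convex hull \<sigma>) = (\<Union>\<sigma>\<in>\<V>. convex hull \<sigma>)"
  proof (intro equalityI subsetI)
    fix x assume "x \<in> (\<Union>\<sigma>\<in>edge_split \<V> p q m. convex hull \<sigma>)"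
    then obtain \<sigma>' where s': "\<sigma>' \<in> edge_split \<V> p q m" "x \<in> convex hull \<sigma>'" by auto
    then obtain \<sigma> where "\<sigma>\<in>\<V>" "\<sigma>' \<subseteq> convex hull \<sigma>" using sub by blast
    then show "x \<in> (\<Union>\<sigma>\<in>\<V>. convex hull \<sigma>)" using s' hull_minimal[of \<sigma>' "convex hull \<sigma>" convex] by auto
  next
    fix x assume "x \<in> (\<Union>\<sigma>\<in>\<V>. convex hull \<sigma>)"
    then obtain \<sigma> where s: "\<sigma> \<in> \<V>" "x \<in> convex hull \<sigma>" by auto
    show "x \<in> (\<Union>\<sigma>\<in>edge_split \<V> p q m. convex hull \<sigma>)"
    proof (cases "{p, q} \<subseteq> \<sigma>")
      case False
      then show ?thesis using s by (auto simp: edge_split_def)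
    next
      case True
      obtain c where c: "bary \<sigma> c" "x = (\<Sum>v\<in>\<sigma>. c v *\<^sub>R v)"
        using s convex_hull_bary vcomplexD(2)[OF V s(1)] by blast
      have U: "(\<sigma> - {r}) \<union> {p, q} = \<sigma>" "\<not> {p, q} \<subseteq> \<sigma> - {r}" if "r = p \<or> r = q" for r
        using True that by auto
      have E: "insert m (\<sigma> - {r}) \<in> edge_split \<V> p q m" if "r = p \<or> r = q" for r
        using U[OF that] s(1) unfolding edge_split_def by (metis (mono_tags, lifting) UnI2 mem_Collect_eq)
      consider "c p * t \<le> c q * (1 - t)" | "c q * (1 - t) \<le> c p * (1 - (1 - t))" by fastforce
      then show ?thesis
      proof cases
        case 1
        have "x \<in> convex hull (insert m (\<sigma> - {p}))"
          by (rule half[OF s(1) _ _ pq(2) t m c 1]) (use True in auto)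
        then show ?thesis using E[of p] by blast
      next
        case 2
        have "x \<in> convex hull (insert m (\<sigma> - {q}))"
          by (rule half[OF s(1) _ _ pq(2)[symmetric] _ _ _ c 2]) (use True t m in auto)
        then show ?thesis using E[of q] by blast
      qed
    qed
  qed
  show ?thesis unfolding subdivides_def by (intro conjI ballI vc un sub)
qed

text \<open>Any two vertices of a simplex of a complex span an edge or coincide, so this makes the
  values of \<open>G\<close> at the vertices of each simplex all nonnegative or all
  nonpositive.\<close>

definition unseparated :: "'v set set \<Rightarrow> ('v \<Rightarrow> real) \<Rightarrow> bool"
  where "unseparated \<V> G \<longleftrightarrow> (\<forall>p q. {p, q} \<in> \<V> \<longrightarrow> \<not> (G p < 0 \<and> 0 < G q))"

lemma affine_on_refinement:
  assumes "subdivides \<V>' \<V>" "vcomplex \<V>" "\<And>\<sigma>. \<sigma> \<in> \<V> \<Longrightarrow> affine_on_simplex \<sigma> G" "\<sigma>' \<in> \<V>'"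
  shows "affine_on_simplex \<sigma>' G"
proof -
  obtain \<sigma> where "\<sigma> \<in> \<V>" "\<sigma>' \<subseteq> convex hull \<sigma>" using subdividesD(3)[OF assms(1,4)] by blast
  moreover have "finite \<sigma>'" using vcomplexD(2)[OF subdividesD(1)[OF assms(1)] assms(4)] .
  ultimately show ?thesis using affine_on_subsimplex[OF assms(3)] vcomplexD(2)[OF assms(2)] by blast
qed

text \<open>A separated edge is split at the zero of \<open>H\<close>, so no new edge is separated by \<open>H\<close>, and the
  number of separated edges drops.\<close>

lemma unseparated_refinement_step:
  fixes \<G> :: "('v::real_vector \<Rightarrow> real) set"
  assumes "vcomplex \<V>" "\<And>G \<sigma>. G \<in> insert H \<G> \<Longrightarrow> \<sigma> \<in> \<V> \<Longrightarrow> affine_on_simplex \<sigma> G"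
    "\<And>G. G \<in> \<G> \<Longrightarrow> unseparated \<V> G"
  shows "\<exists>\<V>'. subdivides \<V>' \<V> \<and> (\<forall>G\<in>insert H \<G>. unseparated \<V>' G)"
  using assms
proof (induction "card {e. \<exists>p q. e = {p, q} \<and> e \<in> \<V> \<and> H p < 0 \<and> 0 < H q}" arbitrary: \<V> rule: less_induct)
  case less
  note V = less.prems(1)
  have refl: "subdivides \<V> \<V>" by (rule subdivides_refl[OF V])
  let ?bad = "\<lambda>\<V>. {e. \<exists>p q. e = {p, q} \<and> e \<in> \<V> \<and> H p < 0 \<and> 0 < H q}"
  show ?case
  proof (cases "unseparated \<V> H")
    case True
    then show ?thesis using refl less.prems(3) by blast
  next
    case False
    then obtain p q where pq: "{p, q} \<in> \<V>" "H p < 0" "0 < H q" unfolding unseparated_def by blast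
    then have ne: "p \<noteq> q" by auto
    define t where "t = H p / (H p - H q)"
    have t: "0 < t" "t < 1" using pq by (auto simp: t_def divide_simps)
    define m where "m = (1 - t) *\<^sub>R p + t *\<^sub>R q"
    let ?V = "edge_split \<V> p q m"
    have r: "subdivides ?V \<V>" by (rule edge_split_refines[OF V pq(1) ne t m_def])
    have Gm: "G m = (1 - t) * G p + t * G q" if "G \<in> insert H \<G>" for G
    proof -
      have "bary {p, q} (\<lambda>v. if v = p then 1 - t else if v = q then t else 0)"
        using ne t by (auto simp: bary_def)
      from affine_on_simplexD[OF less.prems(2)[OF that pq(1)] this] show ?thesis
        using ne by (simp add: m_def)
    qed
    have Hm: "H m = 0" unfolding Gm[of H, simplified] using pq by (simp add: t_def field_simps)
    have new: "({a, b} \<in> \<V> \<and> {a, b} \<noteq> {p, q}) \<or> (a = m \<or> b = m) \<and> (\<forall>c\<in>{a, b} - {m}. {c, p} \<in> \<V> \<and> {c, q} \<in> \<V>)"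
      if ab: "{a, b} \<in> ?V" for a b
    proof (cases "{a, b} \<in> \<V> \<and> \<not> {p, q} \<subseteq> {a, b}")
      case False
      then obtain \<tau> where \<tau>: "{a, b} = insert m \<tau>" "\<tau> \<union> {p, q} \<in> \<V>"
        using ab unfolding edge_split_def by blast
      have "{c, p} \<in> \<V> \<and> {c, q} \<in> \<V>" if "c \<in> {a, b} - {m}" for c
        using that \<tau> by (intro conjI vcomplexD(4)[OF V \<tau>(2)]) auto
      moreover have "a = m \<or> b = m" using \<tau>(1) by auto
      ultimately show ?thesis by blast
    qed auto
    have "card (?bad ?V) < card (?bad \<V>)"
    proof (rule psubset_card_mono)
      show "finite (?bad \<V>)" by (rule finite_subset[of _ \<V>]) (use vcomplexD(1)[OF V] in auto)
      have psub: "A \<subset> B" if "A \<subseteq> B - {x}" "x \<in> B" for A B and x :: "'v set" using that by blast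
      have "?bad ?V \<subseteq> ?bad \<V> - {{p, q}}"
      proof
        fix e assume "e \<in> ?bad ?V"
        then obtain a b where "e = {a, b} \<and> e \<in> ?V \<and> H a < 0 \<and> 0 < H b" by (auto simp only: mem_Collect_eq)
        then have e: "e = {a, b}" "{a, b} \<in> ?V" "H a < 0" "0 < H b" by auto
        have "a \<noteq> m" "b \<noteq> m" using Hm e(3,4) by auto
        then have "{a, b} \<in> \<V>" "{a, b} \<noteq> {p, q}" using new[OF e(2)] by metis+
        then show "e \<in> ?bad \<V> - {{p, q}}" using e(1,3,4) by auto
      qed
      moreover have "{p, q} \<in> ?bad \<V>" using pq by (simp only: mem_Collect_eq) metis
      ultimately show "?bad ?V \<subset> ?bad \<V>" by (rule psub)
    qed
    moreover have "vcomplex ?V" by (rule subdividesD(1)[OF r])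
    moreover have "affine_on_simplex \<sigma> G" if "G \<in> insert H \<G>" "\<sigma> \<in> ?V" for G \<sigma>
      using affine_on_refinement[OF r V less.prems(2)] that by blast
    \<comment> \<open>A new edge joins \<open>m\<close> to a vertex \<open>c\<close> whose edges to
      \<open>p\<close> and to \<open>q\<close> are in \<open>\<V>\<close>. As \<open>G m\<close> is
      a proper convex combination of \<open>G p\<close> and \<open>G q\<close>, one of these has the
      strict sign of \<open>G m\<close>; if \<open>G\<close> separated \<open>m\<close> from
      \<open>c\<close>, it would already separate that end from \<open>c\<close>.\<close>
    moreover have "unseparated ?V G" if G: "G \<in> \<G>" for G
      unfolding unseparated_def
    proof (intro allI impI notI)
      fix a b assume ab: "{a, b} \<in> ?V" and s: "G a < 0 \<and> 0 < G b"
      have u: "\<not> (G x < 0 \<and> 0 < G y)" if "{x, y} \<in> \<V>" for x y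
        using less.prems(3)[OF G] that unfolding unseparated_def by blast
      have gm: "G m = (1 - t) * G p + t * G q" using Gm G by blast
      have pos: "0 < G p \<or> 0 < G q" if "0 < G m"
      proof (rule ccontr)
        assume "\<not> ?thesis"
        then have "(1 - t) * G p \<le> 0" "t * G q \<le> 0" using t by (auto intro: mult_nonneg_nonpos)
        then show False using that gm by linarith
      qed
      have neg: "G p < 0 \<or> G q < 0" if "G m < 0"
      proof (rule ccontr)
        assume "\<not> ?thesis"
        then have "0 \<le> (1 - t) * G p" "0 \<le> t * G q" using t by auto
        then show False using that gm by linarith
      qed
      show False
      proof (cases "{a, b} \<in> \<V>")
        case True
        then show False using u[OF True] s by metis
      next
        case False
        then have "a = m \<and> b \<noteq> m \<or> b = m \<and> a \<noteq> m" "\<forall>c\<in>{a, b} - {m}. {c, p} \<in> \<V> \<and> {c, q} \<in> \<V>"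
          using new[OF ab] s by auto
        then show False
        proof (elim disjE conjE)
          assume "a = m" "b \<noteq> m" "\<forall>c\<in>{a, b} - {m}. {c, p} \<in> \<V> \<and> {c, q} \<in> \<V>"
          then have "{p, b} \<in> \<V>" "{q, b} \<in> \<V>" "G m < 0" using s by (auto simp: insert_commute)
          then show False using neg u[of p b] u[of q b] s by metis
        next
          assume "b = m" "a \<noteq> m" "\<forall>c\<in>{a, b} - {m}. {c, p} \<in> \<V> \<and> {c, q} \<in> \<V>"
          then have "{a, p} \<in> \<V>" "{a, q} \<in> \<V>" "0 < G m" using s by auto
          then show False using pos u[of a p] u[of a q] s by metis
        qed
      qed
    qed
    ultimately have "\<exists>\<V>'. subdivides \<V>' ?V \<and> (\<forall>G\<in>insert H \<G>. unseparated \<V>' G)"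
      by (rule less.hyps)
    then obtain \<V>' where "subdivides \<V>' ?V" "\<forall>G\<in>insert H \<G>. unseparated \<V>' G" by blast
    then show ?thesis using subdivides_trans[OF _ r] by blast
  qed
qed

lemma unseparated_refinement:
  fixes \<G> :: "('v::real_vector \<Rightarrow> real) set"
  assumes "finite \<G>" "vcomplex \<V>" "\<And>G \<sigma>. G \<in> \<G> \<Longrightarrow> \<sigma> \<in> \<V> \<Longrightarrow> affine_on_simplex \<sigma> G"
  shows "\<exists>\<V>'. subdivides \<V>' \<V> \<and> (\<forall>G\<in>\<G>. unseparated \<V>' G)"
  using assms(1,3)
proof (induction \<G> rule: finite_induct)
  case empty
  then show ?case using subdivides_refl[OF assms(2)] by blast
next
  case (insert H \<G>)
  then obtain \<V>' where V': "subdivides \<V>' \<V>" "\<forall>G\<in>\<G>. unseparated \<V>' G" by blast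
  have "\<exists>\<V>''. subdivides \<V>'' \<V>' \<and> (\<forall>G\<in>insert H \<G>. unseparated \<V>'' G)"
  proof (rule unseparated_refinement_step)
    show "vcomplex \<V>'" by (rule subdividesD(1)[OF V'(1)])
    show "affine_on_simplex \<sigma> G" if "G \<in> insert H \<G>" "\<sigma> \<in> \<V>'" for G \<sigma>
      using affine_on_refinement[OF V'(1) assms(2) insert.prems] that by blast
  qed (use V' in blast)
  then show ?case using subdivides_trans[OF _ V'(1)] by blast
qed


section \<open>Simplices and affine maps\<close>

text \<open>A vertex \<open>v\<close> is extreme: if it is a convex combination of points of
  \<open>W\<close>, and these are expanded in \<open>V\<close>, uniqueness of coordinates leaves
  only the weight at \<open>v\<close>. So every point of \<open>W\<close> that occurs with positive
  weight has all its own weight at \<open>v\<close>, that is, equals \<open>v\<close>.\<close>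

lemma convex_hull_subset_affine_independent:
  fixes V W :: "'v::real_vector set"
  assumes fin: "finite V" "finite W" and "\<not> affine_dependent V" and eq: "convex hull V = convex hull W"
  shows "V \<subseteq> W"
proof
  fix v assume v: "v \<in> V"
  have "v \<in> convex hull W" using v eq hull_inc by metis
  then obtain d where d: "bary W d" "v = (\<Sum>w\<in>W. d w *\<^sub>R w)" using convex_hull_bary fin by blast
  have "\<forall>w\<in>W. \<exists>c. bary V c \<and> w = (\<Sum>v\<in>V. c v *\<^sub>R v)"
    using eq convex_hull_bary[OF fin(1)] hull_inc by metis
  then obtain c where c: "\<And>w. w \<in> W \<Longrightarrow> bary V (c w)" "\<And>w. w \<in> W \<Longrightarrow> w = (\<Sum>v\<in>V. c w v *\<^sub>R v)"
    by metis
  have b: "bary V (\<lambda>v. \<Sum>w\<in>W. d w * c w v)"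
    by (rule bary_compose(1)[OF fin(2,1) d(1)]) (rule c(1))
  have "(\<Sum>v\<in>V. (\<Sum>w\<in>W. d w * c w v) *\<^sub>R v) = (\<Sum>w\<in>W. d w *\<^sub>R (\<Sum>v\<in>V. c w v *\<^sub>R v))"
    by (rule bary_compose(2)[OF fin(2,1) d(1)]) (rule c(1))
  also have "\<dots> = (\<Sum>w\<in>W. d w *\<^sub>R w)"
    by (rule sum.cong) (use c(2) in auto)
  also have "\<dots> = (\<Sum>w\<in>V. (if w = v then 1 else 0) *\<^sub>R w)"
    unfolding d(2)[symmetric] by (rule bary_delta(2)[OF fin(1) v, symmetric])
  finally have e: "(\<lambda>v. \<Sum>w\<in>W. d w * c w v) = (\<lambda>w. if w = v then 1 else 0)"
    by (rule affine_independent_bary_unique[OF fin(1) assms(3) b bary_delta(1)[OF fin(1) v]])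
  have "\<exists>w\<in>W. d w \<noteq> 0"
    using baryD(3)[OF d(1)] sum.neutral[of W d] by (metis zero_neq_one)
  then obtain w where w: "w \<in> W" "d w \<noteq> 0" by blast
  have z: "c w u = 0" if "u \<noteq> v" for u
  proof -
    have "(\<Sum>w\<in>W. d w * c w u) = 0" using fun_cong[OF e, of u] that by simp
    moreover have "0 \<le> d w * c w u" if "w \<in> W" for w
      using baryD(1)[OF c(1)[OF that]] baryD(1)[OF d(1)] by simp
    ultimately have "\<forall>w\<in>W. d w * c w u = 0"
      by (subst (asm) sum_nonneg_eq_0_iff[OF fin(2)]) auto
    then have "d w * c w u = 0" using w(1) by blast
    then show ?thesis using w(2) by simp
  qed
  have "1 = (\<Sum>u\<in>V. if u = v then c w v else 0)"
    unfolding baryD(3)[OF c(1)[OF w(1)], symmetric] by (rule sum.cong) (use z in auto)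
  then have "c w v = 1" using v fin by simp
  have "w = (\<Sum>u\<in>V. (if u = v then 1 else 0) *\<^sub>R u)"
    by (subst c(2)[OF w(1)]) (rule sum.cong, use z \<open>c w v = 1\<close> in auto)
  then have "w = v" using bary_delta(2)[OF fin(1) v, of "\<lambda>x. x"] by simp
  then show "v \<in> W" using w by simp
qed

lemma convex_hull_eq_affine_independent:
  fixes V W :: "'v::real_vector set"
  assumes "finite V" "finite W" "\<not> affine_dependent V" "\<not> affine_dependent W" "convex hull V = convex hull W"
  shows "V = W"
  using convex_hull_subset_affine_independent[OF assms(1,2,3,5)]
    convex_hull_subset_affine_independent[OF assms(2,1,4) assms(5)[symmetric]] by (rule equalityI)

lemma simplex_vertices_unique:
  assumes "simplex_with_vertices V S" "simplex_with_vertices W S"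
  shows "V = W"
proof (rule convex_hull_eq_affine_independent)
  show "finite V" "\<not> affine_dependent V" using assms(1) unfolding simplex_with_vertices_def by metis+
  show "finite W" "\<not> affine_dependent W" using assms(2) unfolding simplex_with_vertices_def by metis+
  show "convex hull V = convex hull W" using assms unfolding simplex_with_vertices_def by metis
qed

lemma affine_on_simplex_image:
  assumes f: "affine_on_simplex V f" and fin: "finite V"
  shows "f ` (convex hull V) = convex hull (f ` V)"
proof (intro equalityI subsetI)
  fix y assume "y \<in> f ` (convex hull V)"
  then obtain c where c: "bary V c" "y = f (\<Sum>v\<in>V. c v *\<^sub>R v)" using convex_hull_bary[OF fin] by auto
  have "y = (\<Sum>v\<in>V. c v *\<^sub>R f v)" using c affine_on_simplexD[OF f] by simp
  also have "\<dots> \<in> convex hull (f ` V)"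
    using fin c(1) by (intro convex_sum) (auto simp: bary_def hull_inc)
  finally show "y \<in> convex hull (f ` V)" .
next
  fix y assume y: "y \<in> convex hull (f ` V)"
  have "convex (f ` (convex hull V))"
  proof (rule convexI)
    fix x y and u' u :: real
    assume "x \<in> f ` (convex hull V)" "y \<in> f ` (convex hull V)" and u': "0 \<le> u'" "0 \<le> u" "u' + u = 1"
    then have u: "u' = 1 - u" "0 \<le> u \<and> u \<le> 1" and "x \<in> f ` (convex hull V)" "y \<in> f ` (convex hull V)" by auto
    then obtain x' y' where xy: "x = f x'" "y = f y'" "x' \<in> convex hull V" "y' \<in> convex hull V" by auto
    have "affine_on_simplex {x', y'} f" by (rule affine_on_subsimplex[OF f fin]) (use xy in auto)
    moreover have "f ((1 - u) *\<^sub>R x' + u *\<^sub>R y') = (1 - u) *\<^sub>R x + u *\<^sub>R y"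
    proof (cases "x' = y'")
      case True
      then show ?thesis by (simp add: xy scaleR_left_distrib[symmetric])
    next
      case False
      have "bary {x', y'} (\<lambda>v. if v = x' then 1 - u else if v = y' then u else 0)"
        using False u by (auto simp: bary_def)
      from affine_on_simplexD[OF \<open>affine_on_simplex {x', y'} f\<close> this] show ?thesis
        using False by (simp add: xy)
    qed
    moreover have "(1 - u) *\<^sub>R x' + u *\<^sub>R y' \<in> convex hull V"
      using convexD_alt[OF convex_convex_hull xy(3,4)] u by blast
    ultimately show "u' *\<^sub>R x + u *\<^sub>R y \<in> f ` (convex hull V)"
      unfolding u(1) by (metis image_eqI)
  qed
  moreover have "f ` V \<subseteq> f ` (convex hull V)" by (simp add: hull_subset image_mono)
  ultimately have "convex hull (f ` V) \<subseteq> f ` (convex hull V)" by (simp add: hull_minimal)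
  then show "y \<in> f ` (convex hull V)" using y by blast
qed

lemma affine_independent_image:
  assumes f: "affine_on_simplex V f" and fin: "finite V" and ind: "\<not> affine_dependent V"
    and inj: "inj_on f (convex hull V)"
  shows "\<not> affine_dependent (f ` V)"
proof (rule bary_unique_affine_independent)
  show "finite (f ` V)" using fin by simp
  have injV: "inj_on f V" using inj hull_subset inj_on_subset by metis
  fix c d assume c: "bary (f ` V) c" and d: "bary (f ` V) d"
    and e: "(\<Sum>v\<in>f ` V. c v *\<^sub>R v) = (\<Sum>v\<in>f ` V. d v *\<^sub>R v)"
  define pull where "pull c v = (if v \<in> V then c (f v) else 0)" for c :: "'b \<Rightarrow> real" and v
  have p: "bary V (pull c)" "(\<Sum>v\<in>f ` V. c v *\<^sub>R v) = f (\<Sum>v\<in>V. pull c v *\<^sub>R v)"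
    if c: "bary (f ` V) c" for c
  proof -
    have "sum (pull c) V = sum c (f ` V)"
      unfolding sum.reindex[OF injV] by (rule sum.cong) (auto simp: pull_def)
    then show b: "bary V (pull c)" using c by (auto simp: bary_def pull_def)
    have "(\<Sum>v\<in>f ` V. c v *\<^sub>R v) = (\<Sum>v\<in>V. pull c v *\<^sub>R f v)"
      unfolding sum.reindex[OF injV] by (rule sum.cong) (auto simp: pull_def)
    then show "(\<Sum>v\<in>f ` V. c v *\<^sub>R v) = f (\<Sum>v\<in>V. pull c v *\<^sub>R v)"
      using affine_on_simplexD[OF f b] by simp
  qed
  have hc: "(\<Sum>v\<in>V. pull c v *\<^sub>R v) \<in> convex hull V" if "bary (f ` V) c" for c
    using convex_hull_bary[OF fin] p(1)[OF that] by blast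
  have "(\<Sum>v\<in>V. pull c v *\<^sub>R v) = (\<Sum>v\<in>V. pull d v *\<^sub>R v)"
    using inj_onD[OF inj _ hc[OF c] hc[OF d]] e p(2)[OF c] p(2)[OF d] by simp
  then have "pull c = pull d"
    by (rule affine_independent_bary_unique[OF fin ind p(1)[OF c] p(1)[OF d]])
  show "c = d"
  proof
    fix w show "c w = d w"
    proof (cases "w \<in> f ` V")
      case True
      then obtain v where "v \<in> V" "w = f v" by blast
      then show ?thesis using fun_cong[OF \<open>pull c = pull d\<close>, of v] by (simp add: pull_def)
    next
      case False
      then show ?thesis using baryD(2) c d by metis
    qed
  qed
qed

lemma vcomplex_simplex:
  assumes "vcomplex \<V>" "\<sigma> \<in> \<V>"
  shows "simplex_with_vertices \<sigma> (convex hull \<sigma>)"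
  using vcomplexD(2,3)[OF assms] vcomplex_affine_independent[OF assms] by (simp add: simplex_with_vertices_def)

lemma vcomplex_face:
  assumes "vcomplex \<V>" "\<sigma> \<in> \<V>"
  shows "simplex_face F (convex hull \<sigma>) \<longleftrightarrow> (\<exists>W\<subseteq>\<sigma>. W \<noteq> {} \<and> F = convex hull W)"
proof
  assume "simplex_face F (convex hull \<sigma>)"
  then obtain V W where VW: "simplex_with_vertices V (convex hull \<sigma>)" "W \<subseteq> V" "W \<noteq> {}" "F = convex hull W"
    unfolding simplex_face_def by blast
  have "V = \<sigma>" by (rule simplex_vertices_unique[OF VW(1) vcomplex_simplex[OF assms]])
  then show "\<exists>W\<subseteq>\<sigma>. W \<noteq> {} \<and> F = convex hull W" using VW(2-4) by metis
next
  assume "\<exists>W\<subseteq>\<sigma>. W \<noteq> {} \<and> F = convex hull W"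
  then show "simplex_face F (convex hull \<sigma>)"
    unfolding simplex_face_def using vcomplex_simplex[OF assms] by blast
qed

lemma vcomplex_simplicial_complex:
  assumes V: "vcomplex \<V>" and n: "(\<Union>\<sigma>\<in>\<V>. convex hull \<sigma>) \<subseteq> Rn n"
  shows "Rn_simplicial_complex ((\<lambda>\<sigma>. convex hull \<sigma>) ` \<V>)"
  unfolding Rn_simplicial_complex_def
proof (intro conjI ballI allI impI)
  show "finite ((\<lambda>\<sigma>. convex hull \<sigma>) ` \<V>)" using vcomplexD(1)[OF V] by simp
  show "\<exists>n. \<Union>((\<lambda>\<sigma>. convex hull \<sigma>) ` \<V>) \<subseteq> Rn n" using n by blast
  fix S assume "S \<in> (\<lambda>\<sigma>. convex hull \<sigma>) ` \<V>"
  then obtain \<sigma> where s: "S = convex hull \<sigma>" "\<sigma> \<in> \<V>" by blast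
  show "\<exists>V. simplex_with_vertices V S" using vcomplex_simplex[OF V s(2)] s(1) by blast
  show "F \<in> (\<lambda>\<sigma>. convex hull \<sigma>) ` \<V>" if F: "simplex_face F S" for F
  proof -
    obtain W where "W \<subseteq> \<sigma>" "W \<noteq> {}" "F = convex hull W"
      using F unfolding s(1) vcomplex_face[OF V s(2)] by blast
    then show ?thesis using vcomplexD(4)[OF V s(2)] by blast
  qed
  fix T assume "T \<in> (\<lambda>\<sigma>. convex hull \<sigma>) ` \<V>"
  then obtain \<tau> where t: "T = convex hull \<tau>" "\<tau> \<in> \<V>" by blast
  show "S \<inter> T = {} \<or> simplex_face (S \<inter> T) S \<and> simplex_face (S \<inter> T) T"
  proof (cases "S \<inter> T = {}")
    case False
    then obtain x where x: "x \<in> convex hull \<sigma>" "x \<in> convex hull \<tau>" using s t by auto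
    have ne: "\<sigma> \<inter> \<tau> \<noteq> {}" using vcomplexD(3)[OF V vcomplex_hull_Int(1)[OF V s(2) t(2) x]] .
    have "S \<inter> T \<subseteq> convex hull (\<sigma> \<inter> \<tau>)"
      unfolding s t using vcomplex_hull_Int(2)[OF V s(2) t(2)] by blast
    moreover have "convex hull (\<sigma> \<inter> \<tau>) \<subseteq> S \<inter> T"
      unfolding s t by (simp add: hull_mono)
    ultimately have e: "S \<inter> T = convex hull (\<sigma> \<inter> \<tau>)" by (rule equalityI)
    have "simplex_face (S \<inter> T) S"
      unfolding e unfolding s(1) vcomplex_face[OF V s(2)] using ne by (intro exI[of _ "\<sigma> \<inter> \<tau>"]) auto
    moreover have "simplex_face (S \<inter> T) T"
      unfolding e unfolding t(1) vcomplex_face[OF V t(2)] using ne by (intro exI[of _ "\<sigma> \<inter> \<tau>"]) auto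
    ultimately show ?thesis by blast
  qed simp
qed

text \<open>A nonempty intersection of two simplices is a face of both. Since a simplex determines
  its vertices, it is the hull of one common vertex set, and coordinates of a common point in either
  simplex are those in this face.\<close>

lemma simplicial_complex_vcomplex:
  assumes K: "Rn_simplicial_complex K"
  obtains \<V> where "vcomplex \<V>" "(\<lambda>\<sigma>. convex hull \<sigma>) ` \<V> = K"
proof -
  define \<V> where "\<V> = {V. finite V \<and> V \<noteq> {} \<and> \<not> affine_dependent V \<and> convex hull V \<in> K}"
  have sv: "simplex_with_vertices \<sigma> (convex hull \<sigma>)" if "\<sigma> \<in> \<V>" for \<sigma>
    using that by (simp add: simplex_with_vertices_def \<V>_def)
  have finK: "finite K" using K by (simp add: Rn_simplicial_complex_def)
  have faceK: "F \<in> K" if "S \<in> K" "simplex_face F S" for S F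
    using K that unfolding Rn_simplicial_complex_def by blast
  have IntK: "S \<inter> T = {} \<or> simplex_face (S \<inter> T) S \<and> simplex_face (S \<inter> T) T" if "S \<in> K" "T \<in> K" for S T
    using K that unfolding Rn_simplicial_complex_def by blast
  have sub: "\<tau> \<in> \<V>" if "\<sigma> \<in> \<V>" "\<tau> \<subseteq> \<sigma>" "\<tau> \<noteq> {}" for \<sigma> \<tau>
  proof -
    have "simplex_face (convex hull \<tau>) (convex hull \<sigma>)"
      unfolding simplex_face_def using sv[OF that(1)] that(2,3) by blast
    then have "convex hull \<tau> \<in> K" using faceK that(1) by (auto simp: \<V>_def)
    then show ?thesis using that by (auto simp: \<V>_def intro: finite_subset dest: affine_independent_subset)
  qed
  have "vcomplex \<V>"
    unfolding vcomplex_def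
  proof (intro conjI ballI allI impI)
    have "\<V> \<subseteq> Pow {v. {v} \<in> K}"
    proof
      fix \<sigma> assume s: "\<sigma> \<in> \<V>"
      have "{v} \<in> K" if "v \<in> \<sigma>" for v using sub[OF s, of "{v}"] that by (auto simp: \<V>_def)
      then show "\<sigma> \<in> Pow {v. {v} \<in> K}" by blast
    qed
    moreover have "finite {v. {v} \<in> K}"
      using finite_vimageI[OF finK, of "\<lambda>v. {v}"] by (simp add: vimage_def)
    ultimately show "finite \<V>" by (meson finite_Pow_iff finite_subset)
    fix \<sigma> assume s: "\<sigma> \<in> \<V>"
    show "finite \<sigma>" "\<sigma> \<noteq> {}" using s by (auto simp: \<V>_def)
    show "\<tau> \<in> \<V>" if "\<tau> \<subseteq> \<sigma> \<and> \<tau> \<noteq> {}" for \<tau> using sub[OF s] that by blast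
    fix \<tau> c d assume t: "\<tau> \<in> \<V>" and cd: "bary \<sigma> c \<and> bary \<tau> d \<and> (\<Sum>v\<in>\<sigma>. c v *\<^sub>R v) = (\<Sum>v\<in>\<tau>. d v *\<^sub>R v)"
    define x where "x = (\<Sum>v\<in>\<sigma>. c v *\<^sub>R v)"
    have f: "finite \<sigma>" "finite \<tau>" and ind: "\<not> affine_dependent \<sigma>" "\<not> affine_dependent \<tau>"
      using s t by (auto simp: \<V>_def)
    have x: "x \<in> convex hull \<sigma>" "x \<in> convex hull \<tau>"
      using convex_hull_bary[OF f(1)] convex_hull_bary[OF f(2)] cd x_def by metis+
    then have fc: "simplex_face (convex hull \<sigma> \<inter> convex hull \<tau>) (convex hull \<sigma>)"
      "simplex_face (convex hull \<sigma> \<inter> convex hull \<tau>) (convex hull \<tau>)"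
      using IntK[of "convex hull \<sigma>" "convex hull \<tau>"] s t by (auto simp: \<V>_def)
    have get: "\<exists>W\<subseteq>\<rho>. convex hull W = F" if F: "simplex_face F (convex hull \<rho>)" and r: "\<rho> \<in> \<V>" for F \<rho>
    proof -
      obtain V W where VW: "simplex_with_vertices V (convex hull \<rho>)" "W \<subseteq> V" "W \<noteq> {}" "F = convex hull W"
        using F unfolding simplex_face_def by blast
      have "V = \<rho>" by (rule simplex_vertices_unique[OF VW(1) sv[OF r]])
      then show ?thesis using VW(2,4) by metis
    qed
    obtain W1 where W1: "W1 \<subseteq> \<sigma>" "convex hull W1 = convex hull \<sigma> \<inter> convex hull \<tau>" using get[OF fc(1) s] by blast
    obtain W2 where W2: "W2 \<subseteq> \<tau>" "convex hull W2 = convex hull \<sigma> \<inter> convex hull \<tau>" using get[OF fc(2) t] by blast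
    have "W1 = W2"
    proof (rule convex_hull_eq_affine_independent)
      show "finite W1" "finite W2" using finite_subset W1(1) W2(1) f by blast+
      show "\<not> affine_dependent W1" "\<not> affine_dependent W2"
        using affine_independent_subset ind W1(1) W2(1) by blast+
      show "convex hull W1 = convex hull W2" using W1(2) W2(2) by simp
    qed
    then have W: "W1 \<subseteq> \<sigma>" "W1 \<subseteq> \<tau>" "finite W1" using W1(1) W2(1) f finite_subset by auto
    have "x \<in> convex hull W1" using W1 x by blast
    then obtain e where e: "bary W1 e" "x = (\<Sum>v\<in>W1. e v *\<^sub>R v)" using convex_hull_bary[OF W(3)] by blast
    have "c = e"
      by (rule affine_independent_bary_unique[OF f(1) ind(1) _ bary_mono[OF e(1) W(1) f(1)]])
        (use cd x_def e(2) sum_bary_mono[OF e(1) W(1) f(1), of "\<lambda>x. x"] in auto)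
    moreover have "d = e"
      by (rule affine_independent_bary_unique[OF f(2) ind(2) _ bary_mono[OF e(1) W(2) f(2)]])
        (use cd x_def e(2) sum_bary_mono[OF e(1) W(2) f(2), of "\<lambda>x. x"] in auto)
    ultimately show "c = d" by simp
  qed
  moreover have "(\<lambda>\<sigma>. convex hull \<sigma>) ` \<V> = K"
  proof (intro equalityI subsetI)
    fix S assume S: "S \<in> K"
    then obtain V where "simplex_with_vertices V S" using K unfolding Rn_simplicial_complex_def by blast
    then show "S \<in> (\<lambda>\<sigma>. convex hull \<sigma>) ` \<V>" using S by (auto simp: simplex_with_vertices_def \<V>_def)
  qed (auto simp: \<V>_def)
  ultimately show ?thesis by (rule that)
qed


section \<open>Zigzags along edges\<close>

text \<open>Multiplying a map that vanishes to first order at a point by a cutoff \<open>\<eta>\<close> of the distance \<open>s\<close>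
  to this point adds \<open>s * \<eta>' s\<close> to its Lipschitz constant, which is at most \<open>\<kappa>\<close> for a logarithmic
  cutoff.\<close>

definition log_cutoff :: "real \<Rightarrow> real \<Rightarrow> real \<Rightarrow> real"
  where "log_cutoff \<kappa> r s = (if s \<le> 0 then 0 else max 0 (min 1 (1 + \<kappa> * ln (s / r))))"

text \<open>Truncation to the unit interval is non-expanding, and the logarithm is controlled by
  \<open>ln (t / s) \<le> t / s - 1\<close>.\<close>

lemma log_cutoff_slope:
  assumes "0 < \<kappa>" "0 < r" "0 \<le> s" "s \<le> t"
  shows "\<bar>log_cutoff \<kappa> r t - log_cutoff \<kappa> r s\<bar> * s \<le> \<kappa> * (t - s)"
proof (cases "s = 0")
  case False
  then have s: "0 < s" "0 < t" using assms by auto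
  have "\<bar>log_cutoff \<kappa> r t - log_cutoff \<kappa> r s\<bar> \<le> \<bar>\<kappa> * ln (t / r) - \<kappa> * ln (s / r)\<bar>"
    using s by (simp add: log_cutoff_def)
  also have "\<kappa> * ln (t / r) - \<kappa> * ln (s / r) = \<kappa> * ln (t / s)"
    using s assms by (simp add: ln_div right_diff_distrib)
  also have "\<bar>\<kappa> * ln (t / s)\<bar> = \<kappa> * ln (t / s)" using s assms by simp
  also have "\<dots> \<le> \<kappa> * (t / s - 1)"
    using s assms ln_le_minus_one[of "t / s"] by (intro mult_left_mono) auto
  finally have "\<bar>log_cutoff \<kappa> r t - log_cutoff \<kappa> r s\<bar> * s \<le> \<kappa> * (t / s - 1) * s"
    using s by (intro mult_right_mono) auto
  also have "\<dots> = \<kappa> * (t - s)" using s by (simp add: field_simps)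
  finally show ?thesis .
qed (use assms in simp)

lemma log_cutoff_bounds: "0 \<le> log_cutoff \<kappa> r s" "log_cutoff \<kappa> r s \<le> 1"
  by (auto simp: log_cutoff_def)

lemma log_cutoff_1: "0 < \<kappa> \<Longrightarrow> 0 < r \<Longrightarrow> r \<le> s \<Longrightarrow> log_cutoff \<kappa> r s = 1"
  by (auto simp: log_cutoff_def)

lemma log_cutoff_0:
  assumes "0 < \<kappa>" "0 < r" "s \<le> r * exp (- 1 / \<kappa>)"
  shows "log_cutoff \<kappa> r s = 0"
proof (cases "s \<le> 0")
  case False
  then have "ln (s / r) \<le> ln (exp (- 1 / \<kappa>))"
    using assms by (subst ln_le_cancel_iff) (auto simp: field_simps)
  then have "\<kappa> * ln (s / r) \<le> -1" using assms by (simp add: field_simps)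
  then show ?thesis by (simp add: log_cutoff_def)
qed (simp add: log_cutoff_def)

section \<open>Making a map constant near finitely many points\<close>

lemma flatten_at_point:
  fixes g :: "'a::metric_space \<Rightarrow> 'b::real_normed_vector"
  assumes lip: "L-lipschitz_on X g" and "p \<in> X" "L < L'" "0 < r"
  obtains g1 R where "L'-lipschitz_on X g1" "0 < R" "\<And>x. dist x p \<le> R \<Longrightarrow> g1 x = g p"
    "\<And>x. r \<le> dist x p \<Longrightarrow> g1 x = g x" "\<And>x. x \<in> X \<Longrightarrow> dist (g1 x) (g x) \<le> L * r"
proof -
  have L: "0 \<le> L" using lip lipschitz_on_nonneg by blast
  \<comment> \<open>The cutoff adds at most \<open>\<kappa> * L\<close> to the Lipschitz constant.
    The denominator \<open>L + 1\<close> keeps this below \<open>L' - L\<close> and also covers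
    \<open>L = 0\<close>.\<close>
  define \<kappa> where "\<kappa> = (L' - L) / (L + 1)"
  have k: "0 < \<kappa>" "\<kappa> * L \<le> L' - L" using L assms by (auto simp: \<kappa>_def field_simps)
  define \<eta> where "\<eta> = log_cutoff \<kappa> r"
  define g1 where "g1 x = g p + \<eta> (dist x p) *\<^sub>R (g x - g p)" for x
  note b = log_cutoff_bounds[of \<kappa> r, folded \<eta>_def]
  have gp: "norm (g x - g p) \<le> L * dist x p" if "x \<in> X" for x
    using lipschitz_onD[OF lip that \<open>p \<in> X\<close>] by (simp add: dist_norm)
  \<comment> \<open>Ordering the points by their distance to \<open>p\<close> lets the increment of
    the cutoff be multiplied by the smaller distance \<open>s\<close>, as
    \<open>log_cutoff_slope\<close> demands.\<close>
  have main: "dist (g1 z) (g1 y) \<le> L' * dist z y"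
    if "y \<in> X" "z \<in> X" "dist y p \<le> dist z p" for y z
  proof -
    define s t where "s = dist y p" and "t = dist z p"
    have "g1 z - g1 y = \<eta> t *\<^sub>R (g z - g y) + (\<eta> t - \<eta> s) *\<^sub>R (g y - g p)"
      by (simp add: g1_def s_def t_def algebra_simps)
    then have "dist (g1 z) (g1 y) \<le> norm (\<eta> t *\<^sub>R (g z - g y)) + norm ((\<eta> t - \<eta> s) *\<^sub>R (g y - g p))"
      unfolding dist_norm by (simp only: norm_triangle_ineq)
    also have "norm (\<eta> t *\<^sub>R (g z - g y)) \<le> 1 * (L * dist z y)"
    proof -
      have "norm (\<eta> t *\<^sub>R (g z - g y)) = \<eta> t * norm (g z - g y)" using b[of t] by simp
      also have "\<dots> \<le> 1 * (L * dist z y)"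
        using lipschitz_onD[OF lip that(2,1)] b[of t] by (intro mult_mono) (auto simp: dist_norm)
      finally show ?thesis .
    qed
    also have "norm ((\<eta> t - \<eta> s) *\<^sub>R (g y - g p)) \<le> \<bar>\<eta> t - \<eta> s\<bar> * (L * s)"
      using gp[OF that(1)] by (simp add: s_def mult_left_mono)
    also have "\<dots> = (\<bar>\<eta> t - \<eta> s\<bar> * s) * L" by simp
    also have "\<dots> \<le> (\<kappa> * (t - s)) * L"
      using log_cutoff_slope[of \<kappa> r s t] k(1) \<open>0 < r\<close> that(3) L
      by (intro mult_right_mono) (auto simp: \<eta>_def s_def t_def)
    also have "\<dots> = (\<kappa> * L) * (t - s)" by simp
    also have "\<dots> \<le> (L' - L) * (t - s)" using k(2) that(3) by (intro mult_right_mono) (auto simp: s_def t_def)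
    also have "\<dots> \<le> (L' - L) * dist z y"
      using dist_triangle[of z p y] \<open>L < L'\<close> by (intro mult_left_mono) (auto simp: s_def t_def)
    finally show ?thesis by (simp add: algebra_simps)
  qed
  have "L'-lipschitz_on X g1"
  proof (rule lipschitz_onI)
    fix y z assume yz: "y \<in> X" "z \<in> X"
    show "dist (g1 y) (g1 z) \<le> L' * dist y z"
    proof (cases "dist y p \<le> dist z p")
      case True
      then show ?thesis using main[OF yz] by (metis dist_commute)
    next
      case False
      then show ?thesis using main[of z y] yz by simp
    qed
  qed (use L assms in auto)
  moreover have "0 < r * exp (- 1 / \<kappa>)" using assms by simp
  moreover have "g1 x = g p" if "dist x p \<le> r * exp (- 1 / \<kappa>)" for x
    using log_cutoff_0[OF k(1) \<open>0 < r\<close> that] by (simp add: g1_def \<eta>_def)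
  moreover have far: "g1 x = g x" if "r \<le> dist x p" for x
    using log_cutoff_1[OF k(1) \<open>0 < r\<close> that] by (simp add: g1_def \<eta>_def)
  moreover have "dist (g1 x) (g x) \<le> L * r" if "x \<in> X" for x
  proof (cases "r \<le> dist x p")
    case True
    then show ?thesis using far[OF True] L assms by simp
  next
    case False
    have "g1 x - g x = (\<eta> (dist x p) - 1) *\<^sub>R (g x - g p)" by (simp add: g1_def algebra_simps)
    then have "dist (g1 x) (g x) = \<bar>\<eta> (dist x p) - 1\<bar> * norm (g x - g p)" by (simp add: dist_norm)
    also have "\<dots> \<le> 1 * (L * dist x p)"
      using b[of "dist x p"] gp[OF that] by (intro mult_mono) auto
    also have "\<dots> \<le> L * r" using False L by (simp add: mult_left_mono)
    finally show ?thesis .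
  qed
  ultimately show ?thesis by (rule that[of g1 "r * exp (- 1 / \<kappa>)"])
qed

lemma flatten_at_points:
  fixes g :: "'a::metric_space \<Rightarrow> 'b::real_normed_vector"
  assumes "finite W" "W \<subseteq> X" and lip: "L-lipschitz_on X g" and "L < L'" "0 < \<epsilon>"
  obtains g1 R where "L'-lipschitz_on X g1" "0 < R" "\<And>p x. p \<in> W \<Longrightarrow> dist x p \<le> R \<Longrightarrow> g1 x = g p"
    "\<And>x. x \<in> X \<Longrightarrow> dist (g1 x) (g x) < \<epsilon>"
proof -
  \<comment> \<open>Balls of radius \<open>\<rho>\<close> around distinct points of \<open>W\<close>
    do not interfere: a change within distance \<open>\<rho>\<close> of one point is not felt within
    distance less than \<open>\<rho>\<close> of another, and at distance exactly
    \<open>\<rho>\<close> the changed map has returned to the old one.\<close>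
  obtain \<rho> where \<rho>: "0 < \<rho>" "\<And>p q. p \<in> W \<Longrightarrow> q \<in> W \<Longrightarrow> p \<noteq> q \<Longrightarrow> 2 * \<rho> \<le> dist p q"
  proof -
    define D where "D = insert 1 ((\<lambda>z. dist (fst z) (snd z)) ` {z \<in> W \<times> W. fst z \<noteq> snd z})"
    have "finite (W \<times> W)" using \<open>finite W\<close> by simp
    then have fD: "finite D" unfolding D_def by simp
    have "\<And>d. d \<in> D \<Longrightarrow> 0 < d" "D \<noteq> {}" unfolding D_def by auto
    then have pos: "0 < Min D" using Min_in[OF fD] by blast
    have "dist p q \<in> D" if "p \<in> W" "q \<in> W" "p \<noteq> q" for p q
      unfolding D_def using that by (intro insertI2 image_eqI[of _ _ "(p, q)"]) auto
    then have "2 * (Min D / 2) \<le> dist p q" if "p \<in> W" "q \<in> W" "p \<noteq> q" for p q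
      using Min_le[OF fD] that by simp
    with pos show ?thesis by (intro that[of "Min D / 2"]) simp_all
  qed
  \<comment> \<open>The clause on all of \<open>W\<close> carries the induction: a step at
    \<open>p\<close> makes the map constant with its current value at \<open>p\<close>, and this has
    to be still \<open>g p\<close>.\<close>
  have "\<exists>g1 R. L'-lipschitz_on X g1 \<and> 0 < R \<and> (\<forall>p\<in>V. \<forall>x. dist x p \<le> R \<longrightarrow> g1 x = g p) \<and>
      (\<forall>p\<in>W. g1 p = g p) \<and> (\<forall>x\<in>X. dist (g1 x) (g x) < \<epsilon>)"
    if "finite V" "V \<subseteq> W" "L < L'" "0 < \<epsilon>" for V L' \<epsilon>
    using that
  proof (induction V arbitrary: L' \<epsilon> rule: finite_induct)
    case empty
    have "L'-lipschitz_on X g" using lip empty lipschitz_on_le by fastforce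
    then show ?case using empty by (intro exI[of _ g] exI[of _ 1]) auto
  next
    case (insert p V)
    define M where "M = (L + L') / 2"
    have M: "L < M" "M < L'" using insert by (auto simp: M_def)
    obtain g1 R1 where g1: "M-lipschitz_on X g1" "0 < R1" "\<forall>p\<in>V. \<forall>x. dist x p \<le> R1 \<longrightarrow> g1 x = g p"
      "\<forall>p\<in>W. g1 p = g p" "\<forall>x\<in>X. dist (g1 x) (g x) < \<epsilon> / 2"
      using insert.IH[of M "\<epsilon> / 2"] insert.prems M by auto
    have M0: "0 \<le> M" using g1(1) lipschitz_on_nonneg by blast
    \<comment> \<open>With \<open>M + 1\<close> in place of \<open>M\<close> the error
      \<open>M * r\<close> is strictly below the half of \<open>\<epsilon>\<close> left for this
      step.\<close>
    define r where "r = min \<rho> (\<epsilon> / (2 * (M + 1)))"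
    have r: "0 < r" "M * r < \<epsilon> / 2" "r \<le> \<rho>"
    proof -
      show "0 < r" "r \<le> \<rho>" using \<rho>(1) insert M0 by (auto simp: r_def)
      have "M * r < (M + 1) * r" using \<open>0 < r\<close> by simp
      also have "\<dots> \<le> (M + 1) * (\<epsilon> / (2 * (M + 1)))" using M0 by (intro mult_left_mono) (auto simp: r_def)
      also have "\<dots> = \<epsilon> / 2" using M0 by (simp add: field_simps)
      finally show "M * r < \<epsilon> / 2" .
    qed
    have pX: "p \<in> X" and pW: "p \<in> W" using insert.prems \<open>W \<subseteq> X\<close> by auto
    obtain g2 R2 where g2: "L'-lipschitz_on X g2" "0 < R2" "\<And>x. dist x p \<le> R2 \<Longrightarrow> g2 x = g1 p"
      "\<And>x. r \<le> dist x p \<Longrightarrow> g2 x = g1 x" "\<And>x. x \<in> X \<Longrightarrow> dist (g2 x) (g1 x) \<le> M * r"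
      using flatten_at_point[OF g1(1) pX M(2) r(1)] by metis
    define R where "R = min R2 (min R1 \<rho>)"
    have "g2 x = g q" if q: "q \<in> insert p V" "dist x q \<le> R" for q x
    proof (cases "q = p")
      case True
      then show ?thesis using g2(3)[of x] g1(4) pW q by (auto simp: R_def)
    next
      case False
      then have "2 * \<rho> \<le> dist q p" using \<rho>(2) q insert.prems pW by blast
      also have "\<dots> \<le> dist x q + dist x p" by (metis dist_commute dist_triangle)
      finally have "r \<le> dist x p" using q r by (auto simp: R_def)
      then show ?thesis using g2(4) g1(3) q False by (auto simp: R_def)
    qed
    moreover have "g2 q = g q" if q: "q \<in> W" for q
    proof (cases "q = p")
      case True
      then show ?thesis using g2(2,3) g1(4) pW by auto
    next
      case False
      then have "2 * \<rho> \<le> dist q p" using \<rho>(2) q pW by blast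
      then show ?thesis using g2(4)[of q] r \<rho>(1) g1(4) q by auto
    qed
    moreover have "dist (g2 x) (g x) < \<epsilon>" if "x \<in> X" for x
    proof -
      have "dist (g2 x) (g x) \<le> dist (g2 x) (g1 x) + dist (g1 x) (g x)" by (rule dist_triangle)
      moreover have "dist (g1 x) (g x) < \<epsilon> / 2" using g1(5) that by blast
      ultimately show ?thesis using g2(5)[OF that] r(2) by linarith
    qed
    moreover have "0 < R" using g1(2) g2(2) \<rho>(1) by (simp add: R_def)
    ultimately show ?case using g2(1) by blast
  qed
  from this[OF \<open>finite W\<close> order_refl \<open>L < L'\<close> \<open>0 < \<epsilon>\<close>] show ?thesis using that by blast
qed

text \<open>\<open>G\<close> consists of the breakpoints, paired with their values, of a path of unit speed that
  follows \<open>g\<close>.\<close>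

definition track :: "(real \<Rightarrow> 'b::metric_space) \<Rightarrow> real \<Rightarrow> real \<Rightarrow> real \<Rightarrow> (real \<times> 'b) set \<Rightarrow> bool"
  where "track g d \<alpha> \<beta> G \<longleftrightarrow> finite G \<and> (\<alpha>, g \<alpha>) \<in> G \<and> (\<beta>, g \<beta>) \<in> G \<and>
    (\<forall>s v. (s, v) \<in> G \<longrightarrow> \<alpha> \<le> s \<and> s \<le> \<beta> \<and> dist v (g s) \<le> d) \<and>
    (\<forall>s v t w. (s, v) \<in> G \<longrightarrow> (t, w) \<in> G \<longrightarrow> dist v w \<le> \<bar>s - t\<bar>) \<and>
    (\<forall>s\<in>{\<alpha>..\<beta>}. \<exists>t v t' w. (t, v) \<in> G \<and> (t', w) \<in> G \<and> t \<le> s \<and> s \<le> t' \<and> t' - t \<le> d \<and> dist v w = t' - t)"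

lemma trackD:
  assumes "track g d \<alpha> \<beta> G"
  shows "finite G" "(\<alpha>, g \<alpha>) \<in> G" "(\<beta>, g \<beta>) \<in> G"
    "(s, v) \<in> G \<Longrightarrow> \<alpha> \<le> s" "(s, v) \<in> G \<Longrightarrow> s \<le> \<beta>" "(s, v) \<in> G \<Longrightarrow> dist v (g s) \<le> d"
    "(s, v) \<in> G \<Longrightarrow> (t, w) \<in> G \<Longrightarrow> dist v w \<le> \<bar>s - t\<bar>"
    "\<alpha> \<le> s \<Longrightarrow> s \<le> \<beta> \<Longrightarrow> \<exists>t v t' w. (t, v) \<in> G \<and> (t', w) \<in> G \<and> t \<le> s \<and> s \<le> t' \<and> t' - t \<le> d \<and> dist v w = t' - t"
  using assms unfolding track_def by (blast, blast, blast, blast, blast, blast, blast, simp)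

text \<open>The junction \<open>(\<beta>, g \<beta>)\<close> belongs to both tracks, so points of
  different tracks are compared by passing through it.\<close>

lemma track_append:
  assumes A: "track g d \<alpha> \<beta> G" and B: "track g d \<beta> \<gamma> H"
  shows "track g d \<alpha> \<gamma> (G \<union> H)"
  unfolding track_def
proof (intro conjI allI impI ballI)
  show "finite (G \<union> H)" using trackD(1)[OF A] trackD(1)[OF B] by simp
  show "(\<alpha>, g \<alpha>) \<in> G \<union> H" "(\<gamma>, g \<gamma>) \<in> G \<union> H" using trackD(2)[OF A] trackD(3)[OF B] by auto
  have ab: "\<alpha> \<le> \<beta>" "\<beta> \<le> \<gamma>" using trackD(4)[OF A trackD(3)[OF A]] trackD(4)[OF B trackD(3)[OF B]] .
  fix s v assume sv: "(s, v) \<in> G \<union> H"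
  show "\<alpha> \<le> s" "s \<le> \<gamma>" "dist v (g s) \<le> d"
    using sv ab trackD(4-6)[OF A, of s v] trackD(4-6)[OF B, of s v] by (auto intro: order_trans)
  fix t w assume tw: "(t, w) \<in> G \<union> H"
  have mix: "dist v w \<le> \<bar>s - t\<bar>" if "(s, v) \<in> G" "(t, w) \<in> H" for s v t w
  proof -
    have "dist v w \<le> dist v (g \<beta>) + dist (g \<beta>) w" by (rule dist_triangle)
    also have "\<dots> \<le> \<bar>s - \<beta>\<bar> + \<bar>\<beta> - t\<bar>"
      using trackD(7)[OF A that(1) trackD(3)[OF A]] trackD(7)[OF B trackD(2)[OF B] that(2)] by (rule add_mono)
    also have "\<dots> = \<bar>s - t\<bar>" using trackD(5)[OF A that(1)] trackD(4)[OF B that(2)] by simp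
    finally show ?thesis .
  qed
  show "dist v w \<le> \<bar>s - t\<bar>"
    using sv tw mix[of s v t w] mix[of t w s v] trackD(7)[OF A, of s v t w] trackD(7)[OF B, of s v t w]
    by (auto simp: dist_commute abs_minus_commute)
next
  fix s assume s: "s \<in> {\<alpha>..\<gamma>}"
  show "\<exists>t v t' w. (t, v) \<in> G \<union> H \<and> (t', w) \<in> G \<union> H \<and> t \<le> s \<and> s \<le> t' \<and> t' - t \<le> d \<and> dist v w = t' - t"
  proof (cases "s \<le> \<beta>")
    case True
    then show ?thesis using trackD(8)[OF A, of s] s by (metis UnI1 atLeastAtMost_iff)
  next
    case False
    then show ?thesis using trackD(8)[OF B, of s] s by (metis UnI2 atLeastAtMost_iff linear)
  qed
qed

text \<open>The apex of an isosceles triangle over the base from \<open>a\<close> to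
  \<open>b\<close> with legs \<open>l / 2\<close>. The second dimension provides the direction
  \<open>n\<close> perpendicular to the base in which the surplus length is spent.\<close>

lemma apex_exists:
  fixes a b :: "'b::euclidean_space"
  assumes "2 \<le> DIM('b)" "dist a b \<le> l"
  obtains c where "dist c a = l / 2" "dist c b = l / 2"
proof -
  obtain y where y: "y \<noteq> 0" "orthogonal (b - a) y" using orthogonal_to_vector_exists[OF assms(1)] by blast
  define n where "n = y /\<^sub>R norm y"
  have n: "n \<bullet> n = 1" "(b - a) \<bullet> n = 0"
    using y by (auto simp: n_def orthogonal_def power2_eq_square field_simps dot_square_norm)
  define h where "h = sqrt ((l / 2)\<^sup>2 - (dist a b / 2)\<^sup>2)"
  have l0: "0 \<le> l" using assms(2) zero_le_dist order_trans by blast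
  have h2: "h\<^sup>2 = (l / 2)\<^sup>2 - (dist a b / 2)\<^sup>2"
    unfolding h_def using assms(2) by (intro real_sqrt_pow2) (simp add: power_mono)
  define c where "c = a + (1/2) *\<^sub>R (b - a) + h *\<^sub>R n"
  have ca: "c - a = (1/2) *\<^sub>R (b - a) + h *\<^sub>R n" by (simp add: c_def)
  have "(1/2) *\<^sub>R (b - a) - 1 *\<^sub>R (b - a) = (-(1/2)) *\<^sub>R (b - a)"
    unfolding scaleR_left_diff_distrib[symmetric] by simp
  moreover have "c - b = (1/2) *\<^sub>R (b - a) - 1 *\<^sub>R (b - a) + h *\<^sub>R n" by (simp add: c_def)
  ultimately have cb: "c - b = (-(1/2)) *\<^sub>R (b - a) + h *\<^sub>R n" by simp
  have sq: "(norm (u *\<^sub>R (b - a) + h *\<^sub>R n))\<^sup>2 = (l / 2)\<^sup>2" if "u\<^sup>2 = 1/4" for u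
  proof -
    have "(norm (u *\<^sub>R (b - a) + h *\<^sub>R n))\<^sup>2 = u\<^sup>2 * ((b - a) \<bullet> (b - a)) + h\<^sup>2"
      using n unfolding power2_norm_eq_inner
      by (simp add: inner_add_left inner_add_right inner_commute[of n "b - a"] power2_eq_square)
    also have "\<dots> = (l / 2)\<^sup>2"
      unfolding h2 that by (simp add: dot_square_norm dist_norm norm_minus_commute power_divide)
    finally show ?thesis .
  qed
  show ?thesis
  proof (rule that)
    have "(1/2::real)\<^sup>2 = 1/4" "(-(1/2)::real)\<^sup>2 = 1/4" by (simp_all add: power2_eq_square)
    note q = sq[OF this(1)] sq[OF this(2)]
    show "dist c a = l / 2" unfolding dist_norm ca
      by (rule power2_eq_imp_eq[OF q(1)]) (use l0 in auto)
    show "dist c b = l / 2" unfolding dist_norm cb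
      by (rule power2_eq_imp_eq[OF q(2)]) (use l0 in auto)
  qed
qed

text \<open>One tooth of the zigzag: the middle of the interval is sent to an apex over the two end
  values, so both legs have unit speed.\<close>

lemma track_short_interval:
  fixes g :: "real \<Rightarrow> 'b::euclidean_space"
  assumes "2 \<le> DIM('b)" "\<alpha> \<le> \<beta>" "\<beta> - \<alpha> \<le> d"
    and lip: "\<And>s t. s \<in> {\<alpha>..\<beta>} \<Longrightarrow> t \<in> {\<alpha>..\<beta>} \<Longrightarrow> dist (g s) (g t) \<le> \<bar>s - t\<bar>"
  shows "\<exists>G. track g d \<alpha> \<beta> G"
proof -
  obtain c where c: "dist c (g \<alpha>) = (\<beta> - \<alpha>) / 2" "dist c (g \<beta>) = (\<beta> - \<alpha>) / 2"
    using apex_exists[OF assms(1), of "g \<alpha>" "g \<beta>" "\<beta> - \<alpha>"] lip[of \<alpha> \<beta>] assms(2) by auto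
  define m where "m = (\<alpha> + \<beta>) / 2"
  have m: "\<alpha> \<le> m" "m \<le> \<beta>" "m - \<alpha> = (\<beta> - \<alpha>) / 2" "\<beta> - m = (\<beta> - \<alpha>) / 2"
    using assms(2) by (auto simp: m_def field_simps)
  have "dist c (g m) \<le> dist c (g \<alpha>) + dist (g \<alpha>) (g m)" by (rule dist_triangle)
  also have "\<dots> \<le> (\<beta> - \<alpha>) / 2 + (\<beta> - \<alpha>) / 2" using c(1) lip[of \<alpha> m] m by (intro add_mono) auto
  finally have cm: "dist c (g m) \<le> d" using assms(3) by simp
  have d0: "0 \<le> d" using assms by simp
  have "track g d \<alpha> \<beta> {(\<alpha>, g \<alpha>), (m, c), (\<beta>, g \<beta>)}"
    unfolding track_def
  proof (intro conjI allI impI ballI)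
    fix s v assume sv: "(s, v) \<in> {(\<alpha>, g \<alpha>), (m, c), (\<beta>, g \<beta>)}"
    show "\<alpha> \<le> s" "s \<le> \<beta>" "dist v (g s) \<le> d" using sv m assms(2) cm d0 by auto
    fix t w assume "(t, w) \<in> {(\<alpha>, g \<alpha>), (m, c), (\<beta>, g \<beta>)}"
    then show "dist v w \<le> \<bar>s - t\<bar>"
      using sv m c lip[of \<alpha> \<beta>] assms(2) by (auto simp: dist_commute)
  next
    fix s assume s: "s \<in> {\<alpha>..\<beta>}"
    show "\<exists>t v t' w. (t, v) \<in> {(\<alpha>, g \<alpha>), (m, c), (\<beta>, g \<beta>)} \<and> (t', w) \<in> {(\<alpha>, g \<alpha>), (m, c), (\<beta>, g \<beta>)} \<and>
      t \<le> s \<and> s \<le> t' \<and> t' - t \<le> d \<and> dist v w = t' - t"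
    proof (cases "s \<le> m")
      case True
      then show ?thesis
        by (intro exI[of _ \<alpha>] exI[of _ "g \<alpha>"] exI[of _ m] exI[of _ c])
          (use s m c assms(2,3) in \<open>auto simp: dist_commute\<close>)
    next
      case False
      then show ?thesis
        by (intro exI[of _ m] exI[of _ c] exI[of _ \<beta>] exI[of _ "g \<beta>"])
          (use s m c assms(2,3) in \<open>auto simp: dist_commute\<close>)
    qed
  qed auto
  then show ?thesis by blast
qed

lemma track_exists:
  fixes g :: "real \<Rightarrow> 'b::euclidean_space"
  assumes D: "2 \<le> DIM('b)" and "\<alpha> \<le> \<beta>" "0 < d"
    and "\<And>s t. s \<in> {\<alpha>..\<beta>} \<Longrightarrow> t \<in> {\<alpha>..\<beta>} \<Longrightarrow> dist (g s) (g t) \<le> \<bar>s - t\<bar>"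
  shows "\<exists>G. track g d \<alpha> \<beta> G"
proof -
  obtain n :: nat where "(\<beta> - \<alpha>) / d \<le> real n" using real_arch_simple by blast
  then have "\<beta> - \<alpha> \<le> real n * d" using \<open>0 < d\<close> by (simp add: field_simps)
  with assms(2,4) show ?thesis
  proof (induction n arbitrary: \<alpha>)
    case 0
    then show ?case using \<open>0 < d\<close> by (intro track_short_interval[OF D]) auto
  next
    case (Suc n)
    show ?case
    proof (cases "\<beta> - \<alpha> \<le> d")
      case True
      then show ?thesis using Suc.prems by (intro track_short_interval[OF D]) auto
    next
      case False
      have "\<exists>G. track g d \<alpha> (\<alpha> + d) G"
        using Suc.prems(2) False \<open>0 < d\<close> by (intro track_short_interval[OF D]) auto
      moreover have "\<exists>G. track g d (\<alpha> + d) \<beta> G"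
        using Suc.prems False \<open>0 < d\<close> by (intro Suc.IH) (auto simp: algebra_simps)
      ultimately show ?thesis using track_append by blast
    qed
  qed
qed

text \<open>The breakpoints of a zigzag between \<open>a\<close> and a point at distance
  \<open>d / 2\<close> in direction \<open>u\<close>, on the whole half-line. Edges of any length
  starting at one vertex take their breakpoints from this same set.\<close>

definition wave :: "real \<Rightarrow> 'b::real_normed_vector \<Rightarrow> 'b \<Rightarrow> (real \<times> 'b) set"
  where "wave d a u = (\<lambda>k::nat. (real k * (d / 2), a + (if even k then 0 else d / 2) *\<^sub>R u)) ` UNIV"

lemma mem_wave:
  "(s, v) \<in> wave d a u \<longleftrightarrow> (\<exists>k::nat. s = real k * (d / 2) \<and> v = a + (if even k then 0 else d / 2) *\<^sub>R u)"
  unfolding wave_def by (simp add: image_iff)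

text \<open>Values differ only for indices of different parity, which are at least one step apart.
  This compares breakpoints on different edges at one vertex, each placed at its distance to the
  vertex.\<close>

lemma wave_short:
  assumes "(s, v) \<in> wave d a u" "(t, w) \<in> wave d a u" "norm u = 1" "0 < d"
  shows "dist v w \<le> \<bar>s - t\<bar>"
proof -
  obtain k l where kl: "s = real k * (d / 2)" "v = a + (if even k then 0 else d / 2) *\<^sub>R u"
    "t = real l * (d / 2)" "w = a + (if even l then 0 else d / 2) *\<^sub>R u"
    using assms(1,2) unfolding mem_wave by metis
  show ?thesis
  proof (cases "even k = even l")
    case True
    then show ?thesis by (simp add: kl)
  next
    case False
    then have "k \<noteq> l" by auto
    then have "1 \<le> \<bar>real k - real l\<bar>" by linarith
    then have "d / 2 \<le> \<bar>real k - real l\<bar> * (d / 2)" using assms(4) by simp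
    also have "\<dots> = \<bar>s - t\<bar>" using assms(4) by (simp add: kl left_diff_distrib[symmetric] abs_mult del: times_divide_eq_right)
    finally show ?thesis using False assms(3,4) by (auto simp: kl dist_norm)
  qed
qed

text \<open>The length \<open>real N * d\<close> consists of an even number of half meshes, so the
  wave is back at \<open>a\<close> at the right end and can be joined to another track.\<close>

lemma track_wave:
  fixes a :: "'b::euclidean_space"
  assumes "0 < d" "norm u = 1" and g: "\<And>s. s \<in> {0..real N * d} \<Longrightarrow> g s = a"
  obtains G where "track g d 0 (real N * d) G" "G \<subseteq> wave d a u"
proof -
  define p where "p k = (real k * (d / 2), a + (if even k then 0 else d / 2) *\<^sub>R u)" for k :: nat
  define G where "G = p ` {..2 * N}"
  have GW: "G \<subseteq> wave d a u" unfolding G_def wave_def p_def by blast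
  have le: "real k * (d / 2) \<le> real N * d" if "k \<le> 2 * N" for k
  proof -
    have "real k * (d / 2) \<le> real (2 * N) * (d / 2)" using that assms(1) by (intro mult_right_mono) auto
    then show ?thesis by simp
  qed
  have "track g d 0 (real N * d) G"
    unfolding track_def
  proof (intro conjI allI impI ballI)
    show "finite G" by (simp add: G_def)
    have "p 0 \<in> G" "p (2 * N) \<in> G" by (auto simp: G_def)
    moreover have "p 0 = (0, g 0)" "p (2 * N) = (real N * d, g (real N * d))"
      using g[of 0] g[of "real N * d"] assms(1) by (auto simp: p_def)
    ultimately show "(0, g 0) \<in> G" "(real N * d, g (real N * d)) \<in> G" by auto
    fix s v assume sv: "(s, v) \<in> G"
    then obtain k where k: "k \<le> 2 * N" "s = real k * (d / 2)" "v = a + (if even k then 0 else d / 2) *\<^sub>R u"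
      unfolding G_def p_def by blast
    show s: "0 \<le> s" "s \<le> real N * d" unfolding k(2) using le[OF k(1)] assms(1) by simp_all
    show "dist v (g s) \<le> d" using g[of s] s assms(1,2) by (auto simp: k(3) dist_norm)
    show "dist v w \<le> \<bar>s - t\<bar>" if "(t, w) \<in> G" for t w
      using wave_short[of s v d a u t w] sv that GW assms(1,2) by blast
  next
    fix s assume s: "s \<in> {0..real N * d}"
    show "\<exists>t v t' w. (t, v) \<in> G \<and> (t', w) \<in> G \<and> t \<le> s \<and> s \<le> t' \<and> t' - t \<le> d \<and> dist v w = t' - t"
    proof (cases "s = real N * d")
      case True
      \<comment> \<open>At the right end the next breakpoint lies outside \<open>G\<close>; a
        degenerate pair of equal points takes its place.\<close>
      have "p (2 * N) \<in> G" by (auto simp: G_def)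
      then have "(s, snd (p (2 * N))) \<in> G" by (simp add: p_def True)
      then show ?thesis using assms(1) by (intro exI[of _ s] exI[of _ "snd (p (2 * N))"]) auto
    next
      case False
      define k where "k = nat \<lfloor>s / (d / 2)\<rfloor>"
      have "0 \<le> s / (d / 2)" using s assms(1) by simp
      then have k: "real k \<le> s / (d / 2)" "s / (d / 2) < real k + 1"
        unfolding k_def by linarith+
      have s2: "real k * (d / 2) \<le> s" "s \<le> real (Suc k) * (d / 2)"
        using k assms(1) by (auto simp: field_simps)
      have "real k * (d / 2) < real N * d" using s2 s False by auto
      then have "real k < 2 * real N" using assms(1) by (simp add: field_simps)
      then have "k < 2 * N" by linarith
      then have "p k \<in> G" "p (Suc k) \<in> G" by (auto simp: G_def)
      moreover have "dist (snd (p k)) (snd (p (Suc k))) = d / 2"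
        using assms(1,2) by (auto simp: p_def dist_norm)
      moreover have "fst (p (Suc k)) - fst (p k) = d / 2" by (simp add: p_def algebra_simps add_divide_distrib)
      ultimately show ?thesis using s2 assms(1)
        by (intro exI[of _ "fst (p k)"] exI[of _ "snd (p k)"] exI[of _ "fst (p (Suc k))"] exI[of _ "snd (p (Suc k))"])
          (auto simp: p_def)
    qed
  qed
  then show ?thesis using GW by (rule that)
qed

lemma track_reflect:
  assumes "track g d \<alpha> \<beta> G"
  shows "track (\<lambda>s. g (l - s)) d (l - \<beta>) (l - \<alpha>) ((\<lambda>(s, v). (l - s, v)) ` G)"
  unfolding track_def
proof (intro conjI allI impI ballI)
  let ?H = "(\<lambda>(s, v). (l - s, v)) ` G"
  have mem: "(s, v) \<in> ?H \<longleftrightarrow> (l - s, v) \<in> G" for s v by force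
  show "finite ?H" using trackD(1)[OF assms] by simp
  show "(l - \<beta>, g (l - (l - \<beta>))) \<in> ?H" "(l - \<alpha>, g (l - (l - \<alpha>))) \<in> ?H"
    unfolding mem using trackD(2,3)[OF assms] by auto
  fix s v assume sv: "(s, v) \<in> ?H"
  note sv' = sv[unfolded mem]
  show "l - \<beta> \<le> s" "s \<le> l - \<alpha>" "dist v (g (l - s)) \<le> d" using trackD(4-6)[OF assms sv'] by auto
  show "dist v w \<le> \<bar>s - t\<bar>" if "(t, w) \<in> ?H" for t w
    using trackD(7)[OF assms sv', of "l - t" w] that[unfolded mem] by (simp add: abs_minus_commute)
next
  let ?H = "(\<lambda>(s, v). (l - s, v)) ` G"
  have mem: "(s, v) \<in> ?H \<longleftrightarrow> (l - s, v) \<in> G" for s v by force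
  fix s assume "s \<in> {l - \<beta>..l - \<alpha>}"
  then obtain t v t' w where *: "(t, v) \<in> G" "(t', w) \<in> G" "t \<le> l - s" "l - s \<le> t'" "t' - t \<le> d" "dist v w = t' - t"
    using trackD(8)[OF assms, of "l - s"] by auto
  then show "\<exists>t v t' w. (t, v) \<in> ?H \<and> (t', w) \<in> ?H \<and> t \<le> s \<and> s \<le> t' \<and> t' - t \<le> d \<and> dist v w = t' - t"
    unfolding mem
    by (intro exI[of _ "l - t'"] exI[of _ w] exI[of _ "l - t"] exI[of _ v]) (auto simp: dist_commute)
qed

text \<open>A wave at each end and any track of \<open>g\<close> between them;
  \<open>2 * R < l\<close> keeps the waves apart. Breakpoints with \<open>s < R\<close> or
  \<open>l - s < R\<close> cannot stem from the middle track, which lives on the parameters from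
  \<open>R\<close> to \<open>l - R\<close>.\<close>

lemma edge_track:
  fixes g :: "real \<Rightarrow> 'b::euclidean_space"
  assumes D: "2 \<le> DIM('b)" and d: "0 < d" "R = real N * d" and R: "2 * R < l" and u: "norm u = 1"
    and lip: "\<And>s t. s \<in> {0..l} \<Longrightarrow> t \<in> {0..l} \<Longrightarrow> dist (g s) (g t) \<le> \<bar>s - t\<bar>"
    and a: "\<And>s. s \<in> {0..R} \<Longrightarrow> g s = a" and b: "\<And>s. s \<in> {l - R..l} \<Longrightarrow> g s = b"
  obtains G where "track g d 0 l G" "\<And>s v. (s, v) \<in> G \<Longrightarrow> s < R \<Longrightarrow> (s, v) \<in> wave d a u"
    "\<And>s v. (s, v) \<in> G \<Longrightarrow> l - s < R \<Longrightarrow> (l - s, v) \<in> wave d b u"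
proof -
  have R0: "0 \<le> R" using d by simp
  obtain G1 where G1: "track g d 0 R G1" "G1 \<subseteq> wave d a u"
    using track_wave[OF d(1) u, of N g a] a unfolding d(2) by blast
  obtain G0 where G0: "track (\<lambda>s. g (l - s)) d 0 R G0" "G0 \<subseteq> wave d b u"
    using track_wave[OF d(1) u, of N "\<lambda>s. g (l - s)" b] b unfolding d(2) by auto
  define G3 where "G3 = (\<lambda>(s, v). (l - s, v)) ` G0"
  have G3: "track g d (l - R) l G3"
    using track_reflect[OF G0(1), of l] by (simp add: G3_def)
  obtain G2 where G2: "track g d R (l - R) G2"
    using track_exists[OF D, of R "l - R" d g] R R0 d(1) lip by auto
  have T: "track g d 0 l ((G1 \<union> G2) \<union> G3)"
    by (rule track_append[OF track_append[OF G1(1) G2] G3])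
  have "(s, v) \<in> wave d a u" if "(s, v) \<in> (G1 \<union> G2) \<union> G3" "s < R" for s v
    using that trackD(4)[OF G2, of s v] trackD(4)[OF G3, of s v] G1(2) R by auto
  moreover have "(l - s, v) \<in> wave d b u" if "(s, v) \<in> (G1 \<union> G2) \<union> G3" "l - s < R" for s v
  proof -
    have "(s, v) \<in> G3" using that trackD(5)[OF G2, of s v] trackD(5)[OF G1(1), of s v] R by auto
    then show ?thesis using G0(2) by (auto simp: G3_def)
  qed
  ultimately show ?thesis using T that by blast
qed


section \<open>Prescribed values on all edges\<close>

lemma compact_positive_lower_bound:
  fixes f :: "'a::topological_space \<Rightarrow> real"
  assumes "compact K" "continuous_on K f" "\<And>x. x \<in> K \<Longrightarrow> 0 < f x"
  shows "\<exists>c>0. \<forall>x\<in>K. c \<le> f x"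
proof (cases "K = {}")
  case False
  then obtain x where "x \<in> K" "\<forall>y\<in>K. f x \<le> f y" using continuous_attains_inf assms by blast
  then show ?thesis using assms(3) by blast
qed (auto intro: exI[of _ 1])

lemma finite_positive_lower_bound:
  fixes f :: "'i \<Rightarrow> 'x \<Rightarrow> real"
  assumes "finite A" "\<And>a. a \<in> A \<Longrightarrow> \<exists>c>0. \<forall>x\<in>S a. c \<le> f a x"
  shows "\<exists>c>0. \<forall>a\<in>A. \<forall>x\<in>S a. c \<le> f a x"
  using assms
proof (induction A rule: finite_induct)
  case empty
  then show ?case by (auto intro: exI[of _ 1])
next
  case (insert a A)
  then obtain c where "c > 0" "\<forall>a\<in>A. \<forall>x\<in>S a. c \<le> f a x" by blast
  moreover obtain c' where "c' > 0" "\<forall>x\<in>S a. c' \<le> f a x" using insert.prems by blast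
  ultimately show ?case by (intro exI[of _ "min c c'"]) fastforce
qed

text \<open>The order of choices matters. The radius \<open>R\<close> of the common zigzags is fixed
  first. Compactness then bounds from below the distance of points on different edges that are not
  both within \<open>R\<close> of a common end (\<open>c0\<close>), and of net points from the edges
  (\<open>c1\<close>). The mesh \<open>d\<close> comes last and is small compared with these bounds
  times \<open>1 - L\<close>.\<close>

lemma edge_data:
  fixes \<gamma> :: "'e \<Rightarrow> real \<Rightarrow> 'a::metric_space" and h :: "'a \<Rightarrow> 'b::euclidean_space"
  assumes D: "2 \<le> DIM('b)" and finI: "finite I" and l: "\<And>e. e \<in> I \<Longrightarrow> 0 < l e"
    and iso: "\<And>e s t. e \<in> I \<Longrightarrow> s \<in> {0..l e} \<Longrightarrow> t \<in> {0..l e} \<Longrightarrow> dist (\<gamma> e s) (\<gamma> e t) = \<bar>s - t\<bar>"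
    and inP: "\<And>e s. e \<in> I \<Longrightarrow> s \<in> {0..l e} \<Longrightarrow> \<gamma> e s \<in> P"
    and cross: "\<And>e e' s t. e \<in> I \<Longrightarrow> e' \<in> I \<Longrightarrow> e \<noteq> e' \<Longrightarrow> s \<in> {0..l e} \<Longrightarrow> t \<in> {0..l e'} \<Longrightarrow>
      \<gamma> e s = \<gamma> e' t \<Longrightarrow> (s = 0 \<or> s = l e) \<and> (t = 0 \<or> t = l e')"
    and lip: "L-lipschitz_on P h" "L < 1"
    and R0: "0 < R0" "\<And>e x. e \<in> I \<Longrightarrow> dist x (\<gamma> e 0) \<le> R0 \<Longrightarrow> h x = h (\<gamma> e 0)"
      "\<And>e x. e \<in> I \<Longrightarrow> dist x (\<gamma> e (l e)) \<le> R0 \<Longrightarrow> h x = h (\<gamma> e (l e))"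
    and N0: "finite N0" "N0 \<subseteq> P" and "0 < \<epsilon>"
  obtains G where "finite G" "\<And>x v. (x, v) \<in> G \<Longrightarrow> x \<in> P \<and> dist v (h x) < \<epsilon>"
    "\<And>x v y w. (x, v) \<in> G \<Longrightarrow> (y, w) \<in> G \<Longrightarrow> dist v w \<le> dist x y"
    "\<And>e s. e \<in> I \<Longrightarrow> s \<in> {0..l e} \<Longrightarrow> \<exists>t v t' w. (\<gamma> e t, v) \<in> G \<and> (\<gamma> e t', w) \<in> G \<and>
      0 \<le> t \<and> t \<le> s \<and> s \<le> t' \<and> t' \<le> l e \<and> t' - t < \<epsilon> \<and> dist v w = t' - t"
    "\<And>e. e \<in> I \<Longrightarrow> (\<gamma> e 0, h (\<gamma> e 0)) \<in> G \<and> (\<gamma> e (l e), h (\<gamma> e (l e))) \<in> G"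
    "\<And>n. n \<in> N0 \<Longrightarrow> (\<And>e. e \<in> I \<Longrightarrow> n \<notin> \<gamma> e ` {0..l e}) \<Longrightarrow> (n, h n) \<in> G"
proof -
  have L0: "0 \<le> L" using lip(1) lipschitz_on_nonneg by blast
  have cont: "continuous_on {0..l e} (\<gamma> e)" if "e \<in> I" for e
    using iso[OF that] by (intro lipschitz_on_continuous_on[of 1] lipschitz_onI) (auto simp: dist_real_def)
  obtain l0 where l0: "0 < l0" "\<And>e. e \<in> I \<Longrightarrow> l0 \<le> l e"
    using finite_positive_lower_bound[OF finI, of "\<lambda>_. {()}" "\<lambda>e _. l e"] l by auto
  define R where "R = min R0 (l0 / 3)"
  have R: "0 < R" "R \<le> R0" "\<And>e. e \<in> I \<Longrightarrow> 2 * R < l e"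
    using R0(1) l0(1) by (auto simp: R_def dest: l0(2))
  define pos where "pos e b s = (if b then l e - s else s)" for e s and b :: bool
  define en where "en e b = \<gamma> e (if b then l e else 0)" for e and b :: bool
  have en_dist: "dist (\<gamma> e s) (en e b) = pos e b s" if "e \<in> I" "s \<in> {0..l e}" for e s b
    using iso[OF that(1,2), of "if b then l e else 0"] that l[OF that(1)]
    by (auto simp: en_def pos_def)
  have flat: "h x = h (en e b)" if "e \<in> I" "dist x (en e b) \<le> R" for e b x
    using that R(2) R0(2,3)[OF that(1), of x] by (auto simp: en_def split: if_splits)
  \<comment> \<open>The parameter pairs for which no comparison through a common end is available:
    at every common end, one of the two points is at least \<open>R\<close> away. The weak
    inequality makes this set closed, hence compact. If the edges have no common end, all pairs
    belong to it.\<close>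
  define bad where "bad z = {st \<in> {0..l (fst z)} \<times> {0..l (snd z)}. \<forall>b b'. en (fst z) b = en (snd z) b' \<longrightarrow>
      R \<le> pos (fst z) b (fst st) \<or> R \<le> pos (snd z) b' (snd st)}" for z :: "'e \<times> 'e"
  have "\<exists>c>0. \<forall>z\<in>{z \<in> I \<times> I. fst z \<noteq> snd z}. \<forall>st\<in>bad z. c \<le> dist (\<gamma> (fst z) (fst st)) (\<gamma> (snd z) (snd st))"
  proof (rule finite_positive_lower_bound)
    show "finite {z \<in> I \<times> I. fst z \<noteq> snd z}" using finI by simp
    fix z assume "z \<in> {z \<in> I \<times> I. fst z \<noteq> snd z}"
    then obtain e e' where z: "z = (e, e')" "e \<in> I" "e' \<in> I" "e \<noteq> e'" by auto
    have cl: "closed {st. P' \<longrightarrow> R \<le> pos e b (fst st) \<or> R \<le> pos e' b' (snd st)}" for P' b b'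
    proof (cases P')
      case True
      have "continuous_on UNIV (\<lambda>st::real \<times> real. pos e b (fst st))" "continuous_on UNIV (\<lambda>st::real \<times> real. pos e' b' (snd st))"
        unfolding pos_def by (cases b; auto intro!: continuous_intros) (cases b'; auto intro!: continuous_intros)
      then show ?thesis using True
        by (simp, intro closed_Collect_disj closed_Collect_le continuous_on_const) auto
    qed simp
    have "bad z = ({0..l e} \<times> {0..l e'}) \<inter>
        (\<Inter>b. \<Inter>b'. {st. en e b = en e' b' \<longrightarrow> R \<le> pos e b (fst st) \<or> R \<le> pos e' b' (snd st)})"
      unfolding bad_def z(1) by auto
    moreover have "closed (\<Inter>b. \<Inter>b'. {st. en e b = en e' b' \<longrightarrow> R \<le> pos e b (fst st) \<or> R \<le> pos e' b' (snd st)})"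
      by (intro closed_INT ballI cl)
    ultimately have "compact (bad z)" by (simp add: compact_Int_closed compact_Times)
    moreover have "continuous_on (bad z) (\<lambda>st. dist (\<gamma> (fst z) (fst st)) (\<gamma> (snd z) (snd st)))"
    proof (intro continuous_intros)
      show "continuous_on (bad z) (\<lambda>x. \<gamma> (fst z) (fst x))"
        by (rule continuous_on_compose2[OF cont[of "fst z"]]) (auto simp: z bad_def intro!: continuous_intros)
      show "continuous_on (bad z) (\<lambda>x. \<gamma> (snd z) (snd x))"
        by (rule continuous_on_compose2[OF cont[of "snd z"]]) (auto simp: z bad_def intro!: continuous_intros)
    qed
    \<comment> \<open>Different edges can meet only in a common end, where both positions are 0 and
      thus less than \<open>R\<close>; the definition of \<open>bad\<close> excludes this
      pair.\<close>
    moreover have "0 < dist (\<gamma> (fst z) (fst st)) (\<gamma> (snd z) (snd st))" if st: "st \<in> bad z" for st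
    proof (rule ccontr)
      assume "\<not> ?thesis"
      then have eq: "\<gamma> e (fst st) = \<gamma> e' (snd st)" by (simp add: z)
      have m: "fst st \<in> {0..l e}" "snd st \<in> {0..l e'}" using st by (auto simp: bad_def z)
      have "fst st = 0 \<or> fst st = l e" "snd st = 0 \<or> snd st = l e'" using cross[OF z(2-4) m eq] by auto
      then obtain b b' where b: "fst st = (if b then l e else 0)" "snd st = (if b' then l e' else 0)" by metis
      then have "en e b = en e' b'" using eq by (simp add: en_def)
      then have "R \<le> pos e b (fst st) \<or> R \<le> pos e' b' (snd st)" using st by (auto simp: bad_def z)
      then show False using R(1) by (auto simp: pos_def b split: if_splits)
    qed
    ultimately show "\<exists>c>0. \<forall>x\<in>bad z. c \<le> dist (\<gamma> (fst z) (fst x)) (\<gamma> (snd z) (snd x))"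
      by (rule compact_positive_lower_bound)
  qed
  then obtain c0 where c0: "0 < c0" "\<And>z st. z \<in> {z \<in> I \<times> I. fst z \<noteq> snd z} \<Longrightarrow> st \<in> bad z \<Longrightarrow>
    c0 \<le> dist (\<gamma> (fst z) (fst st)) (\<gamma> (snd z) (snd st))" by blast
  define N where "N = {n \<in> N0. \<forall>e\<in>I. n \<notin> \<gamma> e ` {0..l e}}"
  have "\<exists>c>0. \<forall>z\<in>N \<times> I. \<forall>s\<in>{0..l (snd z)}. c \<le> dist (fst z) (\<gamma> (snd z) s)"
  proof (rule finite_positive_lower_bound)
    show "finite (N \<times> I)" using N0 finI by (simp add: N_def)
    fix z assume z: "z \<in> N \<times> I"
    show "\<exists>c>0. \<forall>s\<in>{0..l (snd z)}. c \<le> dist (fst z) (\<gamma> (snd z) s)"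
    proof (rule compact_positive_lower_bound)
      show "continuous_on {0..l (snd z)} (\<lambda>s. dist (fst z) (\<gamma> (snd z) s))"
        using z by (intro continuous_intros cont) auto
      show "0 < dist (fst z) (\<gamma> (snd z) s)" if "s \<in> {0..l (snd z)}" for s
        using z that by (auto simp: N_def)
    qed simp
  qed
  then obtain c1 where c1: "0 < c1" "\<And>z s. z \<in> N \<times> I \<Longrightarrow> s \<in> {0..l (snd z)} \<Longrightarrow> c1 \<le> dist (fst z) (\<gamma> (snd z) s)"
    by blast
  \<comment> \<open>Two breakpoints deviate from \<open>h\<close> by at most \<open>2 * d\<close>
    together. The second bound keeps this within the budget for points at distance at least
    \<open>c0\<close> or \<open>c1\<close>; the first gives the required closeness.\<close>
  define \<delta> where "\<delta> = min \<epsilon> ((1 - L) * min c0 c1 / 2)"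
  have \<delta>: "0 < \<delta>" using \<open>0 < \<epsilon>\<close> lip(2) c0(1) c1(1) by (simp add: \<delta>_def)
  obtain M :: nat where M: "R / \<delta> < real M" using reals_Archimedean2 by blast
  then have M0: "0 < real M" using R(1) \<delta> by (meson divide_pos_pos less_trans)
  \<comment> \<open>\<open>R\<close> has to be an integral multiple of the mesh, so that the waves
    end at the value of \<open>h\<close> at the vertex.\<close>
  define d where "d = R / real M"
  have d: "0 < d" "R = real M * d" "d < \<delta>"
    using M M0 R(1) \<delta> by (auto simp: d_def field_simps)
  have dc: "2 * d \<le> (1 - L) * min c0 c1" "d < \<epsilon>" using d(3) by (auto simp: \<delta>_def)
  have close: "2 * d \<le> (1 - L) * x" if "c0 \<le> x \<or> c1 \<le> x" for x
  proof -
    have "(1 - L) * min c0 c1 \<le> (1 - L) * x" using that lip(2) by (intro mult_left_mono) auto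
    then show ?thesis using dc by linarith
  qed
  obtain u :: 'b where u: "norm u = 1" using nonempty_Basis norm_Basis by blast
  have "\<exists>T. track (\<lambda>s. h (\<gamma> e s)) d 0 (l e) T \<and>
    (\<forall>b s v. (s, v) \<in> T \<longrightarrow> pos e b s < R \<longrightarrow> (pos e b s, v) \<in> wave d (h (en e b)) u)" if e: "e \<in> I" for e
  proof -
    have lp: "dist (h (\<gamma> e s)) (h (\<gamma> e t)) \<le> \<bar>s - t\<bar>" if "s \<in> {0..l e}" "t \<in> {0..l e}" for s t
    proof -
      have "dist (h (\<gamma> e s)) (h (\<gamma> e t)) \<le> L * \<bar>s - t\<bar>"
        using lipschitz_onD[OF lip(1) inP[OF e that(1)] inP[OF e that(2)]] iso[OF e that] by simp
      also have "\<dots> \<le> 1 * \<bar>s - t\<bar>" using lip(2) by (intro mult_right_mono) auto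
      finally show ?thesis by simp
    qed
    have A: "h (\<gamma> e s) = h (en e False)" if "s \<in> {0..R}" for s
      using flat[OF e, of "\<gamma> e s" False] en_dist[OF e, of s False] that R(1) R(3)[OF e] by (auto simp: pos_def)
    have B: "h (\<gamma> e s) = h (en e True)" if "s \<in> {l e - R..l e}" for s
      using flat[OF e, of "\<gamma> e s" True] en_dist[OF e, of s True] that R(1) R(3)[OF e] by (auto simp: pos_def)
    obtain T where T: "track (\<lambda>s. h (\<gamma> e s)) d 0 (l e) T"
      "\<And>s v. (s, v) \<in> T \<Longrightarrow> s < R \<Longrightarrow> (s, v) \<in> wave d (h (en e False)) u"
      "\<And>s v. (s, v) \<in> T \<Longrightarrow> l e - s < R \<Longrightarrow> (l e - s, v) \<in> wave d (h (en e True)) u"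
      using edge_track[OF D d(1,2) R(3)[OF e] u, of "\<lambda>s. h (\<gamma> e s)" "h (en e False)" "h (en e True)"] lp A B
      by blast
    have "(pos e b s, v) \<in> wave d (h (en e b)) u" if "(s, v) \<in> T" "pos e b s < R" for b s v
      using T(2)[OF that(1)] T(3)[OF that(1)] that(2) by (cases b) (simp_all add: pos_def)
    then show ?thesis using T(1) by blast
  qed
  then obtain T where T: "\<And>e. e \<in> I \<Longrightarrow> track (\<lambda>s. h (\<gamma> e s)) d 0 (l e) (T e)"
    "\<And>e b s v. e \<in> I \<Longrightarrow> (s, v) \<in> T e \<Longrightarrow> pos e b s < R \<Longrightarrow> (pos e b s, v) \<in> wave d (h (en e b)) u"
    by metis
  define G where "G = (\<Union>e\<in>I. (\<lambda>z. (\<gamma> e (fst z), snd z)) ` T e) \<union> (\<lambda>n. (n, h n)) ` N"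
  have GE: "(\<gamma> e s, v) \<in> G" if "e \<in> I" "(s, v) \<in> T e" for e s v
    unfolding G_def using that by force
  have Gcases: "(\<exists>e s. e \<in> I \<and> x = \<gamma> e s \<and> (s, v) \<in> T e) \<or> x \<in> N \<and> v = h x" if "(x, v) \<in> G" for x v
    using that unfolding G_def by force
  have Ts: "s \<in> {0..l e}" "dist v (h (\<gamma> e s)) \<le> d" if "e \<in> I" "(s, v) \<in> T e" for e s v
    using trackD(4-6)[OF T(1)[OF that(1)] that(2)] by auto
  have approx: "x \<in> P \<and> dist v (h x) \<le> d" if "(x, v) \<in> G" for x v
    using Gcases[OF that]
  proof (elim disjE exE conjE)
    fix e s assume "e \<in> I" "x = \<gamma> e s" "(s, v) \<in> T e"
    then show ?thesis using Ts inP by blast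
  next
    assume "x \<in> N" "v = h x"
    then show ?thesis using N0(2) d(1) by (auto simp: N_def)
  qed
  \<comment> \<open>The budget: \<open>h\<close> contracts by the factor \<open>L\<close>, so the
    deviations at both points may use up \<open>(1 - L) * dist x y\<close>.\<close>
  have approx2: "dist v w \<le> dist x y"
    if "(x, v) \<in> G" "(y, w) \<in> G" "dist v (h x) + dist w (h y) \<le> (1 - L) * dist x y" for x v y w
  proof -
    have "dist v w \<le> dist v (h x) + dist (h x) (h y) + dist w (h y)"
      using dist_triangle[of v w "h x"] dist_triangle[of "h x" w "h y"] by (simp add: dist_commute)
    also have "dist (h x) (h y) \<le> L * dist x y"
      using lipschitz_onD[OF lip(1)] approx that by blast
    finally show ?thesis using that(3) by (simp add: algebra_simps)
  qed
  have shortNE: "dist v w \<le> dist x y" if xv: "(x, v) \<in> G" "(y, w) \<in> G" "x \<in> N" "v = h x" and "e \<in> I" "y = \<gamma> e s" "(s, w) \<in> T e" for x v y w e s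
  proof -
    have "c1 \<le> dist x y" using c1(2)[of "(x, e)" s] that Ts(1) by auto
    then have "dist v (h x) + dist w (h y) \<le> (1 - L) * dist x y"
      using close[of "dist x y"] approx[OF that(2)] that(4) d(1) by simp
    then show ?thesis by (rule approx2[OF xv(1,2)])
  qed
  have short: "dist v w \<le> dist x y" if xv: "(x, v) \<in> G" and yw: "(y, w) \<in> G" for x v y w
    using Gcases[OF xv] Gcases[OF yw]
  proof (elim disjE exE conjE)
    fix e s e' t assume e: "e \<in> I" "x = \<gamma> e s" "(s, v) \<in> T e" and e': "e' \<in> I" "y = \<gamma> e' t" "(t, w) \<in> T e'"
    note m = Ts(1)[OF e(1,3)] Ts(1)[OF e'(1,3)]
    show ?thesis
    proof (cases "e = e'")
      case True
      then show ?thesis using trackD(7)[OF T(1)[OF e(1)] e(3), of t w] e' iso[OF e(1) m(1)] m(2) e(2) by simp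
    next
      case False
      show ?thesis
      proof (cases "(s, t) \<in> bad (e, e')")
        case True
        then have "c0 \<le> dist x y" using c0(2)[of "(e, e')" "(s, t)"] e e' False by auto
        then have "dist v (h x) + dist w (h y) \<le> (1 - L) * dist x y"
          using close[of "dist x y"] approx[OF xv] approx[OF yw] by linarith
        then show ?thesis by (rule approx2[OF xv yw])
      next
        case nb: False
        then obtain b b' where b: "en e b = en e' b'" "pos e b s < R" "pos e' b' t < R"
          using m unfolding bad_def by auto
        have "(pos e b s, v) \<in> wave d (h (en e b)) u" "(pos e' b' t, w) \<in> wave d (h (en e b)) u"
          using T(2)[OF e(1,3) b(2)] T(2)[OF e'(1,3) b(3)] b(1) by simp_all
        \<comment> \<open>Near a common end the values depend only on the distances to it, and these
          differ by at most \<open>dist x y\<close>.\<close>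
        then have "dist v w \<le> \<bar>pos e b s - pos e' b' t\<bar>" by (rule wave_short[OF _ _ u d(1)])
        also have "\<dots> = \<bar>dist x (en e b) - dist y (en e b)\<bar>"
          using en_dist[OF e(1) m(1), of b] en_dist[OF e'(1) m(2), of b'] b(1) e(2) e'(2) by simp
        also have "\<dots> \<le> dist x y" by (metis abs_dist_diff_le dist_commute)
        finally show ?thesis .
      qed
    qed
  next
    fix e s assume *: "e \<in> I" "x = \<gamma> e s" "(s, v) \<in> T e" "y \<in> N" "w = h y"
    show ?thesis using shortNE[OF yw xv *(4,5,1-3)] by (simp add: dist_commute)
  next
    fix e t assume *: "x \<in> N" "v = h x" "e \<in> I" "y = \<gamma> e t" "(t, w) \<in> T e"
    show ?thesis by (rule shortNE[OF xv yw *])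
  next
    assume "x \<in> N" "v = h x" "y \<in> N" "w = h y"
    then show ?thesis using approx2[OF xv yw] lip(2) by simp
  qed
  show ?thesis
  proof (rule that[of G])
    show "finite G" unfolding G_def using finI N0(1) trackD(1)[OF T(1)] by (auto simp: N_def)
    show "x \<in> P \<and> dist v (h x) < \<epsilon>" if "(x, v) \<in> G" for x v using approx[OF that] dc(2) by auto
    show "dist v w \<le> dist x y" if "(x, v) \<in> G" "(y, w) \<in> G" for x v y w by (rule short[OF that])
    show "(n, h n) \<in> G" if "n \<in> N0" "\<And>e. e \<in> I \<Longrightarrow> n \<notin> \<gamma> e ` {0..l e}" for n
      unfolding G_def N_def using that by blast
    fix e assume e: "e \<in> I"
    show "(\<gamma> e 0, h (\<gamma> e 0)) \<in> G \<and> (\<gamma> e (l e), h (\<gamma> e (l e))) \<in> G"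
      using GE[OF e] trackD(2,3)[OF T(1)[OF e]] by blast
    fix s assume "s \<in> {0..l e}"
    then obtain t v t' w where t: "(t, v) \<in> T e" "(t', w) \<in> T e" "t \<le> s" "s \<le> t'" "t' - t \<le> d" "dist v w = t' - t"
      using trackD(8)[OF T(1)[OF e], of s] by auto
    have "(\<gamma> e t, v) \<in> G \<and> (\<gamma> e t', w) \<in> G \<and>
      0 \<le> t \<and> t \<le> s \<and> s \<le> t' \<and> t' \<le> l e \<and> t' - t < \<epsilon> \<and> dist v w = t' - t"
      using t GE[OF e] Ts(1)[OF e t(1)] Ts(1)[OF e t(2)] dc(2) by auto
    then show "\<exists>t v t' w. (\<gamma> e t, v) \<in> G \<and> (\<gamma> e t', w) \<in> G \<and>
      0 \<le> t \<and> t \<le> s \<and> s \<le> t' \<and> t' \<le> l e \<and> t' - t < \<epsilon> \<and> dist v w = t' - t" by blast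
  qed
qed


section \<open>Straightening a triangulation\<close>

text \<open>Several vertices may have the same image under \<open>f\<close>; their weights are added
  over each fibre.\<close>

lemma affine_on_simplex_compose:
  assumes f: "affine_on_simplex V f" and fin: "finite V" and H: "affine_on_simplex (f ` V) H"
  shows "affine_on_simplex V (H \<circ> f)"
  unfolding affine_on_simplex_def
proof (intro allI impI)
  fix c assume c: "bary V c"
  define d where "d w = sum c {v \<in> V. f v = w}" for w
  have img: "(\<Sum>v\<in>V. c v *\<^sub>R g (f v)) = (\<Sum>w\<in>f ` V. d w *\<^sub>R g w)" for g :: "'b \<Rightarrow> 'z::real_vector"
  proof -
    have "(\<Sum>v\<in>V. c v *\<^sub>R g (f v)) = (\<Sum>w\<in>f ` V. \<Sum>v\<in>{v \<in> V. f v = w}. c v *\<^sub>R g (f v))"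
      using fin by (rule sum.image_gen)
    also have "\<dots> = (\<Sum>w\<in>f ` V. d w *\<^sub>R g w)"
      by (rule sum.cong) (auto simp: d_def scaleR_sum_left)
    finally show ?thesis .
  qed
  have "sum d (f ` V) = sum c V"
    unfolding d_def using sum.image_gen[OF fin, of c f] by simp
  then have d: "bary (f ` V) d"
    using c by (auto simp: bary_def d_def intro: sum_nonneg sum.neutral)
  have "(H \<circ> f) (\<Sum>v\<in>V. c v *\<^sub>R v) = H (\<Sum>v\<in>V. c v *\<^sub>R f v)"
    using affine_on_simplexD[OF f c] by simp
  also have "(\<Sum>v\<in>V. c v *\<^sub>R f v) = (\<Sum>w\<in>f ` V. d w *\<^sub>R w)"
    using img[of "\<lambda>x. x"] by simp
  also have "H \<dots> = (\<Sum>w\<in>f ` V. d w *\<^sub>R H w)" by (rule affine_on_simplexD[OF H d])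
  also have "\<dots> = (\<Sum>v\<in>V. c v *\<^sub>R H (f v))" by (rule img[symmetric])
  finally show "(H \<circ> f) (\<Sum>v\<in>V. c v *\<^sub>R v) = (\<Sum>v\<in>V. c v *\<^sub>R (H \<circ> f) v)" by simp
qed

lemma affine_on_simplex_inj:
  assumes f: "affine_on_simplex V f" and fin: "finite V" and inj: "inj_on f V" and ind: "\<not> affine_dependent (f ` V)"
  shows "inj_on f (convex hull V)"
proof (rule inj_onI)
  fix x y assume "x \<in> convex hull V" "y \<in> convex hull V" and e: "f x = f y"
  then obtain c d where c: "bary V c" "x = (\<Sum>v\<in>V. c v *\<^sub>R v)" and d: "bary V d" "y = (\<Sum>v\<in>V. d v *\<^sub>R v)"
    using convex_hull_bary[OF fin] by metis
  define push where "push c w = (if w \<in> f ` V then c (the_inv_into V f w) else 0)" for c :: "'a \<Rightarrow> real" and w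
  have pf: "push c (f v) = c v" if "v \<in> V" for c v
    using that by (simp add: push_def the_inv_into_f_f[OF inj])
  have P: "bary (f ` V) (push c)" "(\<Sum>w\<in>f ` V. push c w *\<^sub>R w) = f (\<Sum>v\<in>V. c v *\<^sub>R v)" if c: "bary V c" for c
  proof -
    have "sum (push c) (f ` V) = sum c V"
      unfolding sum.reindex[OF inj] by (rule sum.cong) (auto simp: pf)
    moreover have "0 \<le> push c w" for w using baryD(1)[OF c] by (simp add: push_def)
    ultimately show "bary (f ` V) (push c)" using c by (simp add: bary_def push_def)
    have "(\<Sum>w\<in>f ` V. push c w *\<^sub>R w) = (\<Sum>v\<in>V. c v *\<^sub>R f v)"
      unfolding sum.reindex[OF inj] by (rule sum.cong) (auto simp: pf)
    then show "(\<Sum>w\<in>f ` V. push c w *\<^sub>R w) = f (\<Sum>v\<in>V. c v *\<^sub>R v)" using affine_on_simplexD[OF f c] by simp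
  qed
  have "(\<Sum>w\<in>f ` V. push c w *\<^sub>R w) = (\<Sum>w\<in>f ` V. push d w *\<^sub>R w)"
    using P(2)[OF c(1)] P(2)[OF d(1)] e c(2) d(2) by simp
  then have "push c = push d"
    by (rule affine_independent_bary_unique[OF finite_imageI[OF fin] ind P(1)[OF c(1)] P(1)[OF d(1)]])
  then have "c v = d v" if "v \<in> V" for v using pf[OF that] by metis
  then show "x = y" unfolding c(2) d(2) by (auto intro: sum.cong)
qed

lemma affine_on_simplex_inverse:
  assumes f: "affine_on_simplex V f" and fin: "finite V" and inj: "inj_on f (convex hull V)"
    and g: "\<And>x. x \<in> convex hull V \<Longrightarrow> g (f x) = x"
  shows "affine_on_simplex (f ` V) g"
  unfolding affine_on_simplex_def
proof (intro allI impI)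
  fix c assume c: "bary (f ` V) c"
  have injV: "inj_on f V" using inj hull_subset inj_on_subset by metis
  define d where "d v = (if v \<in> V then c (f v) else 0)" for v
  have "sum d V = sum c (f ` V)"
    unfolding sum.reindex[OF injV] by (rule sum.cong) (auto simp: d_def)
  then have d: "bary V d" using c by (auto simp: bary_def d_def)
  have "(\<Sum>w\<in>f ` V. c w *\<^sub>R w) = (\<Sum>v\<in>V. d v *\<^sub>R f v)"
    unfolding sum.reindex[OF injV] by (rule sum.cong) (auto simp: d_def)
  then have "(\<Sum>w\<in>f ` V. c w *\<^sub>R w) = f (\<Sum>v\<in>V. d v *\<^sub>R v)" using affine_on_simplexD[OF f d] by simp
  moreover have "(\<Sum>v\<in>V. d v *\<^sub>R v) \<in> convex hull V" using convex_hull_bary[OF fin] d by blast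
  ultimately have "g (\<Sum>w\<in>f ` V. c w *\<^sub>R w) = (\<Sum>v\<in>V. d v *\<^sub>R v)" using g by simp
  also have "\<dots> = (\<Sum>w\<in>f ` V. c w *\<^sub>R g w)"
    unfolding sum.reindex[OF injV] by (rule sum.cong) (auto simp: d_def g hull_inc)
  finally show "g (\<Sum>w\<in>f ` V. c w *\<^sub>R w) = (\<Sum>w\<in>f ` V. c w *\<^sub>R g w)" .
qed

lemma affine_on_simplex_continuous_euclidean:
  fixes f :: "'e::euclidean_space \<Rightarrow> 'b::real_normed_vector"
  assumes f: "affine_on_simplex V f" and fin: "finite V" and ind: "\<not> affine_dependent V"
  shows "continuous_on (convex hull V) f"
proof (cases "V = {}")
  case False
  then obtain a where a: "a \<in> V" by blast
  have "independent ((\<lambda>x. - a + x) ` (V - {a}))" using ind affine_dependent_iff_dependent2[OF a] by blast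
  then obtain L where L: "linear L" "\<forall>x\<in>(\<lambda>x. - a + x) ` (V - {a}). L x = f (a + x) - f a"
    using linear_independent_extend[of _ "\<lambda>x. f (a + x) - f a"] by blast
  have Lv: "L (v - a) = f v - f a" if "v \<in> V" for v
    using L that by (cases "v = a") (auto simp: linear_0)
  have "f x = f a + L (x - a)" if x: "x \<in> convex hull V" for x
  proof -
    obtain c where c: "bary V c" "x = (\<Sum>v\<in>V. c v *\<^sub>R v)" using x convex_hull_bary[OF fin] by blast
    have "x - a = (\<Sum>v\<in>V. c v *\<^sub>R (v - a))"
      using baryD(3)[OF c(1)] by (simp add: c(2) scaleR_diff_right sum_subtractf flip: scaleR_sum_left)
    then have "L (x - a) = (\<Sum>v\<in>V. c v *\<^sub>R (f v - f a))"
      by (simp add: linear_sum[OF L(1)] linear_scale[OF L(1)] Lv)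
    also have "\<dots> = f x - f a"
      using baryD(3)[OF c(1)] affine_on_simplexD[OF f c(1)]
      by (simp add: c(2) scaleR_diff_right sum_subtractf flip: scaleR_sum_left)
    finally show ?thesis by simp
  qed
  moreover have "continuous_on (convex hull V) (\<lambda>x. f a + L (x - a))"
    using L(1) by (intro continuous_intros linear_continuous_on_compose)
  ultimately show ?thesis by (simp cong: continuous_on_cong)
qed simp

text \<open>The domain may be infinite-dimensional, as \<open>fseq\<close> is. Continuity is
  therefore obtained for the inverse first, whose domain is a compact Euclidean simplex, and then
  carried over to \<open>f\<close>.\<close>

lemma affine_on_simplex_continuous:
  fixes f :: "'v::real_normed_vector \<Rightarrow> 'e::euclidean_space"
  assumes f: "affine_on_simplex V f" and fin: "finite V" and inj: "inj_on f V" and ind: "\<not> affine_dependent (f ` V)"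
  shows "continuous_on (convex hull V) f"
proof -
  have injc: "inj_on f (convex hull V)" by (rule affine_on_simplex_inj[OF assms])
  define g where "g = the_inv_into (convex hull V) f"
  have gf: "g (f x) = x" if "x \<in> convex hull V" for x
    using the_inv_into_f_f[OF injc that] by (simp add: g_def)
  have img: "f ` (convex hull V) = convex hull (f ` V)" by (rule affine_on_simplex_image[OF f fin])
  have "continuous_on (convex hull (f ` V)) g"
    by (rule affine_on_simplex_continuous_euclidean[OF affine_on_simplex_inverse[OF f fin injc gf] finite_imageI[OF fin] ind])
  then have "continuous_on (g ` (convex hull (f ` V))) f"
    by (rule continuous_on_inv[OF _ finite_imp_compact_convex_hull[OF finite_imageI[OF fin]]])
      (use gf in \<open>auto simp flip: img\<close>)
  moreover have "g ` (convex hull (f ` V)) = convex hull V"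
    unfolding img[symmetric] using gf by force
  ultimately show ?thesis by simp
qed

text \<open>The parallel axis identity: half the double sum is the weighted variance of the points
  \<open>z v\<close>. The expansion \<open>A\<close> is used for \<open>y\<close> and again for each
  \<open>z v\<close>.\<close>

lemma norm_diff_sum_weighted:
  fixes z :: "'v \<Rightarrow> 'b::real_inner"
  assumes c: "bary \<sigma> c" and fin: "finite \<sigma>"
  shows "(norm (y - (\<Sum>v\<in>\<sigma>. c v *\<^sub>R z v)))\<^sup>2 =
    (\<Sum>v\<in>\<sigma>. c v * (norm (y - z v))\<^sup>2) - (1/2) * (\<Sum>v\<in>\<sigma>. \<Sum>w\<in>\<sigma>. c v * c w * (norm (z v - z w))\<^sup>2)"
proof -
  define m where "m = (\<Sum>v\<in>\<sigma>. c v *\<^sub>R z v)"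
  define q where "q = (\<Sum>v\<in>\<sigma>. c v * (z v \<bullet> z v))"
  note s1 = baryD(3)[OF c]
  have sqd: "(norm (a - b))\<^sup>2 = a \<bullet> a - 2 * (a \<bullet> b) + b \<bullet> b" for a b :: 'b
    by (simp add: power2_norm_eq_inner inner_diff inner_commute)
  have A: "(\<Sum>v\<in>\<sigma>. c v * (norm (a - z v))\<^sup>2) = a \<bullet> a - 2 * (a \<bullet> m) + q" for a
  proof -
    have "(\<Sum>v\<in>\<sigma>. c v * (norm (a - z v))\<^sup>2) = (\<Sum>v\<in>\<sigma>. c v * (a \<bullet> a) - 2 * (a \<bullet> (c v *\<^sub>R z v)) + c v * (z v \<bullet> z v))"
      by (rule sum.cong) (auto simp: sqd algebra_simps)
    also have "\<dots> = sum c \<sigma> * (a \<bullet> a) - 2 * (\<Sum>v\<in>\<sigma>. a \<bullet> (c v *\<^sub>R z v)) + q"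
      by (simp only: sum.distrib sum_subtractf sum_distrib_left sum_distrib_right q_def)
    finally show ?thesis using s1 by (simp add: m_def inner_sum_right)
  qed
  have "(\<Sum>v\<in>\<sigma>. \<Sum>w\<in>\<sigma>. c v * c w * (norm (z v - z w))\<^sup>2) = (\<Sum>v\<in>\<sigma>. c v * (\<Sum>w\<in>\<sigma>. c w * (norm (z v - z w))\<^sup>2))"
    by (simp add: sum_distrib_left mult.assoc)
  also have "\<dots> = (\<Sum>v\<in>\<sigma>. c v * (z v \<bullet> z v) - 2 * ((c v *\<^sub>R z v) \<bullet> m) + c v * q)"
    by (rule sum.cong) (auto simp: A algebra_simps)
  also have "\<dots> = q - 2 * (\<Sum>v\<in>\<sigma>. (c v *\<^sub>R z v) \<bullet> m) + sum c \<sigma> * q"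
    by (simp add: sum.distrib sum_subtractf sum_distrib_left[symmetric] sum_distrib_right[symmetric] flip: q_def)
  also have "\<dots> = 2 * q - 2 * (m \<bullet> m)"
    using s1 by (simp add: m_def inner_sum_left)
  finally show ?thesis unfolding m_def[symmetric] A[of y] sqd[of y m] by (simp add: field_simps)
qed

text \<open>By the preceding identity, the distances from a point to the vertices and between the
  vertices determine its distance to a convex combination of the vertices.\<close>

lemma distance_preserving_affine:
  fixes f :: "'a::real_inner \<Rightarrow> 'b::real_inner"
  assumes f: "distance_preserving_on C f" and fin: "finite \<sigma>" and sub: "convex hull \<sigma> \<subseteq> C"
  shows "affine_on_simplex \<sigma> f"
  unfolding affine_on_simplex_def
proof (intro allI impI)
  fix c assume c: "bary \<sigma> c"
  let ?x = "\<Sum>v\<in>\<sigma>. c v *\<^sub>R v"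
  have fd: "norm (f a - f b) = norm (a - b)" if "a \<in> C" "b \<in> C" for a b
    using f that by (simp add: distance_preserving_on_def dist_norm)
  have "?x \<in> convex hull \<sigma>" unfolding convex_hull_bary[OF fin] using c by (intro exI[of _ c] conjI refl)
  then have x: "?x \<in> C" by (rule subsetD[OF sub])
  have s: "v \<in> C" if "v \<in> \<sigma>" for v by (rule subsetD[OF sub hull_inc[OF that]])
  have 1: "(\<Sum>v\<in>\<sigma>. c v * (norm (f ?x - f v))\<^sup>2) = (\<Sum>v\<in>\<sigma>. c v * (norm (?x - v))\<^sup>2)"
    by (rule sum.cong) (auto simp: fd[OF x s])
  have 2: "(\<Sum>v\<in>\<sigma>. \<Sum>w\<in>\<sigma>. c v * c w * (norm (f v - f w))\<^sup>2) = (\<Sum>v\<in>\<sigma>. \<Sum>w\<in>\<sigma>. c v * c w * (norm (v - w))\<^sup>2)"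
    by (intro sum.cong refl) (auto simp: fd[OF s s])
  have "(norm (f ?x - (\<Sum>v\<in>\<sigma>. c v *\<^sub>R f v)))\<^sup>2 = (norm (?x - (\<Sum>v\<in>\<sigma>. c v *\<^sub>R v)))\<^sup>2"
    unfolding norm_diff_sum_weighted[OF c fin, of "f ?x" f] norm_diff_sum_weighted[OF c fin, of ?x "\<lambda>v. v"] 1 2 ..
  then show "f ?x = (\<Sum>v\<in>\<sigma>. c v *\<^sub>R f v)" by simp
qed

lemma distance_preserving_continuous: "distance_preserving_on X f \<Longrightarrow> continuous_on X f"
  by (rule lipschitz_on_continuous_on[of 1]) (auto intro!: lipschitz_onI simp: distance_preserving_on_def)

lemma distance_preserving_inj: "distance_preserving_on X f \<Longrightarrow> inj_on f X"
  unfolding distance_preserving_on_def inj_on_def by (metis dist_eq_0_iff)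

text \<open>Gram-Schmidt starting from one of at most three points. As \<open>sgn 0 = 0\<close>, the
  inner squares of \<open>e1\<close> and \<open>e2\<close> are 0 or 1, and collinear or coinciding
  points are covered by the same computation.\<close>

lemma isometric_projection_exists:
  fixes V :: "'a::real_inner set"
  assumes "finite V" "card V \<le> 3"
  obtains T :: "'a \<Rightarrow> real^2" where "bounded_linear T" "distance_preserving_on (convex hull V) T"
proof -
  obtain u v w where V: "V \<subseteq> {u, v, w}"
  proof -
    obtain xs where xs: "set xs = V" "length xs = card V"
      using assms(1) finite_distinct_list distinct_card by metis
    \<comment> \<open>Entries beyond the end of the list are arbitrary vectors, which is harmless
      for an inclusion.\<close>
    have "V \<subseteq> {xs ! 0, xs ! 1, xs ! 2}"
    proof
      fix x assume "x \<in> V"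
      then obtain i where "i < length xs" "x = xs ! i" using xs by (metis in_set_conv_nth)
      moreover from this have "i = 0 \<or> i = 1 \<or> i = 2" using xs assms(2) by linarith
      ultimately show "x \<in> {xs ! 0, xs ! 1, xs ! 2}" by auto
    qed
    then show ?thesis by (rule that)
  qed
  define e1 where "e1 = sgn (v - u)"
  define w' where "w' = (w - u) - ((w - u) \<bullet> e1) *\<^sub>R e1"
  define e2 where "e2 = sgn w'"
  have n01: "sgn x \<bullet> sgn x = 0 \<or> sgn x \<bullet> sgn x = 1" for x :: 'a
    by (cases "x = 0") (simp_all add: dot_square_norm norm_sgn)
  have n1: "e1 \<bullet> e1 = 0 \<or> e1 \<bullet> e1 = 1" and n2: "e2 \<bullet> e2 = 0 \<or> e2 \<bullet> e2 = 1"
    unfolding e1_def e2_def by (rule n01)+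
  have "w' \<bullet> e1 = 0" using n1 by (auto simp: w'_def inner_diff_left)
  then have o: "e1 \<bullet> e2 = 0" by (simp add: e2_def sgn_div_norm inner_commute)
  have sg: "norm x *\<^sub>R sgn x = x" for x :: 'a by (cases "x = 0") (simp_all add: sgn_div_norm)
  have vu: "v - u = norm (v - u) *\<^sub>R e1" by (simp add: e1_def sg)
  have wu: "w - u = ((w - u) \<bullet> e1) *\<^sub>R e1 + norm w' *\<^sub>R e2" by (simp add: e2_def sg w'_def)
  define T :: "'a \<Rightarrow> real^2" where "T z = (z \<bullet> e1) *\<^sub>R axis 1 1 + (z \<bullet> e2) *\<^sub>R axis 2 1" for z
  have T: "bounded_linear T"
    unfolding T_def by (intro bounded_linear_add bounded_linear_compose[OF bounded_linear_scaleR_left bounded_linear_inner_left])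
  have nT: "norm (T z) = norm z" if z: "z = a *\<^sub>R e1 + b *\<^sub>R e2" for z a b
  proof -
    have "(norm (T z))\<^sup>2 = (z \<bullet> e1)\<^sup>2 + (z \<bullet> e2)\<^sup>2"
      unfolding power2_norm_eq_inner T_def
      by (simp add: inner_add_left inner_add_right inner_axis_axis power2_eq_square)
    also have "z \<bullet> e1 = a * (e1 \<bullet> e1)" using o by (simp add: z inner_add_left inner_commute[of e2 e1])
    also have "z \<bullet> e2 = b * (e2 \<bullet> e2)" using o by (simp add: z inner_add_left)
    also have "(a * (e1 \<bullet> e1))\<^sup>2 + (b * (e2 \<bullet> e2))\<^sup>2 = a\<^sup>2 * (e1 \<bullet> e1) + b\<^sup>2 * (e2 \<bullet> e2)"
      using n1 n2 by (auto simp: power_mult_distrib)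
    also have "\<dots> = (norm z)\<^sup>2"
      unfolding power2_norm_eq_inner using o
      by (simp add: z inner_add_left inner_add_right inner_commute[of e2 e1] power2_eq_square)
    finally show ?thesis by (simp add: power2_eq_iff_nonneg)
  qed
  have hull: "\<exists>\<beta> \<gamma>. x = u + \<beta> *\<^sub>R (v - u) + \<gamma> *\<^sub>R (w - u)" if x: "x \<in> convex hull V" for x
  proof -
    have "x \<in> convex hull {u, v, w}" using x V hull_mono by blast
    then obtain a b c where "a + b + c = 1" "x = a *\<^sub>R u + b *\<^sub>R v + c *\<^sub>R w"
      unfolding convex_hull_3 by blast
    then have "x = (1 - b - c) *\<^sub>R u + b *\<^sub>R v + c *\<^sub>R w" by (metis add_diff_cancel_right' diff_diff_eq2 diff_diff_eq add.commute)
    then have "x = u + b *\<^sub>R (v - u) + c *\<^sub>R (w - u)" by (simp add: algebra_simps)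
    then show ?thesis by blast
  qed
  have "distance_preserving_on (convex hull V) T"
    unfolding distance_preserving_on_def
  proof (intro ballI)
    fix x y assume "x \<in> convex hull V" "y \<in> convex hull V"
    then obtain \<beta> \<gamma> \<beta>' \<gamma>' where xy: "x = u + \<beta> *\<^sub>R (v - u) + \<gamma> *\<^sub>R (w - u)" "y = u + \<beta>' *\<^sub>R (v - u) + \<gamma>' *\<^sub>R (w - u)"
      using hull by metis
    have "x - y = (\<beta> - \<beta>') *\<^sub>R (v - u) + (\<gamma> - \<gamma>') *\<^sub>R (w - u)" by (simp add: xy algebra_simps)
    also have "\<dots> = (\<beta> - \<beta>') *\<^sub>R (norm (v - u) *\<^sub>R e1) + (\<gamma> - \<gamma>') *\<^sub>R (((w - u) \<bullet> e1) *\<^sub>R e1 + norm w' *\<^sub>R e2)"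
      using vu wu by metis
    also have "\<dots> = ((\<beta> - \<beta>') * norm (v - u) + (\<gamma> - \<gamma>') * ((w - u) \<bullet> e1)) *\<^sub>R e1 + ((\<gamma> - \<gamma>') * norm w') *\<^sub>R e2"
      by (simp add: scaleR_add_left scaleR_add_right)
    finally have "norm (T (x - y)) = norm (x - y)" by (rule nT)
    then show "dist (T x) (T y) = dist x y"
      unfolding dist_norm linear_diff[OF bounded_linear.linear[OF T]] .
  qed
  with T show ?thesis by (rule that)
qed


section \<open>Invariance of dimension and charts of simplices\<close>

lemma finite_closed_cover_interior:
  assumes "finite \<A>" "\<And>A. A \<in> \<A> \<Longrightarrow> closed A" "interior (\<Union>\<A>) \<noteq> {}"
  shows "\<exists>A\<in>\<A>. interior A \<noteq> {}"
  using assms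
proof (induction \<A> rule: finite_induct)
  case (insert A \<A>)
  show ?case
  proof (cases "interior (\<Union>\<A>) = {}")
    case True
    then have "interior (A \<union> \<Union>\<A>) = interior A"
      using insert.prems by (intro interior_closed_Un_empty_interior) auto
    then show ?thesis using insert.prems by auto
  next
    case False
    then show ?thesis using insert by blast
  qed
qed simp

text \<open>Four affinely independent points span a tetrahedron, which contains an open ball in
  three parameters. One of the finitely many closed sets pulled back by the embedding has interior
  in this ball; on it the composition with the injection of \<open>Y\<close> into the plane
  contradicts invariance of dimension.\<close>

lemma no_solid_embedding:
  fixes f :: "'v::real_normed_vector \<Rightarrow> 'c::metric_space"
  assumes U: "finite U" "\<not> affine_dependent U" "4 \<le> card U"
    and cont: "continuous_on (convex hull U) f" and inj: "inj_on f (convex hull U)"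
    and fin: "finite \<Y>" and cover: "f ` (convex hull U) \<subseteq> \<Union>\<Y>"
    and Y: "\<And>Y. Y \<in> \<Y> \<Longrightarrow> closed Y" "\<And>Y. Y \<in> \<Y> \<Longrightarrow> \<exists>g::'c \<Rightarrow> real^2. continuous_on Y g \<and> inj_on g Y"
  shows False
proof -
  obtain X where X: "X \<subseteq> U" "card X = 4" "finite X" using obtain_subset_with_card_n[OF U(3)] by metis
  obtain xs where xs: "set xs = X" "distinct xs" using finite_distinct_list[OF X(3)] by blast
  then have len: "length xs = 4" using X(2) distinct_card by metis
  define u0 u1 u2 u3 where u: "u0 = xs ! 0" "u1 = xs ! 1" "u2 = xs ! 2" "u3 = xs ! 3"
  have ne: "u0 \<noteq> u1" "u0 \<noteq> u2" "u0 \<noteq> u3" "u1 \<noteq> u2" "u1 \<noteq> u3" "u2 \<noteq> u3"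
    using xs(2) len by (auto simp: u nth_eq_iff_index_eq)
  have X4: "X = {u0, u1, u2, u3}"
  proof -
    have "{u0, u1, u2, u3} \<subseteq> X" using xs len by (auto simp: u)
    moreover have "card {u0, u1, u2, u3} = 4" using ne by simp
    ultimately show ?thesis using X card_subset_eq by metis
  qed
  have indX: "\<not> affine_dependent X" using affine_independent_subset[OF U(2) X(1)] .
  define m where "m p = u0 + fst p *\<^sub>R (u1 - u0) + fst (snd p) *\<^sub>R (u2 - u0) + snd (snd p) *\<^sub>R (u3 - u0)"
    for p :: "real \<times> real \<times> real"
  define O' where "O' = {p :: real \<times> real \<times> real. 0 < fst p \<and> 0 < fst (snd p) \<and> 0 < snd (snd p) \<and> fst p + fst (snd p) + snd (snd p) < 1}"
  define cc where "cc p v = (if v = u1 then fst p else if v = u2 then fst (snd p) else if v = u3 then snd (snd p)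
      else if v = u0 then 1 - fst p - fst (snd p) - snd (snd p) else 0)" for p :: "real \<times> real \<times> real" and v
  have cc: "bary X (cc p)" if "p \<in> O'" for p
    using that ne by (auto simp: bary_def cc_def X4 O'_def)
  have ccm: "(\<Sum>v\<in>X. cc p v *\<^sub>R v) = m p" for p
    using ne by (simp add: cc_def X4 m_def algebra_simps)
  have mU: "m p \<in> convex hull U" if "p \<in> O'" for p
  proof -
    have "m p \<in> convex hull X" unfolding convex_hull_bary[OF X(3)] using cc[OF that] ccm by metis
    then show ?thesis using hull_mono[OF X(1)] by blast
  qed
  have injm: "inj_on m O'"
  proof (rule inj_onI)
    fix p q assume pq: "p \<in> O'" "q \<in> O'" "m p = m q"
    have "cc p = cc q"
      by (rule affine_independent_bary_unique[OF X(3) indX cc[OF pq(1)] cc[OF pq(2)]]) (simp add: ccm pq(3))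
    then have "cc p u1 = cc q u1" "cc p u2 = cc q u2" "cc p u3 = cc q u3" by simp_all
    then show "p = q" using ne by (simp add: cc_def prod_eq_iff)
  qed
  have contm: "continuous_on S m" for S unfolding m_def by (intro continuous_intros)
  have "open O'"
    unfolding O'_def by (intro open_Collect_conj open_Collect_less continuous_intros)
  moreover have "(1/4, 1/4, 1/4) \<in> O'" by (simp add: O'_def)
  ultimately obtain e where e: "0 < e" "cball (1/4, 1/4, 1/4) e \<subseteq> O'" using open_contains_cball by blast
  define B :: "(real \<times> real \<times> real) set" where "B = cball (1/4, 1/4, 1/4) e"
  have BO: "B \<subseteq> O'" using e by (simp add: B_def)
  define F where "F = f \<circ> m"
  have contF: "continuous_on B F"
    unfolding F_def using mU BO by (intro continuous_on_compose contm continuous_on_subset[OF cont]) auto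
  have injF: "inj_on F B"
    unfolding F_def using mU BO
    by (intro comp_inj_on inj_on_subset[OF injm BO] inj_on_subset[OF inj]) auto
  have "\<exists>A\<in>(\<lambda>Y. B \<inter> F -` Y) ` \<Y>. interior A \<noteq> {}"
  proof (rule finite_closed_cover_interior)
    show "finite ((\<lambda>Y. B \<inter> F -` Y) ` \<Y>)" using fin by simp
    have "closed B" by (simp add: B_def)
    then show "closed A" if "A \<in> (\<lambda>Y. B \<inter> F -` Y) ` \<Y>" for A
      using that Y(1) continuous_closed_preimage[OF contF] by blast
    have "\<Union>((\<lambda>Y. B \<inter> F -` Y) ` \<Y>) = B" using cover mU BO by (fastforce simp: F_def)
    then show "interior (\<Union>((\<lambda>Y. B \<inter> F -` Y) ` \<Y>)) \<noteq> {}" using e(1) by (simp add: B_def interior_cball)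
  qed
  then obtain Y0 where Y0: "Y0 \<in> \<Y>" "interior (B \<inter> F -` Y0) \<noteq> {}" by blast
  define Z where "Z = interior (B \<inter> F -` Y0)"
  have Z: "open Z" "Z \<noteq> {}" "Z \<subseteq> B" "F ` Z \<subseteq> Y0"
    using Y0 interior_subset[of "B \<inter> F -` Y0"] by (auto simp: Z_def)
  obtain g :: "'c \<Rightarrow> real^2" where g: "continuous_on Y0 g" "inj_on g Y0" using Y(2)[OF Y0(1)] by blast
  have "continuous_on Z (g \<circ> F)"
    by (rule continuous_on_compose[OF continuous_on_subset[OF contF Z(3)] continuous_on_subset[OF g(1) Z(4)]])
  moreover have "inj_on (g \<circ> F) Z"
    by (rule comp_inj_on[OF inj_on_subset[OF injF Z(3)] inj_on_subset[OF g(2) Z(4)]])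
  ultimately have "DIM(real \<times> real \<times> real) \<le> DIM(real^2)"
    using invariance_of_dimension[of Z "g \<circ> F"] Z(1,2) by blast
  then show False by simp
qed

text \<open>The chart undoes \<open>\<iota>\<close> and lays the model simplex isometrically into
  the plane; \<open>H\<close> is \<open>h\<close> read in the chart.\<close>

lemma flat_chart_exists:
  fixes h :: "'a::metric_space \<Rightarrow> 'b::real_vector"
  assumes sv: "simplex_with_vertices V E" and iso: "isometry_between E \<Delta> \<iota>" and c3: "card V \<le> 3"
    and h: "\<forall>c. (\<forall>v\<in>V. 0 \<le> c v) \<and> sum c V = 1 \<longrightarrow> h (\<iota> (\<Sum>v\<in>V. c v *\<^sub>R v)) = (\<Sum>v\<in>V. c v *\<^sub>R h (\<iota> v))"
  obtains W and \<kappa> :: "'a \<Rightarrow> real^2" and H where "finite W" "\<not> affine_dependent W"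
    "distance_preserving_on \<Delta> \<kappa>" "\<kappa> ` \<Delta> = convex hull W" "affine_on_simplex W H" "\<And>y. y \<in> \<Delta> \<Longrightarrow> h y = H (\<kappa> y)"
proof -
  have V: "finite V" "V \<noteq> {}" "\<not> affine_dependent V" and E: "E = convex hull V"
    using sv unfolding simplex_with_vertices_def by metis+
  have bij: "bij_betw \<iota> E \<Delta>" and dp: "distance_preserving_on E \<iota>" using iso by (auto simp: isometry_between_def)
  obtain T :: "fseq \<Rightarrow> real^2" where T: "distance_preserving_on (convex hull V) T"
    using isometric_projection_exists[OF V(1) c3] by metis
  note injT = distance_preserving_inj[OF T]
  have affT: "affine_on_simplex V T" by (rule distance_preserving_affine[OF T V(1) order_refl])
  define \<iota>' where "\<iota>' = the_inv_into E \<iota>"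
  have \<iota>': "\<iota>' (\<iota> x) = x" if "x \<in> E" for x
    using the_inv_into_f_f[OF bij_betw_imp_inj_on[OF bij] that] by (simp add: \<iota>'_def)
  have \<Delta>: "\<Delta> = \<iota> ` E" using bij by (simp add: bij_betw_def)
  define T' where "T' = the_inv_into (convex hull V) T"
  have T': "T' (T x) = x" if "x \<in> E" for x
    using the_inv_into_f_f[OF injT] that by (simp add: T'_def E)
  define \<kappa> where "\<kappa> = T \<circ> \<iota>'"
  define H where "H = (h \<circ> \<iota>) \<circ> T'"
  have "finite (T ` V)" using V by simp
  moreover have "\<not> affine_dependent (T ` V)" by (rule affine_independent_image[OF affT V(1,3) injT])
  moreover have "distance_preserving_on \<Delta> \<kappa>"
    using dp T \<iota>' unfolding \<Delta> E[symmetric] by (simp add: distance_preserving_on_def \<kappa>_def)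
  moreover have "\<kappa> ` \<Delta> = convex hull (T ` V)"
  proof -
    have "\<kappa> ` \<Delta> = T ` E" unfolding \<Delta> using \<iota>' by (force simp: \<kappa>_def)
    then show ?thesis unfolding E affine_on_simplex_image[OF affT V(1)] .
  qed
  moreover have "affine_on_simplex (T ` V) H"
    unfolding H_def
  proof (rule affine_on_simplex_compose)
    show "affine_on_simplex (T ` V) T'"
      by (rule affine_on_simplex_inverse[OF affT V(1) injT]) (use T' E in auto)
    have VE: "v \<in> E" if "v \<in> V" for v unfolding E by (rule hull_inc[OF that])
    have "T' ` T ` V = V" using T'[OF VE] by force
    then show "affine_on_simplex (T' ` T ` V) (h \<circ> \<iota>)"
      using h by (simp add: affine_on_simplex_def bary_def)
  qed (use V in simp)
  moreover have "h y = H (\<kappa> y)" if "y \<in> \<Delta>" for y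
    using that \<iota>' T' unfolding \<Delta> by (auto simp: H_def \<kappa>_def)
  ultimately show ?thesis by (rule that[of "T ` V" \<kappa> H])
qed

text \<open>
  A triangulation is only a homeomorphism, and nothing in the definition relates the faces of a
  simplex to those of the Euclidean simplex to which its image is isometric.  That vertices
  correspond to vertices is a consequence of invariance of domain.
\<close>

locale chart_system =
  fixes \<V> :: "fseq set set" and \<phi> :: "fseq \<Rightarrow> 'a::metric_space"
    and W :: "fseq set \<Rightarrow> (real^2) set" and \<kappa> :: "fseq set \<Rightarrow> 'a \<Rightarrow> real^2"
  assumes V: "vcomplex \<V>"
    and card3: "\<sigma> \<in> \<V> \<Longrightarrow> card \<sigma> \<le> 3"
    and cont: "continuous_on (\<Union>\<sigma>\<in>\<V>. convex hull \<sigma>) \<phi>"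
    and inj: "inj_on \<phi> (\<Union>\<sigma>\<in>\<V>. convex hull \<sigma>)"
    and finW: "\<sigma> \<in> \<V> \<Longrightarrow> finite (W \<sigma>)"
    and indW: "\<sigma> \<in> \<V> \<Longrightarrow> \<not> affine_dependent (W \<sigma>)"
    and dp: "\<sigma> \<in> \<V> \<Longrightarrow> distance_preserving_on (\<phi> ` (convex hull \<sigma>)) (\<kappa> \<sigma>)"
    and img: "\<sigma> \<in> \<V> \<Longrightarrow> \<kappa> \<sigma> ` \<phi> ` (convex hull \<sigma>) = convex hull (W \<sigma>)"
begin

lemma fin: "\<sigma> \<in> \<V> \<Longrightarrow> finite \<sigma>"
  using vcomplexD(2)[OF V] .

definition inv_chart :: "fseq set \<Rightarrow> real^2 \<Rightarrow> 'a"
  where "inv_chart \<sigma> = the_inv_into (\<phi> ` (convex hull \<sigma>)) (\<kappa> \<sigma>)"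

lemma inv_chart:
  assumes "\<sigma> \<in> \<V>"
  shows "y \<in> \<phi> ` (convex hull \<sigma>) \<Longrightarrow> inv_chart \<sigma> (\<kappa> \<sigma> y) = y"
    "z \<in> convex hull (W \<sigma>) \<Longrightarrow> \<kappa> \<sigma> (inv_chart \<sigma> z) = z"
    "z \<in> convex hull (W \<sigma>) \<Longrightarrow> inv_chart \<sigma> z \<in> \<phi> ` (convex hull \<sigma>)"
  unfolding inv_chart_def img[OF assms, symmetric]
  using distance_preserving_inj[OF dp[OF assms]]
  by (simp_all add: the_inv_into_f_f f_the_inv_into_f the_inv_into_into)

text \<open>Both charts preserve the metric of the space, so the change of charts is
  distance-preserving between plane sets, hence affine.\<close>

lemma transition_affine:
  assumes "\<sigma> \<in> \<V>" "\<tau> \<subseteq> \<sigma>" "\<tau> \<in> \<V>"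
  shows "affine_on_simplex (W \<tau>) (\<kappa> \<sigma> \<circ> inv_chart \<tau>)"
proof (rule distance_preserving_affine)
  have "inv_chart \<tau> z \<in> \<phi> ` (convex hull \<sigma>)" if "z \<in> convex hull (W \<tau>)" for z
    using inv_chart(3)[OF assms(3) that] hull_mono[OF assms(2)] by blast
  then have "dist (\<kappa> \<sigma> (inv_chart \<tau> y)) (\<kappa> \<sigma> (inv_chart \<tau> z)) = dist (inv_chart \<tau> y) (inv_chart \<tau> z)"
    if "y \<in> convex hull (W \<tau>)" "z \<in> convex hull (W \<tau>)" for y z
    using dp[OF assms(1)] that unfolding distance_preserving_on_def by blast
  moreover have "dist (inv_chart \<tau> y) (inv_chart \<tau> z) = dist y z"
    if "y \<in> convex hull (W \<tau>)" "z \<in> convex hull (W \<tau>)" for y z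
    using dp[OF assms(3)] inv_chart(2,3)[OF assms(3)] that unfolding distance_preserving_on_def by metis
  ultimately show "distance_preserving_on (convex hull (W \<tau>)) (\<kappa> \<sigma> \<circ> inv_chart \<tau>)"
    by (simp add: distance_preserving_on_def)
qed (use finW assms in auto)

lemma chart_facet:
  assumes "\<sigma> \<in> \<V>" "\<tau> \<subseteq> \<sigma>" "\<tau> \<in> \<V>" "\<kappa> \<tau> ` \<phi> ` \<tau> = W \<tau>"
  shows "\<kappa> \<sigma> ` \<phi> ` (convex hull \<tau>) = convex hull (\<kappa> \<sigma> ` \<phi> ` \<tau>)"
proof -
  let ?j = "\<kappa> \<sigma> \<circ> inv_chart \<tau>"
  have j: "?j (\<kappa> \<tau> y) = \<kappa> \<sigma> y" if "y \<in> \<phi> ` (convex hull \<tau>)" for y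
    using inv_chart(1)[OF assms(3) that] by simp
  have "\<kappa> \<sigma> ` \<phi> ` (convex hull \<tau>) = ?j ` \<kappa> \<tau> ` \<phi> ` (convex hull \<tau>)"
    unfolding image_image[of ?j] by (rule image_cong[OF refl j[symmetric]])
  also have "\<dots> = convex hull (?j ` W \<tau>)"
    unfolding img[OF assms(3)]
    by (rule affine_on_simplex_image[OF transition_affine[OF assms(1-3)] finW[OF assms(3)]])
  also have "?j ` W \<tau> = \<kappa> \<sigma> ` \<phi> ` \<tau>"
    unfolding assms(4)[symmetric] image_image[of ?j]
    by (rule image_cong[OF refl j]) (use hull_subset[of \<tau> convex] in blast)
  finally show ?thesis .
qed

text \<open>Flattened in the plane, the simplex is mapped by a homeomorphism \<open>\<theta>\<close>
  onto the hull of \<open>W \<sigma>\<close>. Homeomorphic compact convex sets have the same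
  dimension, which gives the number of vertices. By invariance of domain \<open>\<theta>\<close>
  maps relative interior into relative interior, so a vertex of the image, lying on the relative
  frontier, must come from a facet.\<close>

lemma facet_charts_cover:
  assumes s: "\<sigma> \<in> \<V>" and card2: "2 \<le> card \<sigma>"
  shows "card (W \<sigma>) = card \<sigma> \<and> W \<sigma> \<subseteq> (\<Union>v\<in>\<sigma>. \<kappa> \<sigma> ` \<phi> ` (convex hull (\<sigma> - {v})))"
proof -
  note f = fin[OF s] and ind = vcomplex_affine_independent[OF V s]
  obtain T :: "fseq \<Rightarrow> real^2" where T: "distance_preserving_on (convex hull \<sigma>) T"
    using isometric_projection_exists[OF f card3[OF s]] by metis
  have affT: "affine_on_simplex \<sigma> T" by (rule distance_preserving_affine[OF T f order_refl])
  note injT = distance_preserving_inj[OF T]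
  have injT': "inj_on T \<sigma>" using injT hull_subset inj_on_subset by metis
  define \<sigma>' where "\<sigma>' = T ` \<sigma>"
  have ind': "\<not> affine_dependent \<sigma>'" unfolding \<sigma>'_def by (rule affine_independent_image[OF affT f ind injT])
  have imgT: "T ` (convex hull \<tau>) = convex hull (T ` \<tau>)" if "\<tau> \<subseteq> \<sigma>" for \<tau>
    by (rule affine_on_simplex_image[OF affine_on_subset[OF affT f that] finite_subset[OF that f]])
  define X Y where "X = convex hull \<sigma>'" and "Y = convex hull (W \<sigma>)"
  define T' where "T' = the_inv_into (convex hull \<sigma>) T"
  have T': "T' (T x) = x" if "x \<in> convex hull \<sigma>" for x
    using the_inv_into_f_f[OF injT that] by (simp add: T'_def)
  have XT: "X = T ` (convex hull \<sigma>)" by (simp add: X_def \<sigma>'_def imgT)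
  have "continuous_on X T'"
    unfolding XT by (rule continuous_on_inv[OF distance_preserving_continuous[OF T] finite_imp_compact_convex_hull[OF f]])
      (use T' in blast)
  define \<theta> where "\<theta> = \<kappa> \<sigma> \<circ> (\<phi> \<circ> T')"
  have TX: "T' ` X = convex hull \<sigma>" unfolding XT using T' by force
  have sub: "convex hull \<sigma> \<subseteq> (\<Union>\<sigma>\<in>\<V>. convex hull \<sigma>)" using s by blast
  have cont\<theta>: "continuous_on X \<theta>"
    unfolding \<theta>_def
  proof (intro continuous_on_compose)
    show "continuous_on X T'" by fact
    show "continuous_on (T' ` X) \<phi>" unfolding TX by (rule continuous_on_subset[OF cont sub])
    show "continuous_on ((\<phi> \<circ> T') ` X) (\<kappa> \<sigma>)"
      unfolding image_comp[symmetric] TX by (rule distance_preserving_continuous[OF dp[OF s]])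
  qed
  have inj\<theta>: "inj_on \<theta> X"
    unfolding \<theta>_def
  proof (intro comp_inj_on)
    show "inj_on T' X" unfolding XT by (rule inj_onI) (use T' in force)
    show "inj_on \<phi> (T' ` X)" unfolding TX by (rule inj_on_subset[OF inj sub])
    show "inj_on (\<kappa> \<sigma>) ((\<phi> \<circ> T') ` X)"
      unfolding image_comp[symmetric] TX by (rule distance_preserving_inj[OF dp[OF s]])
  qed
  have \<theta>T: "\<theta> ` T ` S = \<kappa> \<sigma> ` \<phi> ` S" if "S \<subseteq> convex hull \<sigma>" for S
    unfolding image_image using T' that by (intro image_cong) (auto simp: \<theta>_def)
  have XY: "\<theta> ` X = Y" unfolding XT Y_def by (simp add: \<theta>T img[OF s])
  have cX: "compact X" "convex X" "compact Y" "convex Y"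
    using f finW[OF s] by (auto simp: X_def Y_def \<sigma>'_def finite_imp_compact_convex_hull)
  have "X homeomorphic Y"
    using homeomorphism_compact[OF cX(1) cont\<theta> XY inj\<theta>] by (auto simp: homeomorphic_def)
  then have dim: "aff_dim X = aff_dim Y" using homeomorphic_convex_compact_sets_eq cX by blast
  have cardW: "card (W \<sigma>) = card \<sigma>"
  proof -
    have "int (card \<sigma>') = int (card (W \<sigma>))"
      using dim aff_dim_affine_independent[OF ind'] aff_dim_affine_independent[OF indW[OF s]]
      by (simp add: X_def Y_def aff_dim_convex_hull)
    then show ?thesis using card_image[OF injT'] by (simp add: \<sigma>'_def)
  qed
  have "openin (top_of_set (affine hull Y)) (\<theta> ` rel_interior X)"
  proof (rule invariance_of_domain_affine_sets)
    show "openin (top_of_set (affine hull X)) (rel_interior X)" by (rule openin_rel_interior)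
    show "continuous_on (rel_interior X) \<theta>" by (rule continuous_on_subset[OF cont\<theta> rel_interior_subset])
    show "inj_on \<theta> (rel_interior X)" by (rule inj_on_subset[OF inj\<theta> rel_interior_subset])
    show "\<theta> \<in> rel_interior X \<rightarrow> affine hull Y"
      using XY rel_interior_subset[of X] hull_subset[of Y affine] by blast
  qed (use dim in auto)
  then have ri: "\<theta> ` rel_interior X \<subseteq> rel_interior Y"
    using XY rel_interior_subset[of X] by (intro rel_interior_maximal) blast+
  have "w \<in> (\<Union>v\<in>\<sigma>. \<kappa> \<sigma> ` \<phi> ` (convex hull (\<sigma> - {v})))" if w: "w \<in> W \<sigma>" for w
  proof -
    have "\<exists>x\<in>W \<sigma>. x \<noteq> w"
    proof (rule ccontr)
      assume "\<not> ?thesis"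
      then have "W \<sigma> = {w}" using w by blast
      then show False using cardW card2 by simp
    qed
    then obtain x where x: "x \<in> W \<sigma>" "x \<noteq> w" by blast
    have "w \<in> convex hull (W \<sigma> - {x})" using w x by (intro hull_inc) auto
    then have "w \<in> rel_frontier Y"
      unfolding Y_def rel_frontier_convex_hull_cases[OF indW[OF s]] using x(1) by blast
    then have wY: "w \<in> Y" "w \<notin> rel_interior Y"
      using cX(3) by (auto simp: rel_frontier_def compact_imp_closed)
    then obtain z where z: "z \<in> X" "w = \<theta> z" using XY by blast
    then have "z \<notin> rel_interior X" using ri wY by blast
    then have "z \<in> rel_frontier X" using z closure_subset[of X] by (auto simp: rel_frontier_def)
    then obtain a where a: "a \<in> \<sigma>'" "z \<in> convex hull (\<sigma>' - {a})"
      unfolding X_def rel_frontier_convex_hull_cases[OF ind'] by blast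
    then obtain v where v: "v \<in> \<sigma>" "a = T v" by (auto simp: \<sigma>'_def)
    have "\<sigma>' - {a} = T ` (\<sigma> - {v})" using v injT' by (auto simp: \<sigma>'_def inj_on_def)
    then have "z \<in> T ` (convex hull (\<sigma> - {v}))" using a(2) imgT[of "\<sigma> - {v}"] by auto
    then have "w \<in> \<kappa> \<sigma> ` \<phi> ` (convex hull (\<sigma> - {v}))"
      using \<theta>T[OF hull_mono[of "\<sigma> - {v}" \<sigma>]] z(2) by blast
    then show ?thesis using v(1) by blast
  qed
  then show ?thesis using cardW by blast
qed

text \<open>Induction on the dimension. By induction and affine changes of charts, each facet
  appears in the chart of \<open>\<sigma>\<close> as the hull of the images of its vertices. These
  facets contain all of \<open>W \<sigma>\<close>, so \<open>W \<sigma>\<close> and the images of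
  the vertices of \<open>\<sigma>\<close> have the same hull; independence of
  \<open>W \<sigma>\<close> gives an inclusion and the cardinalities give equality.\<close>

lemma chart_vertices:
  "\<sigma> \<in> \<V> \<Longrightarrow> \<kappa> \<sigma> ` \<phi> ` \<sigma> = W \<sigma> \<and> card (W \<sigma>) = card \<sigma>"
proof (induction "card \<sigma>" arbitrary: \<sigma> rule: less_induct)
  case less
  note s = less.prems
  note f = fin[OF s]
  show ?case
  proof (cases "2 \<le> card \<sigma>")
    case False
    have "card \<sigma> \<noteq> 0" using f vcomplexD(3)[OF V s] by simp
    then have "card \<sigma> = 1" using False by simp
    then obtain v where v: "\<sigma> = {v}" using card_1_singletonE by blast
    then have h: "convex hull (W \<sigma>) = {\<kappa> \<sigma> (\<phi> v)}" using img[OF s] by simp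
    then have "W \<sigma> \<noteq> {}" by auto
    moreover have "W \<sigma> \<subseteq> {\<kappa> \<sigma> (\<phi> v)}" using h hull_subset[of "W \<sigma>" convex] by blast
    ultimately have "W \<sigma> = {\<kappa> \<sigma> (\<phi> v)}" by blast
    then show ?thesis by (simp add: v)
  next
    case True
    define Z where "Z = \<kappa> \<sigma> ` \<phi> ` \<sigma>"
    have finZ: "finite Z" using f by (simp add: Z_def)
    have cov: "card (W \<sigma>) = card \<sigma>" "W \<sigma> \<subseteq> (\<Union>v\<in>\<sigma>. \<kappa> \<sigma> ` \<phi> ` (convex hull (\<sigma> - {v})))"
      using facet_charts_cover[OF s True] by blast+
    have fac: "\<kappa> \<sigma> ` \<phi> ` (convex hull (\<sigma> - {v})) \<subseteq> convex hull Z" if v: "v \<in> \<sigma>" for v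
    proof -
      have "card (\<sigma> - {v}) < card \<sigma>" by (rule card_Diff1_less[OF f v])
      moreover have "\<sigma> - {v} \<noteq> {}"
      proof
        assume "\<sigma> - {v} = {}"
        then have "\<sigma> = {v}" using v by blast
        then show False using True by simp
      qed
      then have t: "\<sigma> - {v} \<in> \<V>" by (intro vcomplexD(4)[OF V s]) auto
      ultimately have "\<kappa> \<sigma> ` \<phi> ` (convex hull (\<sigma> - {v})) = convex hull (\<kappa> \<sigma> ` \<phi> ` (\<sigma> - {v}))"
        using less.hyps by (intro chart_facet[OF s]) auto
      also have "\<dots> \<subseteq> convex hull Z" unfolding Z_def by (intro hull_mono image_mono) auto
      finally show ?thesis .
    qed
    have "W \<sigma> \<subseteq> convex hull Z" using cov(2) fac by blast
    then have "convex hull (W \<sigma>) \<subseteq> convex hull Z" by (simp add: hull_minimal)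
    moreover have "Z \<subseteq> convex hull (W \<sigma>)"
      unfolding Z_def img[OF s, symmetric] by (intro image_mono hull_subset)
    then have "convex hull Z \<subseteq> convex hull (W \<sigma>)" by (simp add: hull_minimal)
    ultimately have "convex hull (W \<sigma>) = convex hull Z" by (rule equalityI)
    then have sub: "W \<sigma> \<subseteq> Z" by (rule convex_hull_subset_affine_independent[OF finW[OF s] finZ indW[OF s]])
    moreover have "card Z \<le> card (W \<sigma>)"
      unfolding cov(1) Z_def using f by (metis card_image_le finite_imageI le_trans)
    ultimately have "W \<sigma> = Z" using card_seteq[OF finZ sub] by blast
    then show ?thesis using cov(1) by (simp add: Z_def)
  qed
qed


text \<open>On the face \<open>\<tau>\<close>, reading off the position in the chart of
  \<open>\<sigma>\<close> or in that of \<open>\<tau>\<close> gives two affine maps with the same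
  vertex values.\<close>

lemma inv_chart_transition:
  assumes s: "\<sigma> \<in> \<V>" "\<tau> \<subseteq> \<sigma>" "\<tau> \<in> \<V>" and x: "x \<in> convex hull \<tau>"
    and A: "affine_on_simplex \<sigma> A" "\<And>v. v \<in> \<sigma> \<Longrightarrow> A v = \<kappa> \<sigma> (\<phi> v)"
    and B: "affine_on_simplex \<tau> B" "\<And>v. v \<in> \<tau> \<Longrightarrow> B v = \<kappa> \<tau> (\<phi> v)"
  shows "inv_chart \<sigma> (A x) = inv_chart \<tau> (B x)"
proof -
  note ft = fin[OF s(3)]
  have BW: "B ` \<tau> = W \<tau>" using chart_vertices[OF s(3)] B(2) by (auto simp: image_image)
  have Bx: "B x \<in> convex hull (W \<tau>)"
    using affine_on_simplex_image[OF B(1) ft] x BW by auto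
  have "affine_on_simplex \<tau> ((\<kappa> \<sigma> \<circ> inv_chart \<tau>) \<circ> B)"
    by (rule affine_on_simplex_compose[OF B(1) ft]) (use transition_affine[OF s] BW in simp)
  moreover have "((\<kappa> \<sigma> \<circ> inv_chart \<tau>) \<circ> B) v = A v" if v: "v \<in> \<tau>" for v
    using A(2)[of v] B(2)[OF v] inv_chart(1)[OF s(3), of "\<phi> v"] hull_inc[OF v] s(2) v by auto
  moreover have "affine_on_simplex \<tau> A" by (rule affine_on_subset[OF A(1) fin[OF s(1)] s(2)])
  moreover obtain c where "bary \<tau> c" "x = (\<Sum>v\<in>\<tau>. c v *\<^sub>R v)" using x convex_hull_bary[OF ft] by blast
  ultimately have "((\<kappa> \<sigma> \<circ> inv_chart \<tau>) \<circ> B) x = A x"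
    using affine_on_simplexD[of \<tau> "(\<kappa> \<sigma> \<circ> inv_chart \<tau>) \<circ> B" c] affine_on_simplexD[of \<tau> A c]
    by (simp cong: sum.cong)
  moreover have "inv_chart \<tau> (B x) \<in> \<phi> ` (convex hull \<sigma>)"
    using inv_chart(3)[OF s(3) Bx] hull_mono[OF s(2)] by blast
  ultimately show ?thesis using inv_chart(1)[OF s(1)] by (metis comp_apply)
qed

text \<open>The homeomorphism is replaced by the map with the same vertex values that is affine in
  every chart. As vertices go to vertices, it maps each simplex onto the same image as
  \<open>\<phi>\<close>.\<close>

lemma straighten:
  obtains \<phi>' \<psi>' where "homeomorphism (\<Union>\<sigma>\<in>\<V>. convex hull \<sigma>) (\<phi> ` (\<Union>\<sigma>\<in>\<V>. convex hull \<sigma>)) \<phi>' \<psi>'"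
    "\<And>\<sigma>. \<sigma> \<in> \<V> \<Longrightarrow> \<phi>' ` (convex hull \<sigma>) = \<phi> ` (convex hull \<sigma>)"
    "\<And>\<sigma>. \<sigma> \<in> \<V> \<Longrightarrow> affine_on_simplex \<sigma> (\<kappa> \<sigma> \<circ> \<phi>')" "\<And>\<sigma>. \<sigma> \<in> \<V> \<Longrightarrow> \<kappa> \<sigma> ` \<phi>' ` \<sigma> = W \<sigma>"
proof -
  have "\<exists>A. (\<forall>v\<in>\<sigma>. A v = \<kappa> \<sigma> (\<phi> v)) \<and> affine_on_simplex \<sigma> A" if s: "\<sigma> \<in> \<V>" for \<sigma>
  proof -
    obtain A :: "fseq \<Rightarrow> real^2" where "\<And>v. v \<in> \<Union>\<V> \<Longrightarrow> A v = \<kappa> \<sigma> (\<phi> v)" "\<And>\<sigma>. \<sigma> \<in> \<V> \<Longrightarrow> affine_on_simplex \<sigma> A"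
      using simplexwise_affine_extension[OF V, of "\<lambda>v. \<kappa> \<sigma> (\<phi> v)"] by metis
    then show ?thesis using s by blast
  qed
  then obtain A where A: "\<And>\<sigma> v. \<sigma> \<in> \<V> \<Longrightarrow> v \<in> \<sigma> \<Longrightarrow> A \<sigma> v = \<kappa> \<sigma> (\<phi> v)"
    "\<And>\<sigma>. \<sigma> \<in> \<V> \<Longrightarrow> affine_on_simplex \<sigma> (A \<sigma>)"
    by metis
  define U where "U = (\<Union>\<sigma>\<in>\<V>. convex hull \<sigma>)"
  have sub: "convex hull \<sigma> \<subseteq> U" if "\<sigma> \<in> \<V>" for \<sigma> using that by (auto simp: U_def)
  define \<phi>' where "\<phi>' x = (let \<sigma> = SOME \<sigma>. \<sigma> \<in> \<V> \<and> x \<in> convex hull \<sigma> in inv_chart \<sigma> (A \<sigma> x))" for x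
  have AW: "A \<sigma> ` \<sigma> = W \<sigma>" if "\<sigma> \<in> \<V>" for \<sigma>
    using chart_vertices[OF that] A(1)[OF that] by (auto simp: image_image)
  have Ahull: "A \<sigma> ` (convex hull \<sigma>) = convex hull (W \<sigma>)" if "\<sigma> \<in> \<V>" for \<sigma>
    using affine_on_simplex_image[OF A(2)[OF that] fin[OF that]] AW[OF that] by simp
  have Ainj: "inj_on (A \<sigma>) \<sigma>" if "\<sigma> \<in> \<V>" for \<sigma>
    using chart_vertices[OF that] AW[OF that] fin[OF that] by (intro eq_card_imp_inj_on) auto
  have Ainjh: "inj_on (A \<sigma>) (convex hull \<sigma>)" if "\<sigma> \<in> \<V>" for \<sigma>
    by (rule affine_on_simplex_inj[OF A(2)[OF that] fin[OF that] Ainj[OF that]]) (simp add: AW indW that)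
  have \<phi>'eq: "\<phi>' x = inv_chart \<sigma> (A \<sigma> x)" if s: "\<sigma> \<in> \<V>" and x: "x \<in> convex hull \<sigma>" for \<sigma> x
  proof -
    define \<tau> where "\<tau> = (SOME \<sigma>. \<sigma> \<in> \<V> \<and> x \<in> convex hull \<sigma>)"
    have "\<tau> \<in> \<V> \<and> x \<in> convex hull \<tau>" unfolding \<tau>_def by (rule someI[of _ \<sigma>]) (use s x in simp)
    then have t: "\<tau> \<in> \<V>" "x \<in> convex hull \<tau>" by auto
    note r = vcomplex_hull_Int[OF V s t(1) x t(2)]
    have "inv_chart \<sigma> (A \<sigma> x) = inv_chart (\<sigma> \<inter> \<tau>) (A (\<sigma> \<inter> \<tau>) x)"
      by (rule inv_chart_transition[OF s _ r(1) r(2) A(2)[OF s] A(1)[OF s] A(2)[OF r(1)] A(1)[OF r(1)]]) auto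
    moreover have "inv_chart \<tau> (A \<tau> x) = inv_chart (\<sigma> \<inter> \<tau>) (A (\<sigma> \<inter> \<tau>) x)"
      by (rule inv_chart_transition[OF t(1) _ r(1) r(2) A(2)[OF t(1)] A(1)[OF t(1)] A(2)[OF r(1)] A(1)[OF r(1)]]) auto
    ultimately show ?thesis by (simp add: \<phi>'_def \<tau>_def[symmetric])
  qed
  have \<kappa>\<phi>': "\<kappa> \<sigma> (\<phi>' x) = A \<sigma> x" "\<phi>' x \<in> \<phi> ` (convex hull \<sigma>)" if "\<sigma> \<in> \<V>" "x \<in> convex hull \<sigma>" for \<sigma> x
    using inv_chart(2,3)[OF that(1), of "A \<sigma> x"] Ahull[OF that(1)] that by (auto simp: \<phi>'eq)
  have img': "\<phi>' ` (convex hull \<sigma>) = \<phi> ` (convex hull \<sigma>)" if s: "\<sigma> \<in> \<V>" for \<sigma>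
  proof (intro equalityI subsetI)
    fix y assume y: "y \<in> \<phi> ` (convex hull \<sigma>)"
    then have "\<kappa> \<sigma> y \<in> A \<sigma> ` (convex hull \<sigma>)" using img[OF s] Ahull[OF s] by blast
    then obtain x where x: "x \<in> convex hull \<sigma>" "\<kappa> \<sigma> y = A \<sigma> x" by blast
    then have "\<phi>' x = y" using \<phi>'eq[OF s x(1)] inv_chart(1)[OF s y] by simp
    then show "y \<in> \<phi>' ` (convex hull \<sigma>)" using x(1) by blast
  qed (use \<kappa>\<phi>'(2)[OF s] in blast)
  have inj1: "x = y" if "\<sigma> \<in> \<V>" "x \<in> convex hull \<sigma>" "y \<in> convex hull \<sigma>" "\<phi>' x = \<phi>' y" for \<sigma> x y
    using inj_onD[OF Ainjh[OF that(1)] _ that(2,3)] \<kappa>\<phi>'(1)[OF that(1,2)] \<kappa>\<phi>'(1)[OF that(1,3)] that(4) by simp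
  \<comment> \<open>Injectivity across simplices is borrowed from \<open>\<phi>\<close>: a common
    value on \<open>\<sigma>\<close> and \<open>\<tau>\<close> lies in the image of
    \<open>\<sigma> \<inter> \<tau>\<close> under \<open>\<phi>\<close>, hence under
    \<open>\<phi>'\<close>, and its preimage there is compared with \<open>x\<close> and
    \<open>y\<close> within one simplex each.\<close>
  have inj': "inj_on \<phi>' U"
  proof (rule inj_onI)
    fix x y assume "x \<in> U" "y \<in> U" and e: "\<phi>' x = \<phi>' y"
    then obtain \<sigma> \<tau> where s: "\<sigma> \<in> \<V>" "x \<in> convex hull \<sigma>" and t: "\<tau> \<in> \<V>" "y \<in> convex hull \<tau>" by (auto simp: U_def)
    obtain a where a: "a \<in> convex hull \<sigma>" "\<phi>' x = \<phi> a" using \<kappa>\<phi>'(2)[OF s] by blast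
    obtain b where b: "b \<in> convex hull \<tau>" "\<phi>' y = \<phi> b" using \<kappa>\<phi>'(2)[OF t] by blast
    have "a = b" using inj_onD[OF inj[folded U_def], of a b] a b e sub[OF s(1)] sub[OF t(1)] by auto
    then have "a \<in> convex hull \<tau>" using b by simp
    note r = vcomplex_hull_Int[OF V s(1) t(1) a(1) this]
    have "\<phi>' x \<in> \<phi>' ` (convex hull (\<sigma> \<inter> \<tau>))" unfolding img'[OF r(1)] a(2) using r(2) by blast
    then obtain w where w: "w \<in> convex hull (\<sigma> \<inter> \<tau>)" "\<phi>' x = \<phi>' w" by blast
    have "w \<in> convex hull \<sigma>" "w \<in> convex hull \<tau>" using w(1) hull_mono[of "\<sigma> \<inter> \<tau>"] by auto
    then show "x = y" using inj1[OF s(1,2)] inj1[OF t(1,2)] w(2) e by metis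
  qed
  have cont': "continuous_on U \<phi>'"
    unfolding U_def
  proof (rule continuous_on_closed_Union)
    show "finite \<V>" by (rule vcomplexD(1)[OF V])
    fix \<sigma> assume s: "\<sigma> \<in> \<V>"
    show "closed (convex hull \<sigma>)" using fin[OF s] by (simp add: compact_imp_closed finite_imp_compact_convex_hull)
    have cA: "continuous_on (convex hull \<sigma>) (A \<sigma>)"
      by (rule affine_on_simplex_continuous[OF A(2)[OF s] fin[OF s] Ainj[OF s]]) (simp add: AW indW s)
    have "dist (inv_chart \<sigma> y) (inv_chart \<sigma> z) = dist y z"
      if "y \<in> convex hull (W \<sigma>)" "z \<in> convex hull (W \<sigma>)" for y z
      using dp[OF s] inv_chart(2,3)[OF s] that unfolding distance_preserving_on_def by metis
    then have "continuous_on (convex hull (W \<sigma>)) (inv_chart \<sigma>)"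
      by (intro distance_preserving_continuous) (simp add: distance_preserving_on_def)
    then have "continuous_on (convex hull \<sigma>) (\<lambda>x. inv_chart \<sigma> (A \<sigma> x))"
      by (rule continuous_on_compose2[OF _ cA]) (simp add: Ahull s)
    then show "continuous_on (convex hull \<sigma>) \<phi>'"
      by (rule continuous_on_eq) (rule \<phi>'eq[OF s, symmetric])
  qed
  have "compact U" unfolding U_def
    by (intro compact_UN vcomplexD(1)[OF V] ballI finite_imp_compact_convex_hull fin)
  moreover have "\<phi>' ` U = \<phi> ` U" unfolding U_def image_UN using img' by simp
  ultimately have "\<exists>\<psi>'. homeomorphism U (\<phi> ` U) \<phi>' \<psi>'"
    using homeomorphism_compact[OF _ cont' _ inj'] by blast
  then obtain \<psi>' where hom: "homeomorphism U (\<phi> ` U) \<phi>' \<psi>'" ..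
  have aff: "affine_on_simplex \<sigma> (\<kappa> \<sigma> \<circ> \<phi>')" if s: "\<sigma> \<in> \<V>" for \<sigma>
    unfolding affine_on_simplex_def
  proof (intro allI impI)
    fix c assume c: "bary \<sigma> c"
    have "(\<Sum>v\<in>\<sigma>. c v *\<^sub>R v) \<in> convex hull \<sigma>"
      unfolding convex_hull_bary[OF fin[OF s]] using c by (intro exI[of _ c] conjI refl)
    then have "(\<kappa> \<sigma> \<circ> \<phi>') (\<Sum>v\<in>\<sigma>. c v *\<^sub>R v) = (\<Sum>v\<in>\<sigma>. c v *\<^sub>R A \<sigma> v)"
      using \<kappa>\<phi>'(1)[OF s] affine_on_simplexD[OF A(2)[OF s] c] by simp
    also have "\<dots> = (\<Sum>v\<in>\<sigma>. c v *\<^sub>R (\<kappa> \<sigma> \<circ> \<phi>') v)"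
      by (rule sum.cong) (auto simp: \<kappa>\<phi>'(1)[OF s] hull_inc)
    finally show "(\<kappa> \<sigma> \<circ> \<phi>') (\<Sum>v\<in>\<sigma>. c v *\<^sub>R v) = (\<Sum>v\<in>\<sigma>. c v *\<^sub>R (\<kappa> \<sigma> \<circ> \<phi>') v)" .
  qed
  have ver: "\<kappa> \<sigma> ` \<phi>' ` \<sigma> = W \<sigma>" if s: "\<sigma> \<in> \<V>" for \<sigma>
    unfolding AW[OF s, symmetric] image_image using \<kappa>\<phi>'(1)[OF s hull_inc] by (intro image_cong) auto
  show ?thesis by (rule that[OF hom[unfolded U_def] img' aff ver])
qed

end

text \<open>The dimension is read off some triangulation, whereas \<open>K\<close> may be a
  different one, such as the one on which \<open>h\<close> is linear. Invariance of dimension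
  transfers the bound to the simplices of \<open>K\<close> and to their Euclidean models.\<close>

lemma triangulation_card_le_3:
  fixes P :: "'a::metric_space set"
  assumes "has_polyhedral_dim P 2" and tri: "polyhedral_triangulation K \<phi> P" and s: "simplex_with_vertices V S" "S \<in> K"
  shows "card V \<le> 3"
    "\<And>V' E \<iota>. simplex_with_vertices V' E \<Longrightarrow> isometry_between E (\<phi> ` S) \<iota> \<Longrightarrow> card V' \<le> 3"
proof -
  obtain K2 \<phi>2 where K2: "polyhedral_triangulation K2 \<phi>2 P" "complex_has_dim K2 2"
    using assms(1) by (auto simp: has_polyhedral_dim_def)
  obtain \<psi>2 where \<psi>2: "homeomorphism (\<Union>K2) P \<phi>2 \<psi>2" and Rn2: "Rn_simplicial_complex K2"
    using K2(1) by (auto simp: polyhedral_triangulation_def triangulates_def)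
  obtain \<V>2 where V2: "vcomplex \<V>2" "(\<lambda>\<sigma>. convex hull \<sigma>) ` \<V>2 = K2" by (rule simplicial_complex_vcomplex[OF Rn2])
  have c2: "card \<sigma> \<le> 3" if "\<sigma> \<in> \<V>2" for \<sigma>
    using K2(2) vcomplex_simplex[OF V2(1) that] that V2(2) unfolding complex_has_dim_def by fastforce
  obtain \<psi> where \<psi>: "homeomorphism (\<Union>K) P \<phi> \<psi>" using tri by (auto simp: polyhedral_triangulation_def triangulates_def)
  define \<Y> where "\<Y> = (\<lambda>\<sigma>. \<phi>2 ` (convex hull \<sigma>)) ` \<V>2"
  have UY: "\<Union>\<Y> = P" using homeomorphism_image1[OF \<psi>2] V2(2) by (auto simp: \<Y>_def)
  have finY: "finite \<Y>" using vcomplexD(1)[OF V2(1)] by (simp add: \<Y>_def)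
  have Y: "closed Y \<and> (\<exists>g::'a \<Rightarrow> real^2. continuous_on Y g \<and> inj_on g Y)" if YY: "Y \<in> \<Y>" for Y
  proof -
    obtain \<sigma> where \<sigma>: "\<sigma> \<in> \<V>2" "Y = \<phi>2 ` (convex hull \<sigma>)" using YY by (auto simp: \<Y>_def)
    have sub: "convex hull \<sigma> \<subseteq> \<Union>K2" using \<sigma>(1) V2(2) by blast
    note f = vcomplexD(2)[OF V2(1) \<sigma>(1)]
    obtain T :: "fseq \<Rightarrow> real^2" where T: "distance_preserving_on (convex hull \<sigma>) T"
      using isometric_projection_exists[OF f c2[OF \<sigma>(1)]] by metis
    have "compact Y" unfolding \<sigma>(2)
      by (rule compact_continuous_image[OF continuous_on_subset[OF homeomorphism_cont1[OF \<psi>2] sub] finite_imp_compact_convex_hull[OF f]])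
    moreover have img: "\<psi>2 ` Y = convex hull \<sigma>"
      unfolding \<sigma>(2) using homeomorphism_apply1[OF \<psi>2] sub by force
    have YP: "Y \<subseteq> P" using YY UY by blast
    have "continuous_on Y (T \<circ> \<psi>2)"
      by (rule continuous_on_compose[OF continuous_on_subset[OF homeomorphism_cont2[OF \<psi>2] YP]])
        (simp add: img distance_preserving_continuous[OF T])
    moreover have "inj_on (T \<circ> \<psi>2) Y"
    proof (rule comp_inj_on)
      show "inj_on \<psi>2 Y" by (rule inj_on_inverseI[of _ \<phi>2]) (use homeomorphism_apply2[OF \<psi>2] YP in blast)
      show "inj_on T (\<psi>2 ` Y)" unfolding img by (rule distance_preserving_inj[OF T])
    qed
    ultimately show ?thesis using compact_imp_closed by blast
  qed
  have SK: "S \<subseteq> \<Union>K" using s(2) by blast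
  have contS: "continuous_on S \<phi>" by (rule continuous_on_subset[OF homeomorphism_cont1[OF \<psi>] SK])
  have injS: "inj_on \<phi> S" by (rule inj_on_inverseI[of _ \<psi>]) (use homeomorphism_apply1[OF \<psi>] SK in blast)
  have SP: "\<phi> ` S \<subseteq> P" using homeomorphism_image1[OF \<psi>] SK by blast
  show "card V \<le> 3"
  proof (rule ccontr)
    assume "\<not> card V \<le> 3"
    moreover have "finite V" "\<not> affine_dependent V" "S = convex hull V"
      using s(1) unfolding simplex_with_vertices_def by metis+
    ultimately show False
      using contS injS finY SP UY Y by (intro no_solid_embedding[of V \<phi> \<Y>]) auto
  qed
  fix V' E \<iota> assume sv: "simplex_with_vertices V' E" and iso: "isometry_between E (\<phi> ` S) \<iota>"
  show "card V' \<le> 3"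
  proof (rule ccontr)
    assume "\<not> card V' \<le> 3"
    moreover have "finite V'" "\<not> affine_dependent V'" "E = convex hull V'"
      using sv unfolding simplex_with_vertices_def by metis+
    moreover have "distance_preserving_on E \<iota>" "\<iota> ` E = \<phi> ` S"
      using iso by (auto simp: isometry_between_def bij_betw_def)
    ultimately show False
      using finY SP UY Y distance_preserving_continuous distance_preserving_inj
      by (intro no_solid_embedding[of V' \<iota> \<Y>]) auto
  qed
qed

text \<open>The complex is that of a triangulation on whose simplices \<open>h\<close> is linear,
  with its homeomorphism straightened. Linearity of \<open>h\<close>, given in the coordinates of
  the model simplices, thereby becomes linearity in the coordinates of the complex.\<close>

lemma flat_triangulation_exists:
  fixes P :: "'a::metric_space set" and h :: "'a \<Rightarrow> 'b::euclidean_space"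
  assumes dim: "has_polyhedral_dim P 2" and "piecewise_linear_on P h"
  obtains \<V> n \<phi> \<psi> where "vcomplex \<V>" "(\<Union>\<sigma>\<in>\<V>. convex hull \<sigma>) \<subseteq> Rn n"
    "homeomorphism (\<Union>\<sigma>\<in>\<V>. convex hull \<sigma>) P \<phi> \<psi>" "\<And>\<sigma>. \<sigma> \<in> \<V> \<Longrightarrow> card \<sigma> \<le> 3"
    "\<And>\<sigma>. \<sigma> \<in> \<V> \<Longrightarrow> \<exists>\<kappa>::'a \<Rightarrow> real^2. distance_preserving_on (\<phi> ` (convex hull \<sigma>)) \<kappa> \<and> affine_on_simplex \<sigma> (\<kappa> \<circ> \<phi>)"
    "\<And>\<sigma>. \<sigma> \<in> \<V> \<Longrightarrow> affine_on_simplex \<sigma> (h \<circ> \<phi>)"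
proof -
  obtain K \<phi> where K: "polyhedral_triangulation K \<phi> P" "\<And>S. S \<in> K \<Longrightarrow> barycentric_linear_on (\<phi> ` S) h"
    using assms(2) by (auto simp: piecewise_linear_on_def)
  obtain \<psi> where \<psi>: "homeomorphism (\<Union>K) P \<phi> \<psi>" and Rn: "Rn_simplicial_complex K"
    using K(1) by (auto simp: polyhedral_triangulation_def triangulates_def)
  obtain n where n: "\<Union>K \<subseteq> Rn n" using Rn by (auto simp: Rn_simplicial_complex_def)
  obtain \<V> where V: "vcomplex \<V>" "(\<lambda>\<sigma>. convex hull \<sigma>) ` \<V> = K" by (rule simplicial_complex_vcomplex[OF Rn])
  have UK: "(\<Union>\<sigma>\<in>\<V>. convex hull \<sigma>) = \<Union>K" using V(2) by simp
  have card3: "card \<sigma> \<le> 3" if "\<sigma> \<in> \<V>" for \<sigma>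
    using triangulation_card_le_3(1)[OF dim K(1) vcomplex_simplex[OF V(1) that]] that V(2) by blast
  define Q where "Q \<sigma> p \<longleftrightarrow> (case p of (W, \<kappa>, H) \<Rightarrow> finite W \<and> \<not> affine_dependent W \<and>
     distance_preserving_on (\<phi> ` (convex hull \<sigma>)) (\<kappa> :: 'a \<Rightarrow> real^2) \<and>
     \<kappa> ` \<phi> ` (convex hull \<sigma>) = convex hull W \<and> affine_on_simplex W H \<and>
     (\<forall>y\<in>\<phi> ` (convex hull \<sigma>). h y = H (\<kappa> y)))" for \<sigma> p
  have "\<exists>p. Q \<sigma> p"
    if s: "\<sigma> \<in> \<V>" for \<sigma>
  proof -
    have SK: "convex hull \<sigma> \<in> K" using s V(2) by blast
    obtain V' E \<iota> where *: "simplex_with_vertices V' E" "isometry_between E (\<phi> ` (convex hull \<sigma>)) \<iota>"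
      "\<forall>c. (\<forall>v\<in>V'. 0 \<le> c v) \<and> sum c V' = 1 \<longrightarrow> h (\<iota> (\<Sum>v\<in>V'. c v *\<^sub>R v)) = (\<Sum>v\<in>V'. c v *\<^sub>R h (\<iota> v))"
      using K(2)[OF SK] unfolding barycentric_linear_on_def by metis
    have "card V' \<le> 3" by (rule triangulation_card_le_3(2)[OF dim K(1) vcomplex_simplex[OF V(1) s] SK *(1,2)])
    then obtain W and \<kappa> :: "'a \<Rightarrow> real^2" and H where
      q: "finite W" "\<not> affine_dependent W" "distance_preserving_on (\<phi> ` (convex hull \<sigma>)) \<kappa>"
      "\<kappa> ` \<phi> ` (convex hull \<sigma>) = convex hull W" "affine_on_simplex W H"
      "\<And>y. y \<in> \<phi> ` (convex hull \<sigma>) \<Longrightarrow> h y = H (\<kappa> y)"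
      using flat_chart_exists[OF *(1,2) _ *(3)] by metis
    then have "Q \<sigma> (W, \<kappa>, H)" unfolding Q_def by simp
    then show ?thesis by blast
  qed
  then obtain f where f: "\<And>\<sigma>. \<sigma> \<in> \<V> \<Longrightarrow> Q \<sigma> (f \<sigma>)" by metis
  define W \<kappa> H where "W \<sigma> = fst (f \<sigma>)" and "\<kappa> \<sigma> = fst (snd (f \<sigma>))" and "H \<sigma> = snd (snd (f \<sigma>))" for \<sigma>
  have C: "\<And>\<sigma>. \<sigma> \<in> \<V> \<Longrightarrow> finite (W \<sigma>)" "\<And>\<sigma>. \<sigma> \<in> \<V> \<Longrightarrow> \<not> affine_dependent (W \<sigma>)"
    "\<And>\<sigma>. \<sigma> \<in> \<V> \<Longrightarrow> distance_preserving_on (\<phi> ` (convex hull \<sigma>)) (\<kappa> \<sigma> :: 'a \<Rightarrow> real^2)"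
    "\<And>\<sigma>. \<sigma> \<in> \<V> \<Longrightarrow> \<kappa> \<sigma> ` \<phi> ` (convex hull \<sigma>) = convex hull (W \<sigma>)"
    "\<And>\<sigma>. \<sigma> \<in> \<V> \<Longrightarrow> affine_on_simplex (W \<sigma>) (H \<sigma>)"
    "\<And>\<sigma> y. \<sigma> \<in> \<V> \<Longrightarrow> y \<in> \<phi> ` (convex hull \<sigma>) \<Longrightarrow> h y = H \<sigma> (\<kappa> \<sigma> y)"
    using f[unfolded Q_def case_prod_unfold, folded W_def \<kappa>_def H_def] by blast+
  interpret chart_system \<V> \<phi> W \<kappa>
  proof
    show "vcomplex \<V>" by (rule V(1))
    show "continuous_on (\<Union>\<sigma>\<in>\<V>. convex hull \<sigma>) \<phi>" unfolding UK by (rule homeomorphism_cont1[OF \<psi>])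
    show "inj_on \<phi> (\<Union>\<sigma>\<in>\<V>. convex hull \<sigma>)" unfolding UK
      by (rule inj_on_inverseI[of _ \<psi>]) (rule homeomorphism_apply1[OF \<psi>])
  qed (fact card3 C)+
  obtain \<phi>' \<psi>' where S: "homeomorphism (\<Union>\<sigma>\<in>\<V>. convex hull \<sigma>) (\<phi> ` (\<Union>\<sigma>\<in>\<V>. convex hull \<sigma>)) \<phi>' \<psi>'"
    "\<And>\<sigma>. \<sigma> \<in> \<V> \<Longrightarrow> \<phi>' ` (convex hull \<sigma>) = \<phi> ` (convex hull \<sigma>)"
    "\<And>\<sigma>. \<sigma> \<in> \<V> \<Longrightarrow> affine_on_simplex \<sigma> (\<kappa> \<sigma> \<circ> \<phi>')" "\<And>\<sigma>. \<sigma> \<in> \<V> \<Longrightarrow> \<kappa> \<sigma> ` \<phi>' ` \<sigma> = W \<sigma>"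
  proof (rule straighten)
    fix \<phi>' \<psi>'
    assume *: "homeomorphism (\<Union>\<sigma>\<in>\<V>. convex hull \<sigma>) (\<phi> ` (\<Union>\<sigma>\<in>\<V>. convex hull \<sigma>)) \<phi>' \<psi>'"
      "\<And>\<sigma>. \<sigma> \<in> \<V> \<Longrightarrow> \<phi>' ` (convex hull \<sigma>) = \<phi> ` (convex hull \<sigma>)"
      "\<And>\<sigma>. \<sigma> \<in> \<V> \<Longrightarrow> affine_on_simplex \<sigma> (\<kappa> \<sigma> \<circ> \<phi>')" "\<And>\<sigma>. \<sigma> \<in> \<V> \<Longrightarrow> \<kappa> \<sigma> ` \<phi>' ` \<sigma> = W \<sigma>"
    show thesis by (rule that[OF *])
  qed
  have "\<phi> ` (\<Union>\<sigma>\<in>\<V>. convex hull \<sigma>) = P" unfolding UK by (rule homeomorphism_image1[OF \<psi>])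
  then have hom: "homeomorphism (\<Union>\<sigma>\<in>\<V>. convex hull \<sigma>) P \<phi>' \<psi>'" using S(1) by simp
  have hh: "affine_on_simplex \<sigma> (h \<circ> \<phi>')" if s: "\<sigma> \<in> \<V>" for \<sigma>
  proof -
    have a: "affine_on_simplex \<sigma> (H \<sigma> \<circ> (\<kappa> \<sigma> \<circ> \<phi>'))"
      by (rule affine_on_simplex_compose[OF S(3)[OF s] fin[OF s]])
        (simp only: image_comp[symmetric] S(4)[OF s] C(5)[OF s])
    have eq: "h (\<phi>' x) = H \<sigma> (\<kappa> \<sigma> (\<phi>' x))" if "x \<in> convex hull \<sigma>" for x
      using C(6)[OF s] S(2)[OF s] that by blast
    show ?thesis
      unfolding affine_on_simplex_def
    proof (intro allI impI)
      fix c assume c: "bary \<sigma> c"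
      have "(\<Sum>v\<in>\<sigma>. c v *\<^sub>R v) \<in> convex hull \<sigma>"
        unfolding convex_hull_bary[OF fin[OF s]] using c by (intro exI[of _ c] conjI refl)
      then have "(h \<circ> \<phi>') (\<Sum>v\<in>\<sigma>. c v *\<^sub>R v) = (\<Sum>v\<in>\<sigma>. c v *\<^sub>R H \<sigma> (\<kappa> \<sigma> (\<phi>' v)))"
        using eq affine_on_simplexD[OF a c] by simp
      also have "\<dots> = (\<Sum>v\<in>\<sigma>. c v *\<^sub>R (h \<circ> \<phi>') v)"
        by (rule sum.cong) (auto simp: eq hull_inc)
      finally show "(h \<circ> \<phi>') (\<Sum>v\<in>\<sigma>. c v *\<^sub>R v) = (\<Sum>v\<in>\<sigma>. c v *\<^sub>R (h \<circ> \<phi>') v)" .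
    qed
  qed
  have kk: "\<exists>\<kappa>::'a \<Rightarrow> real^2. distance_preserving_on (\<phi>' ` (convex hull \<sigma>)) \<kappa> \<and> affine_on_simplex \<sigma> (\<kappa> \<circ> \<phi>')"
    if "\<sigma> \<in> \<V>" for \<sigma>
    using C(3)[OF that] S(2,3)[OF that] by auto
  have "(\<Union>\<sigma>\<in>\<V>. convex hull \<sigma>) \<subseteq> Rn n" using n UK by simp
  from that[OF V(1) this hom card3 kk hh] show ?thesis .
qed


section \<open>The approximation\<close>

text \<open>The equality case of the triangle inequality. The only possible point is
  \<open>p\<close>, which divides the segment from \<open>v\<close> to \<open>w\<close> in the ratio
  of \<open>a\<close> to \<open>b\<close>; by the parallel axis identity the squared distance to
  \<open>p\<close> is at most 0.\<close>

lemma inner_between_unique: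
  fixes v w z z' :: "'b::real_inner"
  assumes "dist z v \<le> a" "dist z w \<le> b" "dist z' v \<le> a" "dist z' w \<le> b" "dist v w = a + b"
  shows "z = z'"
proof (cases "a + b = 0")
  case True
  have "0 \<le> a" "0 \<le> b" using assms(1,2) zero_le_dist order_trans by blast+
  then have "a = 0" using True by simp
  then show ?thesis using assms(1,3) by simp
next
  case False
  have ab: "0 \<le> a" "0 \<le> b" using assms(1,2) zero_le_dist order_trans by blast+
  then have pos: "0 < a + b" using False by simp
  define c where "c t = (if t then b / (a + b) else a / (a + b))" for t
  have c: "bary (UNIV :: bool set) c"
    using ab pos by (auto simp: bary_def c_def UNIV_bool add_divide_distrib[symmetric] add.commute)
  define q where "q t = (if t then v else w)" for t
  define p where "p = (\<Sum>t\<in>UNIV. c t *\<^sub>R q t)"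
  have "x = p" if x: "dist x v \<le> a" "dist x w \<le> b" for x
  proof -
    have "(norm (x - p))\<^sup>2 = (\<Sum>t\<in>UNIV. c t * (norm (x - q t))\<^sup>2) - (1/2) * (\<Sum>s\<in>UNIV. \<Sum>t\<in>UNIV. c s * c t * (norm (q s - q t))\<^sup>2)"
      unfolding p_def by (rule norm_diff_sum_weighted[OF c]) simp
    also have "\<dots> = b / (a + b) * (dist x v)\<^sup>2 + a / (a + b) * (dist x w)\<^sup>2 - (b / (a + b)) * (a / (a + b)) * (a + b)\<^sup>2"
      using assms(5) by (simp add: UNIV_bool c_def q_def dist_norm norm_minus_commute[of w v])
    also have "\<dots> \<le> b / (a + b) * a\<^sup>2 + a / (a + b) * b\<^sup>2 - (b / (a + b)) * (a / (a + b)) * (a + b)\<^sup>2"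
      using x ab pos by (intro diff_right_mono add_mono mult_left_mono power_mono) auto
    also have "\<dots> = 0" using pos by (simp add: field_simps power2_eq_square)
    finally show ?thesis by simp
  qed
  then show ?thesis using assms by metis
qed

lemma polytope_halfspaces:
  fixes C :: "'a::euclidean_space set"
  assumes "polytope C"
  shows "\<exists>A. finite A \<and> C = {x. \<forall>z\<in>A. fst z \<bullet> x \<le> snd z}"
proof -
  obtain F where F: "finite F" "C = \<Inter>F" "\<forall>h\<in>F. \<exists>a b. a \<noteq> 0 \<and> h = {x. a \<bullet> x \<le> b}"
    using polytope_imp_polyhedron[OF assms] unfolding polyhedron_def by metis
  have "\<forall>h\<in>F. \<exists>z. h = {x. fst z \<bullet> x \<le> snd z}" using F(3) by (metis fst_conv snd_conv)
  then obtain z where z: "\<And>h. h \<in> F \<Longrightarrow> h = {x. fst (z h) \<bullet> x \<le> snd (z h)}" by metis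
  have "C = {x. \<forall>y\<in>z ` F. fst y \<bullet> x \<le> snd y}" unfolding F(2) using z by blast
  then show ?thesis using F(1) by blast
qed

text \<open>Model simplices of a polyhedral triangulation are sets in \<open>fseq\<close>, whereas
  the charts take values in the plane.\<close>

lemma plane_isometric_embedding:
  obtains J :: "real^2 \<Rightarrow> fseq" where "distance_preserving_on UNIV J"
proof -
  define e where "e i = Abs_fseq (\<lambda>j. if j = i then 1 else 0)" for i :: nat
  have ce: "coord (e i) j = (if j = i then 1 else 0)" for i j
    unfolding e_def by (subst Abs_fseq_inverse) auto
  have ie: "e i \<bullet> e j = (if i = j then 1 else 0)" for i j
    by (subst inner_fseq_eq_sum[of "{i}"]) (auto simp: ce)
  define J :: "real^2 \<Rightarrow> fseq" where "J x = (x $ 1) *\<^sub>R e 0 + (x $ 2) *\<^sub>R e 1" for x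
  have "dist (J x) (J y) = dist x y" for x y
  proof -
    have d: "J x - J y = (x $ 1 - y $ 1) *\<^sub>R e 0 + (x $ 2 - y $ 2) *\<^sub>R e 1"
      by (simp add: J_def algebra_simps)
    have "(norm (J x - J y))\<^sup>2 = (norm (x - y))\<^sup>2"
      unfolding d power2_norm_eq_inner
      by (simp add: inner_add_left inner_add_right ie inner_vec_def sum_2)
    then show ?thesis by (simp add: dist_norm power2_eq_iff_nonneg)
  qed
  then have "distance_preserving_on UNIV J" by (simp add: distance_preserving_on_def)
  then show ?thesis by (rule that)
qed

lemma compact_finite_net:
  assumes "compact K" "0 < e"
  obtains N where "finite N" "N \<subseteq> K" "\<And>x. x \<in> K \<Longrightarrow> \<exists>n\<in>N. dist n x < e"
proof -
  obtain N where "N \<subseteq> K" "finite N" "K \<subseteq> (\<Union>n\<in>N. ball n e)"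
    using compactE_image[OF assms(1), of K "\<lambda>x. ball x e"] assms(2) by force
  then show ?thesis using that[of N] by force
qed

section \<open>Approximation on a flat triangulation\<close>

locale flat_triangulation =
  fixes \<V> :: "fseq set set" and n :: nat and \<phi> :: "fseq \<Rightarrow> 'a::metric_space" and \<psi> P
    and \<kappa> :: "fseq set \<Rightarrow> 'a \<Rightarrow> real^2"
  assumes V: "vcomplex \<V>" and Rn: "(\<Union>\<sigma>\<in>\<V>. convex hull \<sigma>) \<subseteq> Rn n"
    and hom: "homeomorphism (\<Union>\<sigma>\<in>\<V>. convex hull \<sigma>) P \<phi> \<psi>"
    and card3: "\<sigma> \<in> \<V> \<Longrightarrow> card \<sigma> \<le> 3"
    and dp: "\<sigma> \<in> \<V> \<Longrightarrow> distance_preserving_on (\<phi> ` (convex hull \<sigma>)) (\<kappa> \<sigma>)"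
    and aff: "\<sigma> \<in> \<V> \<Longrightarrow> affine_on_simplex \<sigma> (\<kappa> \<sigma> \<circ> \<phi>)"
begin

lemma fin: "\<sigma> \<in> \<V> \<Longrightarrow> finite \<sigma>"
  using vcomplexD(2)[OF V] .

lemma \<phi>_inj:
  assumes "\<sigma> \<in> \<V>" "\<tau> \<in> \<V>" "x \<in> convex hull \<sigma>" "y \<in> convex hull \<tau>" "\<phi> x = \<phi> y"
  shows "x = y"
proof -
  have "\<psi> (\<phi> x) = x" "\<psi> (\<phi> y) = y" using homeomorphism_apply1[OF hom] assms by blast+
  then show ?thesis using assms(5) by metis
qed

lemma \<kappa>_dist:
  assumes "\<sigma> \<in> \<V>" "x \<in> convex hull \<sigma>" "y \<in> convex hull \<sigma>"
  shows "dist (\<kappa> \<sigma> (\<phi> x)) (\<kappa> \<sigma> (\<phi> y)) = dist (\<phi> x) (\<phi> y)"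
  using dp[OF assms(1)] assms(2,3) unfolding distance_preserving_on_def by blast

lemma image_P: "P = (\<Union>\<sigma>\<in>\<V>. \<phi> ` (convex hull \<sigma>))"
  using homeomorphism_image1[OF hom] by (simp add: image_UN)

lemma image_Int:
  assumes "\<sigma> \<in> \<V>" "\<tau> \<in> \<V>" "y \<in> \<phi> ` (convex hull \<sigma>)" "y \<in> \<phi> ` (convex hull \<tau>)"
  shows "\<sigma> \<inter> \<tau> \<in> \<V>" "y \<in> \<phi> ` (convex hull (\<sigma> \<inter> \<tau>))"
proof -
  obtain x x' where x: "x \<in> convex hull \<sigma>" "x' \<in> convex hull \<tau>" "y = \<phi> x" "y = \<phi> x'" using assms(3,4) by blast
  have "x = x'" using \<phi>_inj[OF assms(1,2) x(1,2)] x(3,4) by simp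
  then have "x \<in> convex hull \<tau>" using x(2) by simp
  note r = vcomplex_hull_Int[OF V assms(1,2) x(1) this]
  show "\<sigma> \<inter> \<tau> \<in> \<V>" by (rule r(1))
  show "y \<in> \<phi> ` (convex hull (\<sigma> \<inter> \<tau>))" using r(2) x(3) by blast
qed

lemma compact_simplex: "\<sigma> \<in> \<V> \<Longrightarrow> compact (\<phi> ` (convex hull \<sigma>))"
  using homeomorphism_cont1[OF hom]
  by (intro compact_continuous_image finite_imp_compact_convex_hull fin) (auto elim: continuous_on_subset)

lemma compact_P: "compact P"
  unfolding image_P by (intro compact_UN vcomplexD(1)[OF V] ballI compact_simplex)

text \<open>The charts are affine in the coordinates of the complex, so each new simplex appears in
  a chart as the hull of the images of its vertices, which is a Euclidean model for it.\<close>

lemma subdivision_polyhedral: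
  assumes sub: "subdivides \<V>' \<V>"
  shows "polyhedral_triangulation ((\<lambda>\<sigma>. convex hull \<sigma>) ` \<V>') \<phi> P"
proof -
  note V' = subdividesD(1)[OF sub] and U' = subdividesD(2)[OF sub]
  have "Rn_simplicial_complex ((\<lambda>\<sigma>. convex hull \<sigma>) ` \<V>')"
    by (rule vcomplex_simplicial_complex[OF V', of n]) (use Rn U' in simp)
  then have "triangulates ((\<lambda>\<sigma>. convex hull \<sigma>) ` \<V>') \<phi> P"
    unfolding triangulates_def U' using hom by blast
  moreover have "\<exists>V E \<iota>. simplex_with_vertices V E \<and> isometry_between E (\<phi> ` (convex hull \<sigma>')) \<iota>"
    if s': "\<sigma>' \<in> \<V>'" for \<sigma>'
  proof -
    obtain \<sigma> where s: "\<sigma> \<in> \<V>" "\<sigma>' \<subseteq> convex hull \<sigma>" using subdividesD(3)[OF sub s'] by blast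
    have sh: "convex hull \<sigma>' \<subseteq> convex hull \<sigma>" using s(2) by (simp add: hull_minimal)
    have f': "finite \<sigma>'" "\<sigma>' \<noteq> {}" using vcomplexD(2,3)[OF V' s'] .
    obtain J :: "real^2 \<Rightarrow> fseq" where J: "distance_preserving_on UNIV J" by (rule plane_isometric_embedding)
    define A where "A = J \<circ> (\<kappa> \<sigma> \<circ> \<phi>)"
    have dA: "dist (A x) (A y) = dist (\<phi> x) (\<phi> y)" if "x \<in> convex hull \<sigma>'" "y \<in> convex hull \<sigma>'" for x y
    proof -
      have "x \<in> convex hull \<sigma>" "y \<in> convex hull \<sigma>" using sh that by blast+
      then show ?thesis using J \<kappa>_dist[OF s(1), of x y] by (simp add: A_def distance_preserving_on_def)
    qed
    have affA: "affine_on_simplex \<sigma>' A"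
      unfolding A_def
    proof (rule affine_on_simplex_compose)
      show "affine_on_simplex \<sigma>' (\<kappa> \<sigma> \<circ> \<phi>)" by (rule affine_on_subsimplex[OF aff[OF s(1)] fin[OF s(1)] f'(1) s(2)])
      show "affine_on_simplex ((\<kappa> \<sigma> \<circ> \<phi>) ` \<sigma>') J" by (rule distance_preserving_affine[OF J]) (use f' in auto)
    qed (fact f')
    have injA: "inj_on A (convex hull \<sigma>')"
    proof (rule inj_onI)
      fix x y assume xy: "x \<in> convex hull \<sigma>'" "y \<in> convex hull \<sigma>'" "A x = A y"
      then have "\<phi> x = \<phi> y" using dA[OF xy(1,2)] by simp
      then show "x = y" using \<phi>_inj[OF s(1) s(1)] sh xy by blast
    qed
    define \<iota> where "\<iota> = \<phi> \<circ> the_inv_into (convex hull \<sigma>') A"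
    have \<iota>A: "\<iota> (A x) = \<phi> x" if "x \<in> convex hull \<sigma>'" for x
      using the_inv_into_f_f[OF injA that] by (simp add: \<iota>_def)
    have E: "convex hull (A ` \<sigma>') = A ` (convex hull \<sigma>')"
      by (rule affine_on_simplex_image[OF affA f'(1), symmetric])
    have "simplex_with_vertices (A ` \<sigma>') (convex hull (A ` \<sigma>'))"
      unfolding simplex_with_vertices_def
      using f' affine_independent_image[OF affA f'(1) vcomplex_affine_independent[OF V' s'] injA] by simp
    moreover have "isometry_between (convex hull (A ` \<sigma>')) (\<phi> ` (convex hull \<sigma>')) \<iota>"
      unfolding isometry_between_def
    proof
      show d: "distance_preserving_on (convex hull (A ` \<sigma>')) \<iota>"
        unfolding E distance_preserving_on_def using \<iota>A dA by simp
      show "bij_betw \<iota> (convex hull (A ` \<sigma>')) (\<phi> ` (convex hull \<sigma>'))"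
        unfolding bij_betw_def
      proof
        show "inj_on \<iota> (convex hull (A ` \<sigma>'))" by (rule distance_preserving_inj[OF d])
        show "\<iota> ` (convex hull (A ` \<sigma>')) = \<phi> ` (convex hull \<sigma>')"
          unfolding E image_image using \<iota>A by (rule image_cong[OF refl])
      qed
    qed
    ultimately show ?thesis by blast
  qed
  ultimately show ?thesis unfolding polyhedral_triangulation_def by blast
qed

text \<open>A simplex whose vertices are not separated by any side of the pieces lies in the piece
  that contains its barycenter.\<close>

lemma subdivision_for_pieces:
  fixes Q :: "fseq set \<Rightarrow> (real^2) set" and \<C> :: "fseq set \<Rightarrow> (real^2) set set" and f :: "'a \<Rightarrow> real^2"
  assumes pw: "\<And>\<sigma>. \<sigma> \<in> \<V> \<Longrightarrow> piecewise_isometric (Q \<sigma>) (\<C> \<sigma>) (F \<sigma>)"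
    and Q: "\<And>\<sigma> x. \<sigma> \<in> \<V> \<Longrightarrow> x \<in> convex hull \<sigma> \<Longrightarrow> \<kappa> \<sigma> (\<phi> x) \<in> Q \<sigma>"
    and f: "\<And>\<sigma> x. \<sigma> \<in> \<V> \<Longrightarrow> x \<in> convex hull \<sigma> \<Longrightarrow> f (\<phi> x) = F \<sigma> (\<kappa> \<sigma> (\<phi> x))"
  obtains \<V>' where "subdivides \<V>' \<V>" "\<And>\<sigma>'. \<sigma>' \<in> \<V>' \<Longrightarrow> distance_preserving_on (\<phi> ` (convex hull \<sigma>')) f"
proof -
  have pC: "polytope C" if "\<sigma> \<in> \<V>" "C \<in> \<C> \<sigma>" for \<sigma> C using pw[OF that(1)] that(2) by (auto simp: piecewise_isometric_def)
  define A where "A \<sigma> C = (SOME A. finite A \<and> C = {x. \<forall>z\<in>A. fst z \<bullet> x \<le> snd z})" for \<sigma> :: "fseq set" and C :: "(real^2) set"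
  have A: "\<And>\<sigma> C. \<sigma> \<in> \<V> \<Longrightarrow> C \<in> \<C> \<sigma> \<Longrightarrow> finite (A \<sigma> C)"
    "\<And>\<sigma> C. \<sigma> \<in> \<V> \<Longrightarrow> C \<in> \<C> \<sigma> \<Longrightarrow> C = {x. \<forall>z\<in>A \<sigma> C. fst z \<bullet> x \<le> snd z}"
    using someI_ex[OF polytope_halfspaces[OF pC]] unfolding A_def by blast+
  have ex: "\<exists>G. (\<forall>v\<in>\<Union>\<V>. G v = fst z \<bullet> \<kappa> \<sigma> (\<phi> v) - snd z) \<and> (\<forall>\<tau>\<in>\<V>. affine_on_simplex \<tau> G)" for \<sigma> z
    by (rule simplexwise_affine_extension[OF V, of "\<lambda>v. fst z \<bullet> \<kappa> \<sigma> (\<phi> v) - snd z"]) blast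
  \<comment> \<open>The affine function of a side \<open>z\<close> of a piece, read in the chart of
    \<open>\<sigma>\<close>. Its values at vertices outside \<open>\<sigma>\<close> carry no
    meaning; it is extended over the whole complex because the refinement acts on all simplices at
    once.\<close>
  define ext where "ext \<sigma> z = (SOME G. (\<forall>v\<in>\<Union>\<V>. G v = fst z \<bullet> \<kappa> \<sigma> (\<phi> v) - snd z) \<and> (\<forall>\<tau>\<in>\<V>. affine_on_simplex \<tau> G))" for \<sigma> z
  have extp: "(\<forall>v\<in>\<Union>\<V>. ext \<sigma> z v = fst z \<bullet> \<kappa> \<sigma> (\<phi> v) - snd z) \<and> (\<forall>\<tau>\<in>\<V>. affine_on_simplex \<tau> (ext \<sigma> z))" for \<sigma> z
    unfolding ext_def by (rule someI_ex[OF ex])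
  have ext: "ext \<sigma> z v = fst z \<bullet> \<kappa> \<sigma> (\<phi> v) - snd z" if "\<sigma> \<in> \<V>" "v \<in> \<sigma>" for \<sigma> z v
    using extp[of \<sigma> z] that by blast
  have extA: "affine_on_simplex \<tau> (ext \<sigma> z)" if "\<tau> \<in> \<V>" for \<sigma> z \<tau>
    using extp[of \<sigma> z] that by blast
  define \<G> where "\<G> = (\<Union>\<sigma>\<in>\<V>. \<Union>C\<in>\<C> \<sigma>. ext \<sigma> ` A \<sigma> C)"
  have "finite (\<C> \<sigma>)" if "\<sigma> \<in> \<V>" for \<sigma> using pw[OF that] by (simp add: piecewise_isometric_def)
  then have "finite \<G>" unfolding \<G>_def using vcomplexD(1)[OF V] A(1) by blast
  moreover have "affine_on_simplex \<tau> G" if "G \<in> \<G>" "\<tau> \<in> \<V>" for G \<tau>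
    using that extA unfolding \<G>_def by blast
  ultimately obtain \<V>' where V': "subdivides \<V>' \<V>" "\<forall>G\<in>\<G>. unseparated \<V>' G"
    using unseparated_refinement[OF _ V, of \<G>] by blast
  have "distance_preserving_on (\<phi> ` (convex hull \<sigma>')) f" if s': "\<sigma>' \<in> \<V>'" for \<sigma>'
  proof -
    obtain \<sigma> where s: "\<sigma> \<in> \<V>" "\<sigma>' \<subseteq> convex hull \<sigma>" using subdividesD(3)[OF V'(1) s'] by blast
    have sh: "convex hull \<sigma>' \<subseteq> convex hull \<sigma>" using s(2) by (simp add: hull_minimal)
    have f': "finite \<sigma>'" "\<sigma>' \<noteq> {}" using vcomplexD(2,3)[OF subdividesD(1)[OF V'(1)] s'] .
    define B where "B = \<kappa> \<sigma> \<circ> \<phi>"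
    have affB: "affine_on_simplex \<sigma> B" unfolding B_def by (rule aff[OF s(1)])
    have affB': "affine_on_simplex \<sigma>' B" by (rule affine_on_subsimplex[OF affB fin[OF s(1)] f'(1) s(2)])
    have extB: "ext \<sigma> z w = fst z \<bullet> B w - snd z" if "w \<in> \<sigma>'" for w z
    proof -
      have "w \<in> convex hull \<sigma>" using that s(2) by blast
      then obtain c where c: "bary \<sigma> c" "w = (\<Sum>v\<in>\<sigma>. c v *\<^sub>R v)" using convex_hull_bary[OF fin[OF s(1)]] by blast
      have "ext \<sigma> z w = (\<Sum>v\<in>\<sigma>. c v *\<^sub>R ext \<sigma> z v)"
        unfolding c(2) by (rule affine_on_simplexD[OF extA[OF s(1)] c(1)])
      also have "\<dots> = (\<Sum>v\<in>\<sigma>. c v * (fst z \<bullet> B v) - c v * snd z)"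
        by (rule sum.cong) (auto simp: ext[OF s(1)] B_def right_diff_distrib)
      also have "\<dots> = fst z \<bullet> (\<Sum>v\<in>\<sigma>. c v *\<^sub>R B v) - sum c \<sigma> * snd z"
        by (simp add: sum_subtractf inner_sum_right sum_distrib_right)
      also have "\<dots> = fst z \<bullet> B w - snd z"
        unfolding c(2) affine_on_simplexD[OF affB c(1)] baryD(3)[OF c(1)] by simp
      finally show ?thesis .
    qed
    define k where "k = real (card \<sigma>')"
    have k: "0 < k" using f' by (simp add: k_def card_gt_0_iff)
    define c0 where "c0 v = (if v \<in> \<sigma>' then 1 / k else 0)" for v
    have c0: "bary \<sigma>' c0" using k f' by (auto simp: bary_def c0_def k_def)
    define m where "m = (\<Sum>v\<in>\<sigma>'. c0 v *\<^sub>R v)"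
    have "m \<in> convex hull \<sigma>'" unfolding convex_hull_bary[OF f'(1)] m_def using c0 by (intro exI[of _ c0] conjI refl)
    then have "B m \<in> Q \<sigma>" using Q[OF s(1)] sh by (auto simp: B_def)
    then have "B m \<in> \<Union>(\<C> \<sigma>)" using pw[OF s(1)] unfolding piecewise_isometric_def by metis
    then obtain C where C: "C \<in> \<C> \<sigma>" "B m \<in> C" by blast
    obtain g where g: "rigid_motion g" "\<And>x. x \<in> C \<Longrightarrow> F \<sigma> x = g x"
      using pw[OF s(1)] C(1) unfolding piecewise_isometric_def by metis
    have "B w \<in> C" if w: "w \<in> \<sigma>'" for w
    proof -
      have "fst z \<bullet> B w \<le> snd z" if z: "z \<in> A \<sigma> C" for z
      proof (rule ccontr)
        assume "\<not> ?thesis"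
        then have pos: "0 < ext \<sigma> z w" by (simp add: extB[OF w])
        have "ext \<sigma> z \<in> \<G>" unfolding \<G>_def using s(1) C(1) z by blast
        then have un: "unseparated \<V>' (ext \<sigma> z)" using V'(2) by blast
        \<comment> \<open>One vertex strictly beyond the side \<open>z\<close> forces all vertices
          to be on or beyond it. Every vertex has positive weight in the barycenter, which would
          then lie strictly outside \<open>C\<close>.\<close>
        have nn: "0 \<le> ext \<sigma> z v" if v: "v \<in> \<sigma>'" for v
        proof -
          have "{v, w} \<in> \<V>'" by (rule vcomplexD(4)[OF subdividesD(1)[OF V'(1)] s']) (use v w in auto)
          then have "\<not> (ext \<sigma> z v < 0 \<and> 0 < ext \<sigma> z w)" using un unfolding unseparated_def by blast
          then show ?thesis using pos by simp
        qed
        have "0 < (\<Sum>v\<in>\<sigma>'. ext \<sigma> z v)" by (rule sum_pos2[OF f'(1) w]) (fact pos nn)+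
        also have "(\<Sum>v\<in>\<sigma>'. ext \<sigma> z v) = (\<Sum>v\<in>\<sigma>'. fst z \<bullet> B v) - k * snd z"
          by (simp add: extB sum_subtractf k_def)
        finally have "k * snd z < (\<Sum>v\<in>\<sigma>'. fst z \<bullet> B v)" by simp
        moreover have "B m = (1/k) *\<^sub>R (\<Sum>v\<in>\<sigma>'. B v)"
          unfolding m_def affine_on_simplexD[OF affB' c0] by (simp add: c0_def scaleR_sum_right)
        then have "fst z \<bullet> B m = (\<Sum>v\<in>\<sigma>'. fst z \<bullet> B v) / k" by (simp add: inner_sum_right)
        then have "k * (fst z \<bullet> B m) = (\<Sum>v\<in>\<sigma>'. fst z \<bullet> B v)" using k by simp
        ultimately have "k * snd z < k * (fst z \<bullet> B m)" by simp
        then have "snd z < fst z \<bullet> B m" using k by simp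
        moreover have "fst z \<bullet> B m \<le> snd z" using C A(2)[OF s(1) C(1)] z by blast
        ultimately show False by simp
      qed
      then show ?thesis using A(2)[OF s(1) C(1)] by blast
    qed
    then have "convex hull (B ` \<sigma>') \<subseteq> C"
      using polytope_imp_convex[OF pC[OF s(1) C(1)]] by (intro hull_minimal) auto
    then have BC: "B x \<in> C" if "x \<in> convex hull \<sigma>'" for x
      using affine_on_simplex_image[OF affB' f'(1)] that by blast
    have "dist (f (\<phi> x)) (f (\<phi> y)) = dist (\<phi> x) (\<phi> y)" if "x \<in> convex hull \<sigma>'" "y \<in> convex hull \<sigma>'" for x y
    proof -
      have xy: "x \<in> convex hull \<sigma>" "y \<in> convex hull \<sigma>" using that sh by auto
      have "dist (f (\<phi> x)) (f (\<phi> y)) = dist (g (B x)) (g (B y))"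
        using f[OF s(1) xy(1)] f[OF s(1) xy(2)] g(2)[OF BC[OF that(1)]] g(2)[OF BC[OF that(2)]] by (simp add: B_def)
      also have "\<dots> = dist (B x) (B y)" using g(1) by (simp add: rigid_motion_def)
      also have "\<dots> = dist (\<phi> x) (\<phi> y)" using \<kappa>_dist[OF s(1) xy] by (simp add: B_def)
      finally show ?thesis .
    qed
    then show ?thesis by (auto simp: distance_preserving_on_def)
  qed
  then show ?thesis using that[OF V'(1)] by blast
qed


section \<open>Edges parametrized by arc length\<close>

definition edges :: "fseq set set"
  where "edges = {e \<in> \<V>. card e = 2}"

definition edge_start :: "fseq set \<Rightarrow> fseq"
  where "edge_start e = (SOME p. p \<in> e)"

definition edge_end :: "fseq set \<Rightarrow> fseq"
  where "edge_end e = (SOME q. q \<in> e - {edge_start e})"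

lemma edge:
  assumes "e \<in> edges"
  shows "e \<in> \<V>" "e = {edge_start e, edge_end e}" "edge_start e \<noteq> edge_end e"
proof -
  show "e \<in> \<V>" using assms by (simp add: edges_def)
  obtain p q where pq: "e = {p, q}" "p \<noteq> q" using assms unfolding edges_def card_2_iff by auto
  have 1: "edge_start e \<in> e" unfolding edge_start_def by (rule someI[of _ p]) (simp add: pq)
  then have "\<exists>q. q \<in> e - {edge_start e}" using pq by auto
  then have 2: "edge_end e \<in> e - {edge_start e}" unfolding edge_end_def by (rule someI_ex)
  then show "edge_start e \<noteq> edge_end e" by auto
  show "e = {edge_start e, edge_end e}" using 1 2 pq by auto
qed

definition edge_length :: "fseq set \<Rightarrow> real"
  where "edge_length e = dist (\<phi> (edge_start e)) (\<phi> (edge_end e))"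

definition edge_point :: "fseq set \<Rightarrow> real \<Rightarrow> fseq"
  where "edge_point e s = (1 - s / edge_length e) *\<^sub>R edge_start e + (s / edge_length e) *\<^sub>R edge_end e"

lemma edge_vertices:
  assumes "e \<in> edges"
  shows "edge_start e \<in> convex hull e" "edge_end e \<in> convex hull e"
  using hull_subset[of e convex] edge(2)[OF assms] by blast+

lemma edge_length_pos:
  assumes "e \<in> edges"
  shows "0 < edge_length e"
proof -
  have "\<phi> (edge_start e) \<noteq> \<phi> (edge_end e)"
    using \<phi>_inj[OF edge(1)[OF assms] edge(1)[OF assms] edge_vertices[OF assms]] edge(3)[OF assms] by blast
  then show ?thesis by (simp add: edge_length_def)
qed

lemma edge_point_in:
  assumes "e \<in> edges" "s \<in> {0..edge_length e}"
  shows "edge_point e s \<in> convex hull e"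
  unfolding edge_point_def
  by (rule convexD_alt[OF convex_convex_hull edge_vertices[OF assms(1)]])
    (use assms edge_length_pos[OF assms(1)] in auto)

lemma edge_point_image:
  assumes e: "e \<in> edges"
  shows "edge_point e ` {0..edge_length e} = convex hull e"
proof (intro equalityI subsetI)
  fix x assume "x \<in> convex hull e"
  then have "x \<in> convex hull {edge_start e, edge_end e}" using edge(2)[OF e] by simp
  then obtain u where u: "0 \<le> u" "u \<le> 1" "x = edge_start e + u *\<^sub>R (edge_end e - edge_start e)"
    unfolding convex_hull_2_alt by blast
  have "x = edge_point e (u * edge_length e)"
    using edge_length_pos[OF e] by (simp add: u(3) edge_point_def algebra_simps)
  moreover have "u * edge_length e \<in> {0..edge_length e}"
    using u edge_length_pos[OF e] by (simp add: mult_left_le_one_le)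
  ultimately show "x \<in> edge_point e ` {0..edge_length e}" by blast
qed (use edge_point_in[OF e] in blast)

text \<open>In the chart of the edge, the parametrization is affine between end points at distance
  \<open>edge_length e\<close>, and the chart preserves distances.\<close>

lemma edge_point_dist:
  assumes e: "e \<in> edges" and s: "s \<in> {0..edge_length e}" and t: "t \<in> {0..edge_length e}"
  shows "dist (\<phi> (edge_point e s)) (\<phi> (edge_point e t)) = \<bar>s - t\<bar>"
proof -
  note E = edge(1)[OF e] and l = edge_length_pos[OF e]
  let ?B = "\<kappa> e \<circ> \<phi>"
  have B: "?B (edge_point e s) = (1 - s / edge_length e) *\<^sub>R ?B (edge_start e) + (s / edge_length e) *\<^sub>R ?B (edge_end e)"
    if "s \<in> {0..edge_length e}" for s
  proof -
    define p q where "p = edge_start e" and "q = edge_end e"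
    have pq: "p \<noteq> q" "{p, q} \<subseteq> e" using edge(2,3)[OF e] by (auto simp: p_def q_def)
    have aff': "affine_on_simplex {p, q} ?B" by (rule affine_on_subset[OF aff[OF E] fin[OF E] pq(2)])
    define c where "c v = (if v = p then 1 - s / edge_length e else if v = q then s / edge_length e else 0)" for v
    have c: "bary {p, q} c" "(\<Sum>v\<in>{p, q}. c v *\<^sub>R v) = edge_point e s"
      "(\<Sum>v\<in>{p, q}. c v *\<^sub>R ?B v) = (1 - s / edge_length e) *\<^sub>R ?B p + (s / edge_length e) *\<^sub>R ?B q"
      using that l pq(1) by (auto simp: bary_def c_def edge_point_def p_def[symmetric] q_def[symmetric])
    show ?thesis using affine_on_simplexD[OF aff' c(1)] unfolding c(2,3) unfolding p_def q_def .
  qed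
  have "dist (\<phi> (edge_point e s)) (\<phi> (edge_point e t)) = dist (?B (edge_point e s)) (?B (edge_point e t))"
    using \<kappa>_dist[OF E edge_point_in[OF e s] edge_point_in[OF e t]] by simp
  also have "\<dots> = norm (((t - s) / edge_length e) *\<^sub>R (?B (edge_start e) - ?B (edge_end e)))"
    unfolding dist_norm B[OF s] B[OF t] by (simp add: algebra_simps diff_divide_distrib)
  also have "\<dots> = \<bar>t - s\<bar> / edge_length e * dist (?B (edge_start e)) (?B (edge_end e))"
    using l by (simp add: dist_norm)
  also have "dist (?B (edge_start e)) (?B (edge_end e)) = edge_length e"
    using \<kappa>_dist[OF E edge_vertices[OF e]] by (simp add: edge_length_def)
  finally show ?thesis using l by simp
qed

text \<open>A common point of two distinct edges lies in the hull of their common vertices, and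
  there is at most one such vertex.\<close>

lemma edge_cross:
  assumes e: "e \<in> edges" "e' \<in> edges" "e \<noteq> e'" and s: "s \<in> {0..edge_length e}" "t \<in> {0..edge_length e'}"
    and eq: "\<phi> (edge_point e s) = \<phi> (edge_point e' t)"
  shows "s = 0 \<or> s = edge_length e"
proof -
  note E = edge(1)[OF e(1)] edge(1)[OF e(2)]
  have "edge_point e s = edge_point e' t"
    by (rule \<phi>_inj[OF E edge_point_in[OF e(1) s(1)] edge_point_in[OF e(2) s(2)] eq])
  then have x: "edge_point e s \<in> convex hull e'" using edge_point_in[OF e(2) s(2)] by simp
  note r = vcomplex_hull_Int[OF V E edge_point_in[OF e(1) s(1)] x]
  have "e \<inter> e' \<noteq> e"
  proof
    assume "e \<inter> e' = e"
    then have "e \<subseteq> e'" by blast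
    then show False using e card_subset_eq[of e' e] fin[OF E(2)] by (auto simp: edges_def)
  qed
  then have "e \<inter> e' \<subset> e" by blast
  then obtain w where w: "w \<in> e" "w \<notin> e'" by blast
  define v where "v = (if w = edge_start e then edge_end e else edge_start e)"
  have v: "v \<in> e" "e \<inter> e' \<subseteq> {v}"
  proof -
    have "edge_start e \<in> e" "edge_end e \<in> e" using edge(2)[OF e(1)] by blast+
    then show "v \<in> e" by (simp add: v_def)
    have "x = v" if "x \<in> e" "x \<in> e'" for x
    proof -
      have "x = edge_start e \<or> x = edge_end e" "w = edge_start e \<or> w = edge_end e" "x \<noteq> w"
        using that w edge(2)[OF e(1)] by blast+
      then show ?thesis by (auto simp: v_def)
    qed
    then show "e \<inter> e' \<subseteq> {v}" by blast
  qed
  have "edge_point e s \<in> convex hull {v}" using r(2) hull_mono[OF v(2)] by blast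
  then have "edge_point e s = v" by simp
  moreover have "edge_point e 0 = edge_start e" "edge_point e (edge_length e) = edge_end e"
    using edge_length_pos[OF e(1)] by (auto simp: edge_point_def)
  ultimately have "edge_point e s = edge_point e 0 \<or> edge_point e s = edge_point e (edge_length e)"
    by (simp add: v_def)
  then have "dist (\<phi> (edge_point e s)) (\<phi> (edge_point e 0)) = 0 \<or>
      dist (\<phi> (edge_point e s)) (\<phi> (edge_point e (edge_length e))) = 0" by auto
  then show ?thesis
    using edge_point_dist[OF e(1) s(1), of 0] edge_point_dist[OF e(1) s(1), of "edge_length e"] edge_length_pos[OF e(1)] by auto
qed

lemma approximation:
  fixes g :: "'a \<Rightarrow> real^2"
  assumes lip: "L-lipschitz_on P g" "L < 1" and "0 < \<epsilon>"
  obtains f :: "'a \<Rightarrow> real^2" where "piecewise_distance_preserving_on P f" "\<And>x. x \<in> P \<Longrightarrow> dist (f x) (g x) < \<epsilon>"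
proof -
  have L0: "0 \<le> L" using lip(1) lipschitz_on_nonneg by blast
  define Wp where "Wp = \<phi> ` \<Union>\<V>"
  have vP: "\<phi> v \<in> P" if "v \<in> \<sigma>" "\<sigma> \<in> \<V>" for v \<sigma>
    unfolding image_P using that hull_inc[OF that(1)] by blast
  have finWp: "finite Wp" unfolding Wp_def using vcomplexD(1)[OF V] fin by blast
  have "Wp \<subseteq> P" unfolding Wp_def using vP by blast
  \<comment> \<open>The part of the gap from \<open>L\<close> to \<open>L'\<close> is spent on
    making the map constant near vertices, the rest from \<open>L'\<close> to 1 on the
    zigzags.\<close>
  obtain L' where L': "L < L'" "L' < 1" using dense[OF lip(2)] by blast
  obtain h R0 where h: "L'-lipschitz_on P h" "0 < R0" "\<And>p x. p \<in> Wp \<Longrightarrow> dist x p \<le> R0 \<Longrightarrow> h x = g p"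
    "\<And>x. x \<in> P \<Longrightarrow> dist (h x) (g x) < \<epsilon> / 2"
    using flatten_at_points[OF finWp \<open>Wp \<subseteq> P\<close> lip(1) L'(1), of "\<epsilon> / 2"] \<open>0 < \<epsilon>\<close> by (metis half_gt_zero)
  have hflat: "h x = h p" if "p \<in> Wp" "dist x p \<le> R0" for x p
    using h(3)[OF that] h(3)[OF that(1), of p] h(2) by simp
  \<comment> \<open>The final error is less than \<open>5 * \<epsilon>' + \<epsilon> / 2\<close>:
    twice \<open>2 * \<epsilon>'\<close> for the distance to a point with prescribed value, once for
    \<open>f\<close> and once for \<open>h\<close>, then \<open>\<epsilon>'\<close> for the value
    itself and \<open>\<epsilon> / 2\<close> for the flattening.\<close>
  define \<epsilon>' where "\<epsilon>' = \<epsilon> / 12"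
  have e': "0 < \<epsilon>'" using \<open>0 < \<epsilon>\<close> by (simp add: \<epsilon>'_def)
  have "\<exists>N. finite N \<and> N \<subseteq> \<phi> ` (convex hull \<sigma>) \<and> (\<forall>x\<in>\<phi> ` (convex hull \<sigma>). \<exists>n\<in>N. dist n x < \<epsilon>')" if "\<sigma> \<in> \<V>" for \<sigma>
    using compact_finite_net[OF compact_simplex[OF that] e'] by metis
  then obtain net where net: "\<And>\<sigma>. \<sigma> \<in> \<V> \<Longrightarrow> finite (net \<sigma>)" "\<And>\<sigma>. \<sigma> \<in> \<V> \<Longrightarrow> net \<sigma> \<subseteq> \<phi> ` (convex hull \<sigma>)"
    "\<And>\<sigma> x. \<sigma> \<in> \<V> \<Longrightarrow> x \<in> \<phi> ` (convex hull \<sigma>) \<Longrightarrow> \<exists>n\<in>net \<sigma>. dist n x < \<epsilon>'" by metis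
  \<comment> \<open>The vertices are included so that a vertex on no edge also receives a prescribed
    value.\<close>
  define N0 where "N0 = (\<Union>\<sigma>\<in>\<V>. net \<sigma>) \<union> Wp"
  have N0: "finite N0" "N0 \<subseteq> P"
  proof -
    show "finite N0" unfolding N0_def using net(1) vcomplexD(1)[OF V] finWp by blast
    have "net \<sigma> \<subseteq> P" if "\<sigma> \<in> \<V>" for \<sigma> unfolding image_P using net(2)[OF that] that by blast
    then show "N0 \<subseteq> P" unfolding N0_def using \<open>Wp \<subseteq> P\<close> by blast
  qed
  have ends: "edge_point e 0 = edge_start e" "edge_point e (edge_length e) = edge_end e" if "e \<in> edges" for e
    using edge_length_pos[OF that] by (auto simp: edge_point_def)
  have endW: "\<phi> (edge_start e) \<in> Wp" "\<phi> (edge_end e) \<in> Wp" if "e \<in> edges" for e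
    unfolding Wp_def using edge(1,2)[OF that] by blast+
  define \<gamma> where "\<gamma> e s = \<phi> (edge_point e s)" for e s
  have \<gamma>img: "\<gamma> e ` {0..edge_length e} = \<phi> ` (convex hull e)" if "e \<in> edges" for e
    unfolding \<gamma>_def edge_point_image[OF that, symmetric] image_image ..
  obtain G where G: "finite G" "\<And>x v. (x, v) \<in> G \<Longrightarrow> x \<in> P \<and> dist v (h x) < \<epsilon>'"
    "\<And>x v y w. (x, v) \<in> G \<Longrightarrow> (y, w) \<in> G \<Longrightarrow> dist v w \<le> dist x y"
    "\<And>e s. e \<in> edges \<Longrightarrow> s \<in> {0..edge_length e} \<Longrightarrow> \<exists>t v t' w. (\<gamma> e t, v) \<in> G \<and> (\<gamma> e t', w) \<in> G \<and>
      0 \<le> t \<and> t \<le> s \<and> s \<le> t' \<and> t' \<le> edge_length e \<and> t' - t < \<epsilon>' \<and> dist v w = t' - t"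
    "\<And>e. e \<in> edges \<Longrightarrow> (\<gamma> e 0, h (\<gamma> e 0)) \<in> G \<and> (\<gamma> e (edge_length e), h (\<gamma> e (edge_length e))) \<in> G"
    "\<And>n. n \<in> N0 \<Longrightarrow> (\<And>e. e \<in> edges \<Longrightarrow> n \<notin> \<gamma> e ` {0..edge_length e}) \<Longrightarrow> (n, h n) \<in> G"
  proof (rule edge_data[where \<gamma> = \<gamma> and I = edges and l = edge_length and P = P and h = h and L = L' and ?R0.0 = R0 and ?N0.0 = N0 and \<epsilon> = \<epsilon>'])
    show "2 \<le> DIM(real^2)" by simp
    show "finite edges" unfolding edges_def using vcomplexD(1)[OF V] by simp
    show "0 < edge_length e" if "e \<in> edges" for e by (rule edge_length_pos[OF that])
    show "dist (\<gamma> e s) (\<gamma> e t) = \<bar>s - t\<bar>" if "e \<in> edges" "s \<in> {0..edge_length e}" "t \<in> {0..edge_length e}" for e s t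
      unfolding \<gamma>_def by (rule edge_point_dist[OF that])
    show "\<gamma> e s \<in> P" if "e \<in> edges" "s \<in> {0..edge_length e}" for e s
      unfolding image_P \<gamma>_def using edge_point_in[OF that] edge(1)[OF that(1)] by blast
    show "(s = 0 \<or> s = edge_length e) \<and> (t = 0 \<or> t = edge_length e')"
      if "e \<in> edges" "e' \<in> edges" "e \<noteq> e'" "s \<in> {0..edge_length e}" "t \<in> {0..edge_length e'}" "\<gamma> e s = \<gamma> e' t" for e e' s t
      using edge_cross[OF that(1-5)] edge_cross[OF that(2,1) that(3)[symmetric] that(5,4)] that(6) by (simp add: \<gamma>_def)
    show "h x = h (\<gamma> e 0)" if "e \<in> edges" "dist x (\<gamma> e 0) \<le> R0" for e x
      using hflat[OF endW(1)[OF that(1)], of x] that(2) ends[OF that(1)] by (simp add: \<gamma>_def)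
    show "h x = h (\<gamma> e (edge_length e))" if "e \<in> edges" "dist x (\<gamma> e (edge_length e)) \<le> R0" for e x
      using hflat[OF endW(2)[OF that(1)], of x] that(2) ends[OF that(1)] by (simp add: \<gamma>_def)
  qed (use h(1,2) L'(2) N0 e' in blast)+
  have vert: "(\<phi> v, h (\<phi> v)) \<in> G" if v: "{v} \<in> \<V>" for v
  proof (cases "\<exists>e\<in>edges. \<phi> v \<in> \<phi> ` (convex hull e)")
    case False
    have "\<phi> v \<in> N0" using v by (auto simp: N0_def Wp_def)
    then show ?thesis by (rule G(6)) (use False \<gamma>img in blast)
  next
    case True
    then obtain e where e: "e \<in> edges" "\<phi> v \<in> \<phi> ` (convex hull e)" by blast
    have "{v} \<inter> e \<in> \<V>" by (rule image_Int(1)[OF v edge(1)[OF e(1)] _ e(2)]) simp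
    then have "v \<in> e" using vcomplexD(3)[OF V] by blast
    then have "v = edge_start e \<or> v = edge_end e" using edge(2)[OF e(1)] by blast
    then show ?thesis using G(5)[OF e(1)] ends[OF e(1)] by (auto simp: \<gamma>_def)
  qed
  \<comment> \<open>Every point of a vertex or an edge lies between two points with prescribed
    values that are as far apart as the points. For a vertex both points are \<open>y\<close> itself
    and all distances are 0.\<close>
  have pin: "\<exists>x v x' w. (x, v) \<in> G \<and> (x', w) \<in> G \<and> x \<in> \<phi> ` (convex hull \<rho>) \<and> x' \<in> \<phi> ` (convex hull \<rho>) \<and>
      dist v w = dist y x + dist y x' \<and> dist y x < \<epsilon>'"
    if \<rho>: "\<rho> \<in> \<V>" "card \<rho> \<le> 2" "y \<in> \<phi> ` (convex hull \<rho>)" for \<rho> y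
  proof (cases "card \<rho> = 2")
    case True
    then have e: "\<rho> \<in> edges" using \<rho> by (simp add: edges_def)
    then obtain s where s: "s \<in> {0..edge_length \<rho>}" "y = \<gamma> \<rho> s" using \<rho>(3) \<gamma>img[OF e] by blast
    obtain t v t' w where t: "(\<gamma> \<rho> t, v) \<in> G" "(\<gamma> \<rho> t', w) \<in> G" "0 \<le> t" "t \<le> s" "s \<le> t'" "t' \<le> edge_length \<rho>"
      "t' - t < \<epsilon>'" "dist v w = t' - t" using G(4)[OF e s(1)] by blast
    have m: "t \<in> {0..edge_length \<rho>}" "t' \<in> {0..edge_length \<rho>}" using t by auto
    have "dist y (\<gamma> \<rho> t) = s - t" "dist y (\<gamma> \<rho> t') = t' - s"
      using edge_point_dist[OF e s(1) m(1)] edge_point_dist[OF e s(1) m(2)] t by (simp_all add: s(2) \<gamma>_def)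
    then have "dist v w = dist y (\<gamma> \<rho> t) + dist y (\<gamma> \<rho> t') \<and> dist y (\<gamma> \<rho> t) < \<epsilon>'" using t by auto
    moreover have "\<gamma> \<rho> t \<in> \<phi> ` (convex hull \<rho>)" "\<gamma> \<rho> t' \<in> \<phi> ` (convex hull \<rho>)" using \<gamma>img[OF e] m by blast+
    ultimately show ?thesis using t(1,2) by blast
  next
    case False
    have "card \<rho> \<noteq> 0" using fin[OF \<rho>(1)] vcomplexD(3)[OF V \<rho>(1)] by simp
    then have "card \<rho> = 1" using False \<rho>(2) by simp
    then obtain v where v: "\<rho> = {v}" using card_1_singletonE by blast
    then have "y = \<phi> v" using \<rho>(3) by simp
    then show ?thesis using vert[of v] \<rho>(1,3) v e' by (intro exI[of _ y] exI[of _ "h y"]) auto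
  qed
  define R where "R \<sigma> p \<longleftrightarrow> piecewise_isometric (fst p) (fst (snd p)) (snd (snd p)) \<and> convex (fst p) \<and>
      (\<forall>x\<in>convex hull \<sigma>. \<kappa> \<sigma> (\<phi> x) \<in> fst p) \<and>
      (\<forall>x v. (x, v) \<in> G \<longrightarrow> x \<in> \<phi> ` (convex hull \<sigma>) \<longrightarrow> snd (snd p) (\<kappa> \<sigma> x) = v)" for \<sigma> p
  have "\<exists>p. R \<sigma> p" if s: "\<sigma> \<in> \<V>" for \<sigma>
  proof -
    define D where "D = (\<lambda>z. (\<kappa> \<sigma> (fst z), snd z)) ` {z \<in> G. fst z \<in> \<phi> ` (convex hull \<sigma>)}"
    have "finite D" using G(1) by (simp add: D_def)
    have D: "\<exists>x. (x, b) \<in> G \<and> x \<in> \<phi> ` (convex hull \<sigma>) \<and> a = \<kappa> \<sigma> x" if "(a, b) \<in> D" for a b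
      using that unfolding D_def by force
    have "dist b b' \<le> dist a a'" if ab: "(a, b) \<in> D" "(a', b') \<in> D" for a b a' b'
    proof -
      obtain x x' where x: "(x, b) \<in> G" "x \<in> \<phi> ` (convex hull \<sigma>)" "a = \<kappa> \<sigma> x"
        "(x', b') \<in> G" "x' \<in> \<phi> ` (convex hull \<sigma>)" "a' = \<kappa> \<sigma> x'" using D[OF ab(1)] D[OF ab(2)] by blast
      have "dist a a' = dist x x'" using dp[OF s] x unfolding distance_preserving_on_def by blast
      then show ?thesis using G(3)[OF x(1,4)] by simp
    qed
    note shortD = this
    have "compact (\<kappa> \<sigma> ` \<phi> ` (convex hull \<sigma>))"
      by (rule compact_continuous_image[OF distance_preserving_continuous[OF dp[OF s]] compact_simplex[OF s]])
    then obtain r where r: "\<And>x. x \<in> \<kappa> \<sigma> ` \<phi> ` (convex hull \<sigma>) \<Longrightarrow> norm x \<le> r"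
      using compact_imp_bounded bounded_iff by metis
    have "\<exists>Q \<C> F. piecewise_isometric Q \<C> F \<and> convex Q \<and> cball 0 r \<subseteq> Q \<and> (\<forall>a b. (a, b) \<in> D \<longrightarrow> F a = b)"
    proof (rule brehm_extension[where G = D and r = r])
      show "dist b b' \<le> dist a a'" if "(a, b) \<in> D" "(a', b') \<in> D" for a b a' b' by (rule shortD[OF that])
    qed (fact \<open>finite D\<close>, blast)
    then obtain Q \<C> F where F: "piecewise_isometric Q \<C> F" "convex Q" "cball 0 r \<subseteq> Q"
      "\<And>a b. (a, b) \<in> D \<Longrightarrow> F a = b" by blast
    have "F (\<kappa> \<sigma> x) = v" if "(x, v) \<in> G" "x \<in> \<phi> ` (convex hull \<sigma>)" for x v
    proof -
      have "(\<kappa> \<sigma> x, v) \<in> D" unfolding D_def using that by force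
      then show ?thesis using F(4) by blast
    qed
    moreover have "\<kappa> \<sigma> (\<phi> x) \<in> Q" if "x \<in> convex hull \<sigma>" for x
      using r[of "\<kappa> \<sigma> (\<phi> x)"] F(3) that by force
    ultimately have "R \<sigma> (Q, \<C>, F)" using F(1,2) by (simp add: R_def)
    then show ?thesis by blast
  qed
  then obtain q where q: "\<And>\<sigma>. \<sigma> \<in> \<V> \<Longrightarrow> R \<sigma> (q \<sigma>)" by metis
  define Q \<C> F where "Q \<sigma> = fst (q \<sigma>)" and "\<C> \<sigma> = fst (snd (q \<sigma>))" and "F \<sigma> = snd (snd (q \<sigma>))" for \<sigma>
  have F: "\<And>\<sigma>. \<sigma> \<in> \<V> \<Longrightarrow> piecewise_isometric (Q \<sigma>) (\<C> \<sigma>) (F \<sigma>)" "\<And>\<sigma>. \<sigma> \<in> \<V> \<Longrightarrow> convex (Q \<sigma>)"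
    "\<And>\<sigma> x. \<sigma> \<in> \<V> \<Longrightarrow> x \<in> convex hull \<sigma> \<Longrightarrow> \<kappa> \<sigma> (\<phi> x) \<in> Q \<sigma>"
    and FG: "\<And>\<sigma> x v. \<sigma> \<in> \<V> \<Longrightarrow> (x, v) \<in> G \<Longrightarrow> x \<in> \<phi> ` (convex hull \<sigma>) \<Longrightarrow> F \<sigma> (\<kappa> \<sigma> x) = v"
    using q[unfolded R_def, folded Q_def \<C>_def F_def] by blast+
  have Flip: "dist (F \<sigma> (\<kappa> \<sigma> x)) (F \<sigma> (\<kappa> \<sigma> y)) \<le> dist x y"
    if s: "\<sigma> \<in> \<V>" and xy: "x \<in> \<phi> ` (convex hull \<sigma>)" "y \<in> \<phi> ` (convex hull \<sigma>)" for \<sigma> x y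
  proof -
    have "dist (F \<sigma> (\<kappa> \<sigma> x)) (F \<sigma> (\<kappa> \<sigma> y)) \<le> dist (\<kappa> \<sigma> x) (\<kappa> \<sigma> y)"
      by (rule piecewise_isometric_nonexpanding[OF F(1)[OF s] F(2)[OF s]]) (use F(3)[OF s] xy in blast)+
    also have "\<dots> = dist x y" using dp[OF s] xy unfolding distance_preserving_on_def by blast
    finally show ?thesis .
  qed
  \<comment> \<open>Both extensions are non-expanding and take the prescribed values at the two
    points from \<open>pin\<close>, so \<open>inner_between_unique\<close> fixes their common value
    at \<open>y\<close>. A face with three vertices is all of \<open>\<sigma>\<close>.\<close>
  have face: "F \<sigma> (\<kappa> \<sigma> y) = F \<rho> (\<kappa> \<rho> y)" if s: "\<sigma> \<in> \<V>" "\<rho> \<in> \<V>" "\<rho> \<subseteq> \<sigma>" and y: "y \<in> \<phi> ` (convex hull \<rho>)" for \<sigma> \<rho> y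
  proof (cases "card \<rho> \<le> 2")
    case True
    obtain x v x' w where p: "(x, v) \<in> G" "(x', w) \<in> G" "x \<in> \<phi> ` (convex hull \<rho>)" "x' \<in> \<phi> ` (convex hull \<rho>)"
      "dist v w = dist y x + dist y x'" using pin[OF s(2) True y] by blast
    have sub: "\<phi> ` (convex hull \<rho>) \<subseteq> \<phi> ` (convex hull \<sigma>)" using hull_mono[OF s(3)] by blast
    have near: "dist (F \<tau> (\<kappa> \<tau> y)) v \<le> dist y x \<and> dist (F \<tau> (\<kappa> \<tau> y)) w \<le> dist y x'"
      if t: "\<tau> \<in> \<V>" "\<phi> ` (convex hull \<rho>) \<subseteq> \<phi> ` (convex hull \<tau>)" for \<tau>
    proof -
      have m: "x \<in> \<phi> ` (convex hull \<tau>)" "x' \<in> \<phi> ` (convex hull \<tau>)" "y \<in> \<phi> ` (convex hull \<tau>)"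
        using p(3,4) y t(2) by blast+
      show ?thesis
        using Flip[OF t(1) m(3,1)] Flip[OF t(1) m(3,2)] FG[OF t(1) p(1) m(1)] FG[OF t(1) p(2) m(2)] by simp
    qed
    show ?thesis
      by (rule inner_between_unique[OF _ _ _ _ p(5)]) (use near[OF s(1) sub] near[OF s(2)] in auto)
  next
    case False
    then have "card \<sigma> \<le> card \<rho>" using card3[OF s(1)] by simp
    then have "\<rho> = \<sigma>" by (rule card_seteq[OF fin[OF s(1)] s(3)])
    then show ?thesis by simp
  qed
  define f where "f y = (let \<sigma> = SOME \<sigma>. \<sigma> \<in> \<V> \<and> y \<in> \<phi> ` (convex hull \<sigma>) in F \<sigma> (\<kappa> \<sigma> y))" for y
  have f: "f y = F \<sigma> (\<kappa> \<sigma> y)" if s: "\<sigma> \<in> \<V>" and y: "y \<in> \<phi> ` (convex hull \<sigma>)" for \<sigma> y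
  proof -
    define \<tau> where "\<tau> = (SOME \<sigma>. \<sigma> \<in> \<V> \<and> y \<in> \<phi> ` (convex hull \<sigma>))"
    have "\<tau> \<in> \<V> \<and> y \<in> \<phi> ` (convex hull \<tau>)" unfolding \<tau>_def by (rule someI[of _ \<sigma>]) (use s y in simp)
    then have t: "\<tau> \<in> \<V>" "y \<in> \<phi> ` (convex hull \<tau>)" by auto
    note r = image_Int[OF s t(1) y t(2)]
    have "F \<sigma> (\<kappa> \<sigma> y) = F \<tau> (\<kappa> \<tau> y)"
      using face[OF s r(1) _ r(2)] face[OF t(1) r(1) _ r(2)] by simp
    then show ?thesis by (simp add: f_def \<tau>_def[symmetric])
  qed
  obtain \<V>' where V': "subdivides \<V>' \<V>" "\<And>\<sigma>'. \<sigma>' \<in> \<V>' \<Longrightarrow> distance_preserving_on (\<phi> ` (convex hull \<sigma>')) f"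
  proof (rule subdivision_for_pieces[OF F(1) F(3)])
    show "f (\<phi> x) = F \<sigma> (\<kappa> \<sigma> (\<phi> x))" if "\<sigma> \<in> \<V>" "x \<in> convex hull \<sigma>" for \<sigma> x
      using f that by blast
    fix \<V>' assume *: "subdivides \<V>' \<V>" "\<And>\<sigma>'. \<sigma>' \<in> \<V>' \<Longrightarrow> distance_preserving_on (\<phi> ` (convex hull \<sigma>')) f"
    show thesis by (rule that[OF *])
  qed
  have "piecewise_distance_preserving_on P f"
    unfolding piecewise_distance_preserving_on_def
    using subdivision_polyhedral[OF V'(1)] V'(2) by blast
  moreover have "dist (f y) (g y) < \<epsilon>" if yP: "y \<in> P" for y
  proof -
    obtain \<sigma> where s: "\<sigma> \<in> \<V>" "y \<in> \<phi> ` (convex hull \<sigma>)" using yP unfolding image_P by blast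
    obtain n where n: "n \<in> net \<sigma>" "dist n y < \<epsilon>'" using net(3)[OF s] by blast
    have n\<sigma>: "n \<in> \<phi> ` (convex hull \<sigma>)" using net(2)[OF s(1)] n(1) by blast
    \<comment> \<open>A net point on an edge may lack a prescribed value; a nearby breakpoint
      replaces it. It is sought on the face \<open>\<sigma> \<inter> e\<close>, because
      \<open>e\<close> may leave \<open>\<sigma>\<close> and the breakpoint has to lie in
      \<open>\<sigma>\<close>.\<close>
    have "\<exists>x v. (x, v) \<in> G \<and> x \<in> \<phi> ` (convex hull \<sigma>) \<and> dist n x < \<epsilon>'"
    proof (cases "\<exists>e\<in>edges. n \<in> \<phi> ` (convex hull e)")
      case False
      have "n \<in> N0" using n(1) s(1) by (auto simp: N0_def)
      then have "(n, h n) \<in> G" by (rule G(6)) (use False \<gamma>img in blast)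
      then show ?thesis using n\<sigma> e' by (intro exI[of _ n] exI[of _ "h n"]) auto
    next
      case True
      then obtain e where e: "e \<in> edges" "n \<in> \<phi> ` (convex hull e)" by blast
      note r = image_Int[OF s(1) edge(1)[OF e(1)] n\<sigma> e(2)]
      have "card (\<sigma> \<inter> e) \<le> card e" by (rule card_mono[OF fin[OF edge(1)[OF e(1)]]]) blast
      then have "card (\<sigma> \<inter> e) \<le> 2" using e(1) by (simp add: edges_def)
      then obtain x v where x: "(x, v) \<in> G" "x \<in> \<phi> ` (convex hull (\<sigma> \<inter> e))" "dist n x < \<epsilon>'"
        using pin[OF r(1) _ r(2)] by blast
      moreover have "x \<in> \<phi> ` (convex hull \<sigma>)" using x(2) hull_mono[of "\<sigma> \<inter> e" \<sigma> convex] by blast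
      ultimately show ?thesis by blast
    qed
    then obtain x v where x: "(x, v) \<in> G" "x \<in> \<phi> ` (convex hull \<sigma>)" "dist n x < \<epsilon>'" by blast
    have "dist y x \<le> dist n y + dist n x" by (metis dist_commute dist_triangle)
    then have yx: "dist y x < 2 * \<epsilon>'" using n(2) x(3) by linarith
    have xP: "x \<in> P" and vx: "dist v (h x) < \<epsilon>'" using G(2)[OF x(1)] by auto
    have "dist (f y) v \<le> dist y x"
      using Flip[OF s(1) s(2) x(2)] f[OF s] FG[OF s(1) x(1,2)] by simp
    moreover have "dist (h x) (h y) \<le> dist y x"
    proof -
      have "dist (h x) (h y) \<le> L' * dist x y" by (rule lipschitz_onD[OF h(1) xP yP])
      also have "\<dots> \<le> 1 * dist x y" using L'(2) by (intro mult_right_mono) auto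
      finally show ?thesis by (simp add: dist_commute)
    qed
    moreover have "dist (f y) (g y) \<le> dist (f y) v + dist v (h x) + dist (h x) (h y) + dist (h y) (g y)"
      using dist_triangle[of "f y" "g y" v] dist_triangle[of v "g y" "h x"] dist_triangle[of "h x" "g y" "h y"] by linarith
    moreover have "dist (h y) (g y) < \<epsilon> / 2" by (rule h(4)[OF yP])
    ultimately show ?thesis using yx vx e' by (simp add: \<epsilon>'_def)
  qed
  ultimately show ?thesis by (rule that)
qed

end

theorem mainTheorem3:
  fixes P :: "'a::metric_space set" and h :: "'a \<Rightarrow> real^2"
  assumes "polyhedral_space P"
    and "has_polyhedral_dim P 2"
    and "distance_nonexpanding_on P h"
    and "piecewise_linear_on P h"
  shows "\<forall>\<epsilon>>0. \<exists>f :: 'a \<Rightarrow> real^2.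
    piecewise_distance_preserving_on P f \<and> (\<forall>x\<in>P. norm (f x - h x) < \<epsilon>)"
proof (intro allI impI)
  fix \<epsilon> :: real assume "0 < \<epsilon>"
  obtain \<V> n \<phi> \<psi> where T: "vcomplex \<V>" "(\<Union>\<sigma>\<in>\<V>. convex hull \<sigma>) \<subseteq> Rn n"
    "homeomorphism (\<Union>\<sigma>\<in>\<V>. convex hull \<sigma>) P \<phi> \<psi>" "\<And>\<sigma>. \<sigma> \<in> \<V> \<Longrightarrow> card \<sigma> \<le> 3"
    "\<And>\<sigma>. \<sigma> \<in> \<V> \<Longrightarrow> \<exists>\<kappa>::'a \<Rightarrow> real^2. distance_preserving_on (\<phi> ` (convex hull \<sigma>)) \<kappa> \<and> affine_on_simplex \<sigma> (\<kappa> \<circ> \<phi>)"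
    using flat_triangulation_exists[OF assms(2,4)] by metis
  obtain \<kappa> :: "fseq set \<Rightarrow> 'a \<Rightarrow> real^2" where k: "\<And>\<sigma>. \<sigma> \<in> \<V> \<Longrightarrow> distance_preserving_on (\<phi> ` (convex hull \<sigma>)) (\<kappa> \<sigma>)"
    "\<And>\<sigma>. \<sigma> \<in> \<V> \<Longrightarrow> affine_on_simplex \<sigma> (\<kappa> \<sigma> \<circ> \<phi>)"
    using T(5) by metis
  interpret flat_triangulation \<V> n \<phi> \<psi> P \<kappa>
    by unfold_locales (fact T k)+
  have h: "1-lipschitz_on P h"
    using assms(3) by (intro lipschitz_onI) (auto simp: distance_nonexpanding_on_def)
  have "compact (h ` P)"
    by (rule compact_continuous_image[OF lipschitz_on_continuous_on[OF h] compact_P])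
  then obtain B where B: "0 < B" "\<And>x. x \<in> P \<Longrightarrow> norm (h x) \<le> B"
    using compact_imp_bounded bounded_pos by (metis image_eqI)
  \<comment> \<open>Scaling by \<open>1 - \<delta>\<close> gives the strict Lipschitz bound and
    moves \<open>h\<close> by at most \<open>\<delta> * B\<close>, hence by at most
    \<open>\<epsilon> / 2\<close>. The bound \<open>1/2\<close> keeps the factor positive.\<close>
  define \<delta> where "\<delta> = min (1/2) (\<epsilon> / (2 * B))"
  have \<delta>: "0 < \<delta>" "\<delta> < 1" "\<delta> * B \<le> \<epsilon> / 2"
    using \<open>0 < \<epsilon>\<close> B(1) by (auto simp: \<delta>_def min_def field_simps)
  define g where "g x = (1 - \<delta>) *\<^sub>R h x" for x
  have "(1 - \<delta>)-lipschitz_on P g"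
  proof (rule lipschitz_onI)
    fix x y assume "x \<in> P" "y \<in> P"
    then have "dist (h x) (h y) \<le> dist x y" using assms(3) by (simp add: distance_nonexpanding_on_def)
    then show "dist (g x) (g y) \<le> (1 - \<delta>) * dist x y"
      using \<delta> by (simp add: g_def dist_norm scaleR_diff_right[symmetric] mult_left_mono)
  qed (use \<delta> in simp)
  then obtain f :: "'a \<Rightarrow> real^2" where f: "piecewise_distance_preserving_on P f" "\<And>x. x \<in> P \<Longrightarrow> dist (f x) (g x) < \<epsilon> / 2"
    using approximation[of "1 - \<delta>" g "\<epsilon> / 2"] \<delta> \<open>0 < \<epsilon>\<close> by (metis diff_less_eq half_gt_zero less_add_same_cancel1)
  have "norm (f x - h x) < \<epsilon>" if "x \<in> P" for x
  proof -
    have "g x - h x = (- \<delta>) *\<^sub>R h x" by (simp add: g_def algebra_simps)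
    then have "dist (g x) (h x) = \<delta> * norm (h x)" using \<delta> by (simp add: dist_norm)
    also have "\<dots> \<le> \<delta> * B" using B(2)[OF that] \<delta> by (intro mult_left_mono) auto
    finally have "dist (g x) (h x) \<le> \<epsilon> / 2" using \<delta> by simp
    then show ?thesis
      using f(2)[OF that] dist_triangle[of "f x" "h x" "g x"] by (simp add: dist_norm)
  qed
  then show "\<exists>f :: 'a \<Rightarrow> real^2. piecewise_distance_preserving_on P f \<and> (\<forall>x\<in>P. norm (f x - h x) < \<epsilon>)"
    using f(1) by blast
qed

end
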